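(* Fix a source schema $\mathcal{S}$ and a target schema $\mathcal{T}$. The class of c-acyclic LAV schema mappings over $\mathcal{S},\mathcal{T}$ is efficiently exactly learnable with membership queries: there is an algorithm that takes no input, has access to a membership oracle for an unknown goal c-acyclic LAV schema mapping $M$ over $\mathcal{S},\mathcal{T}$, always terminates and outputs a c-acyclic LAV schema mapping logically equivalent to $M$, and whose running time (counting each oracle call as one step) is bounded by a fixed polynomial in the size of $M$.
   Context: A LAV schema mapping is a triple $M=(\mathcal{S},\mathcal{T},\Sigma)$ where $\mathcal{S},\mathcal{T}$ are disjoint finite relational schemas and $\Sigma$ is a finite set of sentences $\forall\mathbf{x}(\alpha(\mathbf{x})\to\exists\mathbf{y}\,\phi(\mathbf{x},\mathbf{y}))$, $\alpha$ a single atom over $\mathcal{S}$, $\phi$ a conjunction of atoms over $\mathcal{T}$. A schema-mapping example is a pair $(I,J)$ of a finite $\mathcal{S}$-structure $I$ and a finite $\mathcal{T}$-structure $J$; it is positive for $M$ if $I\cup J$ satisfies $\Sigma$ and negative otherwise; two mappings are logically equivalent if they have the same positive examples. The membership oracle receives a schema-mapping example and answers whether it is positive for the goal mapping. The right-hand side $\exists\mathbf{y}\phi$ of a constraint has canonical structure with elements the variables $\mathbf{x},\mathbf{y}$, facts the atoms of $\phi$, and distinguished tuple $\mathbf{x}$. The incidence graph of a structure is the bipartite multigraph on its elements and facts with one edge per occurrence of an element in a fact; a structure is c-acyclic if every cycle of its incidence graph (including length-2 cycles from parallel edges) contains a distinguished element; a LAV mapping is c-acyclic if all canonical structures of right-hand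 sides of its constraints are c-acyclic. The size of $M$ is the length of its (smallest) representation. *)

theory Defs
  imports "HOL-Computational_Algebra.Polynomial"
begin

section \<open>Schemas, structures and schema mappings\<close>

text \<open>Relation symbols, elements and variables are natural numbers. A schema maps each of its
  relation symbols to its arity. An atom consists of a relation symbol and a list of variables,
  a fact of a relation symbol and a list of elements.\<close>

type_synonym schema = "nat \<Rightarrow> nat option"
type_synonym fact = "nat \<times> nat list"
type_synonym atom = "nat \<times> nat list"

definition is_schema :: "schema \<Rightarrow> bool" where
  "is_schema S \<longleftrightarrow> finite (dom S)"

record struct =
  elements :: "nat set"
  facts :: "fact set"

definition is_structure :: "schema \<Rightarrow> struct \<Rightarrow> bool" where
  "is_structure S A \<longleftrightarrow> finite (elements A) \<and> finite (facts A) \<and>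
     (\<forall>(r, as) \<in> facts A. S r = Some (length as) \<and> set as \<subseteq> elements A)"

definition struct_union :: "struct \<Rightarrow> struct \<Rightarrow> struct" where
  "struct_union A B =
     \<lparr>elements = elements A \<union> elements B, facts = facts A \<union> facts B\<rparr>"

text \<open>The constraint with left-hand side \<open>\<alpha>\<close> and right-hand side \<open>[\<phi>\<^sub>1, \<dots>, \<phi>\<^sub>n]\<close> stands for the
  sentence \<open>\<forall>x (\<alpha> \<longrightarrow> \<exists>y (\<phi>\<^sub>1 \<and> \<dots> \<and> \<phi>\<^sub>n))\<close>: the universally quantified variables are those
  occurring in \<open>\<alpha>\<close> (possibly repeatedly), the existentially quantified ones are the others
  occurring in some \<open>\<phi>\<^sub>i\<close>.\<close>

record lav_constraint =
  lhs :: atom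
  rhs :: "atom list"

type_synonym mapping = "lav_constraint set"

definition atom_vars :: "atom \<Rightarrow> nat set" where
  "atom_vars a = set (snd a)"

definition rhs_vars :: "lav_constraint \<Rightarrow> nat set" where
  "rhs_vars c = (\<Union>a \<in> set (rhs c). atom_vars a)"

definition atom_over :: "schema \<Rightarrow> atom \<Rightarrow> bool" where
  "atom_over S a \<longleftrightarrow> S (fst a) = Some (length (snd a))"

definition lav_mapping :: "schema \<Rightarrow> schema \<Rightarrow> mapping \<Rightarrow> bool" where
  "lav_mapping S T M \<longleftrightarrow> finite M \<and>
     (\<forall>c \<in> M. atom_over S (lhs c) \<and> (\<forall>a \<in> set (rhs c). atom_over T a))"

definition instantiate :: "(nat \<Rightarrow> nat) \<Rightarrow> atom \<Rightarrow> fact" where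
  "instantiate h a = (fst a, map h (snd a))"

definition satisfies :: "struct \<Rightarrow> lav_constraint \<Rightarrow> bool" where
  "satisfies A c \<longleftrightarrow>
     (\<forall>h. h ` atom_vars (lhs c) \<subseteq> elements A \<and> instantiate h (lhs c) \<in> facts A \<longrightarrow>
        (\<exists>h'. (\<forall>x \<in> atom_vars (lhs c). h' x = h x) \<and> h' ` rhs_vars c \<subseteq> elements A \<and>
              (\<forall>a \<in> set (rhs c). instantiate h' a \<in> facts A)))"

definition mapping_example :: "schema \<Rightarrow> schema \<Rightarrow> struct \<times> struct \<Rightarrow> bool" where
  "mapping_example S T e \<longleftrightarrow> is_structure S (fst e) \<and> is_structure T (snd e)"

definition positive :: "mapping \<Rightarrow> struct \<times> struct \<Rightarrow> bool" where
  "positive M e \<longleftrightarrow> (\<forall>c \<in> M. satisfies (struct_union (fst e) (snd e)) c)"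

definition logically_equivalent :: "schema \<Rightarrow> schema \<Rightarrow> mapping \<Rightarrow> mapping \<Rightarrow> bool" where
  "logically_equivalent S T M M' \<longleftrightarrow>
     (\<forall>e. mapping_example S T e \<longrightarrow> (positive M e \<longleftrightarrow> positive M' e))"


section \<open>C-acyclicity\<close>

text \<open>An edge of the incidence graph is an occurrence, i.e. a fact together with an argument
  position of it.\<close>

datatype vertex = Elem nat | Fact fact

type_synonym edge = "fact \<times> nat"

definition incidence_edges :: "struct \<Rightarrow> edge set" where
  "incidence_edges A = {(f, i). f \<in> facts A \<and> i < length (snd f)}"

definition endpoints :: "edge \<Rightarrow> vertex set" where
  "endpoints e = {Elem (snd (fst e) ! snd e), Fact (fst e)}"

text \<open>A cycle of a multigraph, given by its successive vertices and edges: vertices as well as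
  edges are pairwise distinct. Two parallel edges form a cycle of length 2; traversing a single
  edge back and forth does not.\<close>

definition incidence_cycle :: "struct \<Rightarrow> vertex list \<Rightarrow> edge list \<Rightarrow> bool" where
  "incidence_cycle A vs es \<longleftrightarrow>
     es \<noteq> [] \<and> length vs = length es \<and> distinct vs \<and> distinct es \<and>
     set es \<subseteq> incidence_edges A \<and>
     (\<forall>i < length es. endpoints (es ! i) = {vs ! i, vs ! (Suc i mod length es)})"

definition c_acyclic_structure :: "struct \<Rightarrow> nat list \<Rightarrow> bool" where
  "c_acyclic_structure A xs \<longleftrightarrow>
     (\<forall>vs es. incidence_cycle A vs es \<longrightarrow> (\<exists>x \<in> set xs. Elem x \<in> set vs))"

definition canonical_structure :: "lav_constraint \<Rightarrow> struct" where
  "canonical_structure c =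
     \<lparr>elements = atom_vars (lhs c) \<union> rhs_vars c, facts = set (rhs c)\<rparr>"

definition distinguished_tuple :: "lav_constraint \<Rightarrow> nat list" where
  "distinguished_tuple c = remdups (snd (lhs c))"

definition c_acyclic_lav_mapping :: "schema \<Rightarrow> schema \<Rightarrow> mapping \<Rightarrow> bool" where
  "c_acyclic_lav_mapping S T M \<longleftrightarrow> lav_mapping S T M \<and>
     (\<forall>c \<in> M. c_acyclic_structure (canonical_structure c) (distinguished_tuple c))"


section \<open>Size of a schema mapping\<close>

text \<open>Length is the number of occurrences of relation symbols and variables; the remaining symbols
  (quantifier prefixes, connectives) contribute at most a constant factor.\<close>

definition atom_length :: "atom \<Rightarrow> nat" where
  "atom_length a = 1 + length (snd a)"

definition mapping_length :: "mapping \<Rightarrow> nat" where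
  "mapping_length M = (\<Sum>c \<in> M. atom_length (lhs c) + sum_list (map atom_length (rhs c)))"

text \<open>The size is the length of a smallest representation in the class of c-acyclic LAV
  mappings.\<close>

definition mapping_size :: "schema \<Rightarrow> schema \<Rightarrow> mapping \<Rightarrow> nat" where
  "mapping_size S T M =
     (LEAST n. \<exists>M'. c_acyclic_lav_mapping S T M' \<and> logically_equivalent S T M M' \<and>
                    mapping_length M' = n)"


section \<open>Algorithms with access to a membership query\<close>

text \<open>The machine model is a first-order call-by-value functional language over binary trees
  (a fragment of pure Lisp). Variables are de Bruijn indices into the environment. A program is a
  list of function bodies, called by their position; a body is evaluated in the environment
  consisting of the argument values.\<close>

datatype val = Leaf | Node val val

datatype expr =
    EVar nat
  | ELeaf
  | ENode expr expr
  | ECase expr expr expr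
  | ELet expr expr
  | ECall nat "expr list"
  | EQuery expr

type_synonym program = "expr list"

definition val_of_bool :: "bool \<Rightarrow> val" where
  "val_of_bool b = (if b then Node Leaf Leaf else Leaf)"

text \<open>\<open>evaluates Q P env e v t\<close>: with membership query \<open>Q\<close>, expression \<open>e\<close> evaluates to \<open>v\<close> in
  time \<open>t\<close>. Every evaluation step takes time 1, including a query, except that building a tree
  takes time equal to the size of the tree built. Without this exception, sharing as in
  \<open>ELet e (ENode (EVar 0) (EVar 0))\<close> would produce exponentially large trees, and thus
  exponentially large queries, in polynomial time. With it, all values in play have size at most
  the elapsed time (see below), and the model is polynomially related to oracle Turing machines.\<close>

inductive
  evaluates :: "(val \<Rightarrow> bool) \<Rightarrow> program \<Rightarrow> val list \<Rightarrow> expr \<Rightarrow> val \<Rightarrow> nat \<Rightarrow> bool" and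
  evaluates_list :: "(val \<Rightarrow> bool) \<Rightarrow> program \<Rightarrow> val list \<Rightarrow> expr list \<Rightarrow> val list \<Rightarrow> nat \<Rightarrow> bool"
  for Q :: "val \<Rightarrow> bool" and P :: program
where
  ev_var: "i < length env \<Longrightarrow> evaluates Q P env (EVar i) (env ! i) 1"
| ev_leaf: "evaluates Q P env ELeaf Leaf 1"
| ev_node: "evaluates Q P env e1 v1 t1 \<Longrightarrow> evaluates Q P env e2 v2 t2 \<Longrightarrow>
    evaluates Q P env (ENode e1 e2) (Node v1 v2) (t1 + t2 + size (Node v1 v2))"
| ev_case_leaf: "evaluates Q P env e Leaf t1 \<Longrightarrow> evaluates Q P env e1 v t2 \<Longrightarrow>
    evaluates Q P env (ECase e e1 e2) v (t1 + t2 + 1)"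
| ev_case_node: "evaluates Q P env e (Node a b) t1 \<Longrightarrow> evaluates Q P (a # b # env) e2 v t2 \<Longrightarrow>
    evaluates Q P env (ECase e e1 e2) v (t1 + t2 + 1)"
| ev_let: "evaluates Q P env e1 u t1 \<Longrightarrow> evaluates Q P (u # env) e2 v t2 \<Longrightarrow>
    evaluates Q P env (ELet e1 e2) v (t1 + t2 + 1)"
| ev_call: "evaluates_list Q P env es us t1 \<Longrightarrow> f < length P \<Longrightarrow>
    evaluates Q P us (P ! f) v t2 \<Longrightarrow>
    evaluates Q P env (ECall f es) v (t1 + t2 + 1)"
| ev_query: "evaluates Q P env e v t \<Longrightarrow>
    evaluates Q P env (EQuery e) (val_of_bool (Q v)) (t + 1)"
| ev_nil: "evaluates_list Q P env [] [] 0"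
| ev_cons: "evaluates Q P env e v t1 \<Longrightarrow> evaluates_list Q P env es vs t2 \<Longrightarrow>
    evaluates_list Q P env (e # es) (v # vs) (t1 + t2)"

lemma evaluates_deterministic:
  shows "evaluates Q P env e v t \<Longrightarrow> evaluates Q P env e v' t' \<Longrightarrow> v' = v \<and> t' = t"
    and "evaluates_list Q P env es vs t \<Longrightarrow> evaluates_list Q P env es vs' t' \<Longrightarrow> vs' = vs \<and> t' = t"
proof (induction arbitrary: v' t' and vs' t' rule: evaluates_evaluates_list.inducts)
  case (ev_var i env)
  then show ?case by (auto elim: evaluates.cases)
next
  case (ev_leaf env)
  then show ?case by (auto elim: evaluates.cases)
next
  case (ev_node env e1 v1 t1 e2 v2 t2)
  from ev_node.prems ev_node.IH show ?case by cases blast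
next
  case (ev_case_leaf env e t1 e1 v t2 e2)
  from ev_case_leaf.prems ev_case_leaf.IH show ?case by cases blast+
next
  case (ev_case_node env e a b t1 e2 v t2 e1)
  from ev_case_node.prems ev_case_node.IH show ?case by cases blast+
next
  case (ev_let env e1 u t1 e2 v t2)
  from ev_let.prems ev_let.IH show ?case by cases blast
next
  case (ev_call env es us t1 f v t2)
  from ev_call.prems ev_call.IH show ?case by cases blast
next
  case (ev_query env e v t)
  from ev_query.prems ev_query.IH show ?case by cases blast
next
  case (ev_nil env)
  then show ?case by (auto elim: evaluates_list.cases)
next
  case (ev_cons env e v t1 es vs t2)
  from ev_cons.prems ev_cons.IH show ?case by cases blast
qed

lemma evaluates_size:
  shows "evaluates Q P env e v t \<Longrightarrow> \<forall>u \<in> set env. size u \<le> k \<Longrightarrow> size v \<le> k + t"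
    and "evaluates_list Q P env es vs t \<Longrightarrow> \<forall>u \<in> set env. size u \<le> k \<Longrightarrow>
           \<forall>v \<in> set vs. size v \<le> k + t"
proof (induction arbitrary: k and k rule: evaluates_evaluates_list.inducts)
  case (ev_var i env)
  then show ?case by (metis nth_mem trans_le_add1)
next
  case (ev_case_node env e a b t1 e2 v t2 e1)
  have "size (Node a b) \<le> k + t1" using ev_case_node by blast
  then have "\<forall>u \<in> set (a # b # env). size u \<le> k + t1"
    using ev_case_node.prems by (auto intro: trans_le_add1)
  then have "size v \<le> k + t1 + t2" using ev_case_node by blast
  then show ?case by simp
next
  case (ev_let env e1 u t1 e2 v t2)
  have "\<forall>w \<in> set (u # env). size w \<le> k + t1"
    using ev_let.prems ev_let.IH by (auto intro: trans_le_add1)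
  then have "size v \<le> k + t1 + t2" using ev_let by blast
  then show ?case by simp
next
  case (ev_call env es us t1 f v t2)
  then have "size v \<le> k + t1 + t2" by blast
  then show ?case by simp
next
  case (ev_case_leaf env e t1 e1 v t2 e2)
  then show ?case by fastforce
next
  case (ev_cons env e v t1 es vs t2)
  then show ?case by fastforce
qed (auto simp: val_of_bool_def)

text \<open>A program takes no input: it is run by calling function 0 without arguments.\<close>

definition outputs_in_time :: "(val \<Rightarrow> bool) \<Rightarrow> program \<Rightarrow> val \<Rightarrow> nat \<Rightarrow> bool" where
  "outputs_in_time Q P v t \<longleftrightarrow> evaluates Q P [] (ECall 0 []) v t"


section \<open>Encoding of queries and outputs\<close>

fun encode_list :: "('a \<Rightarrow> val) \<Rightarrow> 'a list \<Rightarrow> val" where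
  "encode_list enc [] = Leaf"
| "encode_list enc (x # xs) = Node (enc x) (encode_list enc xs)"

definition encode_nat :: "nat \<Rightarrow> val" where
  "encode_nat n = encode_list (\<lambda>_. Leaf) [0..<n]"

definition encode_fact :: "fact \<Rightarrow> val" where
  "encode_fact f = Node (encode_nat (fst f)) (encode_list encode_nat (snd f))"

definition encode_constraint :: "lav_constraint \<Rightarrow> val" where
  "encode_constraint c = Node (encode_fact (lhs c)) (encode_list encode_fact (rhs c))"

text \<open>Finite sets are represented by lists, so a structure or mapping has several encodings.\<close>

definition represents_structure :: "val \<Rightarrow> struct \<Rightarrow> bool" where
  "represents_structure v A \<longleftrightarrow>
     (\<exists>ds fs. set ds = elements A \<and> set fs = facts A \<and>
              v = Node (encode_list encode_nat ds) (encode_list encode_fact fs))"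

definition represents_example :: "val \<Rightarrow> struct \<times> struct \<Rightarrow> bool" where
  "represents_example v e \<longleftrightarrow>
     (\<exists>a b. v = Node a b \<and> represents_structure a (fst e) \<and> represents_structure b (snd e))"

definition represents_mapping :: "val \<Rightarrow> mapping \<Rightarrow> bool" where
  "represents_mapping v M \<longleftrightarrow> (\<exists>cs. set cs = M \<and> v = encode_list encode_constraint cs)"

text \<open>Values that do not represent an example are answered negatively.\<close>

definition membership_query :: "schema \<Rightarrow> schema \<Rightarrow> mapping \<Rightarrow> val \<Rightarrow> bool" where
  "membership_query S T M v \<longleftrightarrow>
     (\<exists>e. mapping_example S T e \<and> represents_example v e \<and> positive M e)"

end

theory Submission
  imports Defs
begin

text \<open>
For a source fact \<open>\<alpha> = R(a\<^sub>1, \<dots>, a\<^sub>k)\<close> the examples \<open>({\<alpha>}, J)\<close> that are positive for \<open>M\<close> are those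
into which a certain conjunctive query \<open>q\<close> maps, namely the conjunction of all right-hand sides whose
left-hand side matches \<open>\<alpha>\<close>. It suffices to learn \<open>q\<close> up to homomorphic equivalence for each of the
finitely many equality patterns \<open>\<alpha>\<close>. A hypothesis is a positive \<open>J\<close> that is minimal under deletion of
facts, so that \<open>q\<close> maps onto it and \<open>J\<close> is no larger than \<open>q\<close>. Initially it is a minimal part of the
structure of all facts over the constants and one further element. There are two ways of replacing
\<open>J\<close> by some \<open>J'\<close> that maps to it. A double cover of \<open>J\<close>, with the sheets interchanged at one
occurrence of an element in a fact, is always positive because \<open>q\<close> is acyclic. The frontier of a
component \<open>C\<close> of \<open>J\<close> is positive unless \<open>C\<close> maps to \<open>q\<close>. If a minimal positive part of \<open>J'\<close> is not
larger than \<open>J\<close>, then \<open>J\<close> embeds into \<open>J'\<close> as a section. No cycle has a section into the double cover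
at one of its edges, and an acyclic component has none into its frontier. Hence, as long as \<open>J\<close> is
not acyclic and equivalent to \<open>q\<close>, one of these steps yields a larger hypothesis; since the size of
\<open>J\<close> is bounded by that of \<open>q\<close>, this ends after linearly many rounds.

The algorithm consists of folds over lists whose results have polynomially bounded size, and one
unbounded loop. Functions of the former kind are closed under composition and bounded folds, so that
a program and its time bound are obtained from the definition of the function.
\<close>

section \<open>Typed encodings\<close>

text \<open>The algorithm never searches for a homomorphism, which would be intractable in general:
  only the oracle decides such questions, and progress is measured by counting. Counting suffices
  because hypotheses are minimal. The projection of a refinement to \<open>J\<close> is a
  homomorphism, so the image of a positive part is a positive part of \<open>J\<close>, hence all of
  \<open>J\<close>; if that part is not larger than \<open>J\<close>, its existential elements
  correspond one to one to those of \<open>J\<close>, and the inverse is the section. Such a section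
  is a choice of one label per element, and both obstructions speak of such choices: a colouring
  that changes at a single edge of a cycle, and a walk in a finite tree that never turns back.

  The hypothesis may have cycles through existential elements although the query has none, since the
  map of the query onto it may identify variables. Therefore double covers come in addition to
  frontiers, whose analysis presupposes acyclic components.

  Both constructions have polynomial size because the schemas, and with them the arity bound
  \<open>r\<close>, are fixed.\<close>

class enc =
  fixes enc :: "'a \<Rightarrow> val"
  assumes enc_eq_iff [simp]: "enc x = enc y \<longleftrightarrow> x = y"

lemma encode_list_inj:
  assumes "\<And>x y. f x = f y \<Longrightarrow> x = y" "encode_list f xs = encode_list f ys"
  shows "xs = ys"
  using assms(2)
proof (induction xs arbitrary: ys)
  case Nil then show ?case by (cases ys) auto
next
  case (Cons x xs) then show ?case using assms(1) by (cases ys) auto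
qed

lemma encode_list_unit: "encode_list (\<lambda>_. Leaf) xs = encode_list (\<lambda>_. Leaf) ys \<longleftrightarrow> length xs = length ys"
proof (induction xs arbitrary: ys)
  case Nil then show ?case by (cases ys) auto
next
  case (Cons x xs) then show ?case by (cases ys) auto
qed

instantiation val :: enc begin
definition "enc_val (v::val) = v"
instance by standard (simp add: enc_val_def)
end

instantiation unit :: enc begin
definition "enc_unit (_::unit) = Leaf"
instance by standard (simp add: enc_unit_def)
end

instantiation bool :: enc begin
definition "enc_bool b = val_of_bool b"
instance by standard (simp add: enc_bool_def val_of_bool_def)
end

instantiation nat :: enc begin
definition "enc_nat n = encode_nat n"
instance by standard (simp add: enc_nat_def encode_nat_def encode_list_unit)
end

instantiation prod :: (enc, enc) enc begin
definition "enc_prod p = Node (enc (fst p)) (enc (snd p))"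
instance by standard (simp add: enc_prod_def prod_eq_iff)
end

instantiation list :: (enc) enc begin
definition "enc_list xs = encode_list enc xs"
instance by standard (auto simp: enc_list_def dest: encode_list_inj[rotated])
end

lemma enc_simps [simp]:
  "enc () = Leaf"
  "enc True = Node Leaf Leaf"
  "enc False = Leaf"
  "enc (a, b) = Node (enc a) (enc b)"
  "enc [] = Leaf"
  "enc (x # xs) = Node (enc x) (enc xs)"
  by (simp_all add: enc_unit_def enc_bool_def val_of_bool_def enc_prod_def enc_list_def)

text \<open>Numbers are encoded in unary, so a number is the same tree as a list of that many units.
  List operations thereby replace arithmetic.\<close>

lemma enc_length: "enc (length xs) = enc (map (\<lambda>_. ()) xs)"
proof -
  have "encode_list (\<lambda>_. Leaf) [0..<length xs] = encode_list (\<lambda>_. Leaf) xs"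
    by (simp add: encode_list_unit)
  also have "\<dots> = encode_list enc (map (\<lambda>_. ()) xs)" by (induction xs) auto
  finally show ?thesis by (simp add: enc_nat_def encode_nat_def enc_list_def)
qed

lemma size_enc_list: "size (enc xs) = (\<Sum>x\<leftarrow>xs. size (enc x) + 1)"
  by (induction xs) auto

lemma length_le_size: "length xs \<le> size (enc xs)"
  by (induction xs) auto

lemma size_enc_nat [simp]: "size (enc (n::nat)) = n"
proof -
  have "size (enc n) = size (enc (map (\<lambda>_. ()) [0..<n]))" using enc_length[of "[0..<n]"] by simp
  then show ?thesis by (simp add: size_enc_list o_def sum_list_triv)
qed

lemma size_enc_fst: "size (enc (fst p)) \<le> size (enc p)"
  by (cases p) simp

lemma size_enc_append: "size (enc (xs @ ys)) = size (enc xs) + size (enc ys)"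
  by (simp add: size_enc_list)

lemma size_enc_filter: "size (enc (filter P xs)) \<le> size (enc xs)"
  by (induction xs) auto

lemma size_enc_takeWhile: "size (enc (takeWhile P xs)) \<le> size (enc xs)"
  by (induction xs) auto

lemma size_enc_remdups: "size (enc (remdups xs)) \<le> size (enc xs)"
  by (induction xs) auto

lemma size_enc_concat: "size (enc (concat xss)) \<le> size (enc xss)"
  by (induction xss) (auto simp: size_enc_append)

lemma size_enc_drop: "size (enc (drop n xs)) \<le> size (enc xs)"
  by (metis append_take_drop_id le_add2 size_enc_append)

lemma size_enc_map_le:
  "(\<And>x. x \<in> set xs \<Longrightarrow> size (enc (f x)) \<le> B) \<Longrightarrow> size (enc (map f xs)) \<le> length xs * (B + 1)"
proof (induction xs)
  case (Cons x xs)
  then have "size (enc (f x)) \<le> B" "size (enc (map f xs)) \<le> length xs * (B + 1)" by simp_all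
  then show ?case by simp
qed simp

lemma size_enc_mem: "x \<in> set xs \<Longrightarrow> size (enc x) \<le> size (enc xs)"
  by (induction xs) auto


section \<open>Polynomial-time computable functions\<close>

type_synonym query = "val \<Rightarrow> bool"

text \<open>Coefficients are natural numbers, so arguments of bounds may be enlarged without a side
  condition.\<close>

lemma poly_nat_mono: "a \<le> b \<Longrightarrow> poly p a \<le> poly p (b::nat)"
  by (induction p) (auto intro!: add_mono mult_mono)

section \<open>Linking programs\<close>

text \<open>Calls refer to absolute positions; \<open>shift k\<close> relocates them for a program
  that is placed behind \<open>k\<close> other functions.\<close>

primrec shift :: "nat \<Rightarrow> expr \<Rightarrow> expr" where
  "shift k (EVar i) = EVar i"
| "shift k ELeaf = ELeaf"
| "shift k (ENode a b) = ENode (shift k a) (shift k b)"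
| "shift k (ECase a b c) = ECase (shift k a) (shift k b) (shift k c)"
| "shift k (ELet a b) = ELet (shift k a) (shift k b)"
| "shift k (ECall f es) = ECall (k + f) (map (shift k) es)"
| "shift k (EQuery a) = EQuery (shift k a)"

lemma shift_0 [simp]: "shift 0 e = e"
  by (induction e) (auto simp: map_idI)

text \<open>Relocated code calls only relocated code, so neither the functions in front of it nor
  those behind it influence its run.\<close>

lemma evaluates_shift:
  shows "evaluates Q P env e v t \<Longrightarrow>
      evaluates Q (L @ map (shift (length L)) P @ R) env (shift (length L) e) v t"
    and "evaluates_list Q P env es vs t \<Longrightarrow>
      evaluates_list Q (L @ map (shift (length L)) P @ R) env (map (shift (length L)) es) vs t"
proof (induction rule: evaluates_evaluates_list.inducts)
  case (ev_call env es us t1 f v t2)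
  have "evaluates Q (L @ map (shift (length L)) P @ R) us
      ((L @ map (shift (length L)) P @ R) ! (length L + f)) v t2"
    using ev_call by (simp add: nth_append[of L] nth_append)
  from evaluates_evaluates_list.ev_call[OF _ _ this] ev_call show ?case by simp
qed (auto intro: evaluates_evaluates_list.intros evaluates_evaluates_list.intros[simplified])

lemma ex_timeI:
  "evaluates Q P env e v t \<Longrightarrow> t \<le> B \<Longrightarrow> v = v' \<Longrightarrow> \<exists>t. t \<le> B \<and> evaluates Q P env e v' t"
  by blast

lemma evaluates_append: "evaluates Q P env e v t \<Longrightarrow> evaluates Q (P @ R) env e v t"
  using evaluates_shift(1)[where L = "[]"] by (simp add: map_idI)

text \<open>Program and polynomial are fixed before \<open>Q\<close>: the same code must serve every
  goal mapping, which is visible only through the oracle.\<close>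

definition computes :: "program \<Rightarrow> nat \<Rightarrow> nat poly \<Rightarrow> (query \<Rightarrow> 'a::enc \<Rightarrow> 'b::enc) \<Rightarrow> bool" where
  "computes P f p A \<longleftrightarrow> f < length P \<and>
     (\<forall>Q a. \<exists>t \<le> poly p (size (enc a)). evaluates Q P [enc a] (P ! f) (enc (A Q a)) t)"

definition PT :: "(query \<Rightarrow> 'a::enc \<Rightarrow> 'b::enc) \<Rightarrow> bool" where
  "PT A \<longleftrightarrow> (\<exists>P f p. computes P f p A)"

lemma computes_append: "computes P f p A \<Longrightarrow> computes (P @ R) f p A"
  unfolding computes_def by (auto simp: nth_append) (meson evaluates_append)

lemma computes_shift: "computes P f p A \<Longrightarrow> computes (L @ map (shift (length L)) P) (length L + f) p A"
  unfolding computes_def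
  by (auto simp: nth_append) (metis append_Nil2 evaluates_shift(1))

lemma PT_merge2:
  assumes "PT A" "PT B"
  obtains P f p g q where "computes P f p A" "computes P g q B"
  using assms computes_append computes_shift unfolding PT_def by metis

lemma PT_merge3:
  assumes "PT A" "PT B" "PT C"
  obtains P f p g q h r where "computes P f p A" "computes P g q B" "computes P h r C"
proof -
  obtain P f p g q where "computes P f p A" "computes P g q B" using PT_merge2[OF assms(1,2)] .
  moreover obtain P' h r where "computes P' h r C" using assms(3) unfolding PT_def by blast
  ultimately show ?thesis using computes_append computes_shift that by metis
qed

lemma computes_call:
  assumes "computes P f p A" "evaluates Q (P @ R) env e (enc b) t1"
  shows "\<exists>t. t \<le> t1 + poly p (size (enc b)) + 1 \<and>
     evaluates Q (P @ R) env (ECall f [e]) (enc (A Q b)) t"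
proof -
  from computes_append[OF assms(1), of R] obtain t2 where
    "f < length (P @ R)" "t2 \<le> poly p (size (enc b))"
    "evaluates Q (P @ R) [enc b] ((P @ R) ! f) (enc (A Q b)) t2"
    unfolding computes_def by blast
  then show ?thesis
    using ev_call[OF ev_cons[OF assms(2) ev_nil]] by (intro exI[of _ "t1 + 0 + t2 + 1"]) auto
qed

text \<open>A value cannot be larger than the inputs plus the elapsed time
  (\<open>evaluates_size\<close>). This closes \<open>PT\<close> under composition: the outer
  function receives an argument of polynomial size.\<close>

lemma computes_size:
  assumes "computes P f p A"
  shows "size (enc (A Q a)) \<le> size (enc a) + poly p (size (enc a))"
proof -
  obtain t where "t \<le> poly p (size (enc a))" "evaluates Q P [enc a] (P ! f) (enc (A Q a)) t"
    using assms unfolding computes_def by blast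
  then show ?thesis using evaluates_size(1)[of Q P "[enc a]" "P ! f" "enc (A Q a)" t "size (enc a)"]
    by auto
qed

lemma PT_size:
  assumes "PT A"
  obtains p where "\<And>Q a. size (enc (A Q a)) \<le> poly p (size (enc a))"
proof -
  obtain P f p where "computes P f p A" using assms unfolding PT_def by blast
  from computes_size[OF this] show ?thesis by (intro that[of "[:0,1:] + p"]) auto
qed

lemma PT_intro:
  assumes "\<And>Q a. \<exists>t. t \<le> poly p (size (enc a)) \<and> evaluates Q (P @ [e]) [enc a] e (enc (A Q a)) t"
  shows "PT A"
  unfolding PT_def computes_def
  using assms by (intro exI[of _ "P @ [e]"] exI[of _ "length P"] exI[of _ p]) auto

text \<open>\<open>PT\<close> depends on encodings only, so a function may be exchanged for one of
  another type with the same encodings: pairs for nonempty lists, lists of units for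
  numbers.\<close>

lemma PT_retype:
  assumes "PT A" "\<And>Q a. enc (B Q a) = enc (A Q a)"
  shows "PT B"
  using assms unfolding PT_def computes_def by simp

section \<open>Closure of \<open>PT\<close> under basic operations\<close>

named_theorems pt

lemma PT_id [pt]: "PT (\<lambda>Q a. a)"
proof (rule PT_intro[where e = "EVar 0" and P = "[]" and p = 1])
  fix Q and a :: 'a
  show "\<exists>t. t \<le> poly 1 (size (enc a)) \<and> evaluates Q ([] @ [EVar 0]) [enc a] (EVar 0) (enc a) t"
    using ev_var[of 0 "[enc a]" Q] by auto
qed

primrec expr_of_val :: "val \<Rightarrow> expr" where
  "expr_of_val Leaf = ELeaf"
| "expr_of_val (Node a b) = ENode (expr_of_val a) (expr_of_val b)"

lemma evaluates_expr_of_val: "\<exists>t. \<forall>Q P env. evaluates Q P env (expr_of_val v) v t"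
proof (induction v)
  case Leaf then show ?case by (auto intro: ev_leaf)
next
  case (Node a b)
  then show ?case by (auto intro: ev_node) (meson ev_node)
qed

lemma PT_const [pt]: "PT (\<lambda>Q a. c)"
proof -
  obtain t where "\<And>Q P env. evaluates Q P env (expr_of_val (enc c)) (enc c) t"
    using evaluates_expr_of_val by blast
  then show ?thesis
    by (intro PT_intro[where e = "expr_of_val (enc c)" and P = "[]" and p = "[:t:]"]) auto
qed

lemma PT_comp:
  fixes A :: "query \<Rightarrow> 'b::enc \<Rightarrow> 'c::enc" and B :: "query \<Rightarrow> 'a::enc \<Rightarrow> 'b"
  assumes "PT A" "PT B"
  shows "PT (\<lambda>Q a. A Q (B Q a))"
proof -
  obtain P f p g q where A: "computes P f p A" and B: "computes P g q B"
    using PT_merge2[OF assms] .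
  show ?thesis
  proof (rule PT_intro[where e = "ECall f [ECall g [EVar 0]]" and P = P
      and p = "q + pcompose p ([:0,1:] + q) + 3"])
    fix Q and a :: 'a
    let ?R = "[ECall f [ECall g [EVar 0]]]"
    have "evaluates Q (P @ ?R) [enc a] (EVar 0) (enc a) 1"
      using ev_var[of 0 "[enc a]" Q] by auto
    from computes_call[OF B this] obtain t1 where t1: "t1 \<le> 1 + poly q (size (enc a)) + 1"
      "evaluates Q (P @ ?R) [enc a] (ECall g [EVar 0]) (enc (B Q a)) t1" by blast
    from computes_call[OF A t1(2)] obtain t where t: "t \<le> t1 + poly p (size (enc (B Q a))) + 1"
      "evaluates Q (P @ ?R) [enc a] (ECall f [ECall g [EVar 0]]) (enc (A Q (B Q a))) t" by blast
    have "poly p (size (enc (B Q a))) \<le> poly p (size (enc a) + poly q (size (enc a)))"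
      by (rule poly_nat_mono[OF computes_size[OF B]])
    then show "\<exists>t. t \<le> poly (q + pcompose p ([:0,1:] + q) + 3) (size (enc a)) \<and>
        evaluates Q (P @ ?R) [enc a] (ECall f [ECall g [EVar 0]]) (enc (A Q (B Q a))) t"
      using t t1(1) by (intro exI[of _ t]) (simp add: poly_pcompose)
  qed
qed

lemma PT_Pair [pt]:
  fixes A :: "query \<Rightarrow> 'a::enc \<Rightarrow> 'b::enc" and B :: "query \<Rightarrow> 'a \<Rightarrow> 'c::enc"
  assumes "PT A" "PT B"
  shows "PT (\<lambda>Q a. (A Q a, B Q a))"
proof -
  obtain P f p g q where A: "computes P f p A" and B: "computes P g q B"
    using PT_merge2[OF assms] .
  let ?e = "ENode (ECall f [EVar 0]) (ECall g [EVar 0])"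
  show ?thesis
  \<comment> \<open>The factor 2 pays for the final \<open>ENode\<close>, whose cost is the size of
    the pair; each half is bounded by the input size plus its running time.\<close>
  proof (rule PT_intro[where e = ?e and P = P and p = "2 * p + 2 * q + [:10,2:]"])
    fix Q and a :: 'a
    have v: "evaluates Q (P @ [?e]) [enc a] (EVar 0) (enc a) 1"
      using ev_var[of 0 "[enc a]" Q] by auto
    from computes_call[OF A v] obtain t1 where t1: "t1 \<le> 1 + poly p (size (enc a)) + 1"
      "evaluates Q (P @ [?e]) [enc a] (ECall f [EVar 0]) (enc (A Q a)) t1" by blast
    from computes_call[OF B v] obtain t2 where t2: "t2 \<le> 1 + poly q (size (enc a)) + 1"
      "evaluates Q (P @ [?e]) [enc a] (ECall g [EVar 0]) (enc (B Q a)) t2" by blast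
    show "\<exists>t. t \<le> poly (2 * p + 2 * q + [:10,2:]) (size (enc a)) \<and>
        evaluates Q (P @ [?e]) [enc a] ?e (enc (A Q a, B Q a)) t"
      using t1(1) t2(1) computes_size[OF A, of Q a] computes_size[OF B, of Q a]
      by (intro ex_timeI[OF ev_node[OF t1(2) t2(2)]]) simp_all
  qed
qed

lemma PT_fst_aux: "PT (\<lambda>Q p. fst p)"
proof (rule PT_intro[where e = "ECase (EVar 0) ELeaf (EVar 0)" and P = "[]" and p = 3])
  fix Q and a :: "'a \<times> 'b"
  let ?P = "[] @ [ECase (EVar 0) ELeaf (EVar 0)]"
  have "evaluates Q ?P [enc a] (EVar 0) (Node (enc (fst a)) (enc (snd a))) 1"
    using ev_var[of 0 "[enc a]" Q] by (cases a) auto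
  from ev_case_node[OF this, of "EVar 0" "enc (fst a)" 1]
  show "\<exists>t. t \<le> poly 3 (size (enc a)) \<and> evaluates Q ?P [enc a] (ECase (EVar 0) ELeaf (EVar 0)) (enc (fst a)) t"
    using ev_var[of 0 "[enc (fst a), enc (snd a), enc a]" Q] by (intro exI[of _ 3]) (auto simp: eval_nat_numeral)
qed

lemma PT_snd_aux: "PT (\<lambda>Q p. snd p)"
proof (rule PT_intro[where e = "ECase (EVar 0) ELeaf (EVar 1)" and P = "[]" and p = 3])
  fix Q and a :: "'a \<times> 'b"
  let ?P = "[] @ [ECase (EVar 0) ELeaf (EVar 1)]"
  have "evaluates Q ?P [enc a] (EVar 0) (Node (enc (fst a)) (enc (snd a))) 1"
    using ev_var[of 0 "[enc a]" Q] by (cases a) auto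
  from ev_case_node[OF this, of "EVar 1" "enc (snd a)" 1]
  show "\<exists>t. t \<le> poly 3 (size (enc a)) \<and> evaluates Q ?P [enc a] (ECase (EVar 0) ELeaf (EVar 1)) (enc (snd a)) t"
    using ev_var[of 1 "[enc (fst a), enc (snd a), enc a]" Q] by (intro exI[of _ 3]) (auto simp: eval_nat_numeral)
qed

lemma PT_fst [pt]: "PT A \<Longrightarrow> PT (\<lambda>Q a. fst (A Q a))"
  by (rule PT_comp[OF PT_fst_aux])

lemma PT_snd [pt]: "PT A \<Longrightarrow> PT (\<lambda>Q a. snd (A Q a))"
  by (rule PT_comp[OF PT_snd_aux])

lemma PT_Cons [pt]:
  assumes "PT A" "PT B"
  shows "PT (\<lambda>Q a. A Q a # B Q a)"
  by (rule PT_retype[OF PT_Pair[OF assms]]) simp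

text \<open>In unary, a successor is the pair of a unit and the predecessor.\<close>

lemma PT_Suc [pt]:
  assumes "PT A"
  shows "PT (\<lambda>Q a. Suc (A Q a))"
proof (rule PT_retype[OF PT_Pair[OF PT_const[of "()"] assms]])
  fix Q and a :: 'a
  have "enc (Suc (A Q a)) = enc (map (\<lambda>_. ()) [0..<Suc (A Q a)])"
    using enc_length[of "[0..<Suc (A Q a)]"] by simp
  also have "\<dots> = enc (() # map (\<lambda>_. ()) [0..<A Q a])"
    by (intro arg_cong[of _ _ enc]) (simp add: map_replicate_const replicate_append_same)
  also have "\<dots> = Node Leaf (enc (A Q a))" using enc_length[of "[0..<A Q a]"] by simp
  finally show "enc (Suc (A Q a)) = enc ((), A Q a)" by simp
qed

lemma PT_query [pt]:
  fixes A :: "query \<Rightarrow> 'a::enc \<Rightarrow> 'b::enc"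
  assumes "PT A"
  shows "PT (\<lambda>Q a. Q (enc (A Q a)))"
proof -
  have "PT (\<lambda>Q (a::'b). Q (enc a))"
  proof (rule PT_intro[where e = "EQuery (EVar 0)" and P = "[]" and p = 2])
    fix Q and a :: 'b
    have "evaluates Q ([] @ [EQuery (EVar 0)]) [enc a] (EVar 0) (enc a) 1"
      using ev_var[of 0 "[enc a]" Q] by auto
    from ev_query[OF this]
    show "\<exists>t. t \<le> poly 2 (size (enc a)) \<and>
       evaluates Q ([] @ [EQuery (EVar 0)]) [enc a] (EQuery (EVar 0)) (enc (Q (enc a))) t"
      by (intro exI[of _ 2]) (simp add: enc_bool_def eval_nat_numeral)
  qed
  from PT_comp[OF this assms] show ?thesis .
qed

lemma PT_if [pt]:
  fixes A B :: "query \<Rightarrow> 'a::enc \<Rightarrow> 'b::enc"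
  assumes "PT C" "PT A" "PT B"
  shows "PT (\<lambda>Q a. if C Q a then A Q a else B Q a)"
proof -
  obtain P f p g q h r where A: "computes P f p A" and B: "computes P g q B" and C: "computes P h r C"
    using PT_merge3[OF assms(2,3,1)] .
  let ?e = "ECase (ECall h [EVar 0]) (ECall g [EVar 0]) (ECall f [EVar 2])"
  show ?thesis
  proof (rule PT_intro[where e = ?e and P = P and p = "p + q + r + 10"])
    fix Q and a :: 'a
    have v: "evaluates Q (P @ [?e]) [enc a] (EVar 0) (enc a) 1"
      using ev_var[of 0 "[enc a]" Q] by auto
    from computes_call[OF C v] obtain t1 where t1: "t1 \<le> 1 + poly r (size (enc a)) + 1"
      "evaluates Q (P @ [?e]) [enc a] (ECall h [EVar 0]) (enc (C Q a)) t1" by blast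
    show "\<exists>t. t \<le> poly (p + q + r + 10) (size (enc a)) \<and>
        evaluates Q (P @ [?e]) [enc a] ?e (enc (if C Q a then A Q a else B Q a)) t"
    proof (cases "C Q a")
      case True
      have "evaluates Q (P @ [?e]) [Leaf, Leaf, enc a] (EVar 2) (enc a) 1"
        using ev_var[of 2 "[Leaf, Leaf, enc a]" Q] by auto
      from computes_call[OF A this] obtain t2 where t2: "t2 \<le> 1 + poly p (size (enc a)) + 1"
        "evaluates Q (P @ [?e]) [Leaf, Leaf, enc a] (ECall f [EVar 2]) (enc (A Q a)) t2" by blast
      have "evaluates Q (P @ [?e]) [enc a] ?e (enc (A Q a)) (t1 + t2 + 1)"
        using ev_case_node t1(2) t2(2) True by simp
      with True t1 t2 show ?thesis by (intro exI[of _ "t1 + t2 + 1"]) auto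
    next
      case False
      from computes_call[OF B v] obtain t2 where t2: "t2 \<le> 1 + poly q (size (enc a)) + 1"
        "evaluates Q (P @ [?e]) [enc a] (ECall g [EVar 0]) (enc (B Q a)) t2" by blast
      have "evaluates Q (P @ [?e]) [enc a] ?e (enc (B Q a)) (t1 + t2 + 1)"
        using ev_case_leaf t1(2) t2(2) False by simp
      with False t1 t2 show ?thesis by (intro exI[of _ "t1 + t2 + 1"]) auto
    qed
  qed
qed

lemma PT_tl [pt]:
  assumes "PT A"
  shows "PT (\<lambda>Q a. tl (A Q a))"
proof -
  have "PT (\<lambda>Q (a::'b list). tl a)"
  proof (rule PT_intro[where e = "ECase (EVar 0) ELeaf (EVar 1)" and P = "[]" and p = 3])
    fix Q and a :: "'b list"
    let ?e = "ECase (EVar 0) ELeaf (EVar 1)"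
    have v: "evaluates Q ([] @ [?e]) [enc a] (EVar 0) (enc a) 1"
      using ev_var[of 0 "[enc a]" Q] by auto
    show "\<exists>t. t \<le> poly 3 (size (enc a)) \<and> evaluates Q ([] @ [?e]) [enc a] ?e (enc (tl a)) t"
    proof (cases a)
      case Nil
      then show ?thesis using ev_case_leaf[OF _ ev_leaf, of Q "[] @ [?e]" "[enc a]" "EVar 0" 1] v
        by (intro exI[of _ 3]) (simp add: eval_nat_numeral)
    next
      case (Cons x xs)
      then show ?thesis using ev_case_node[of Q "[] @ [?e]" "[enc a]" "EVar 0" "enc x" "enc xs" 1 "EVar 1" "enc xs" 1] v
        ev_var[of 1 "[enc x, enc xs, enc a]" Q] by (intro exI[of _ 3]) (simp add: eval_nat_numeral)
    qed
  qed
  from PT_comp[OF this assms] show ?thesis .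
qed

text \<open>The default value makes the head total on encodings: \<open>hd []\<close> has no computable encoding.\<close>

definition head :: "'a \<Rightarrow> 'a list \<Rightarrow> 'a" where
  "head d xs = (case xs of [] \<Rightarrow> d | x # _ \<Rightarrow> x)"

lemma PT_head [pt]:
  assumes "PT D" "PT A"
  shows "PT (\<lambda>Q a. head (D Q a) (A Q a))"
proof -
  have "PT (\<lambda>Q (a::'b \<times> 'b list). head (fst a) (snd a))"
  proof (rule PT_intro[where e = "ECase (EVar 0) ELeaf (ECase (EVar 1) (EVar 0) (EVar 0))" and P = "[]" and p = 5])
    fix Q and a :: "'b \<times> 'b list"
    let ?c = "ECase (EVar 1) (EVar 0) (EVar 0)"
    let ?e = "ECase (EVar 0) ELeaf ?c"
    obtain d xs where a: "a = (d, xs)" by (cases a)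
    have v: "evaluates Q ([] @ [?e]) [enc a] (EVar 0) (Node (enc d) (enc xs)) 1"
      using ev_var[of 0 "[enc a]" Q] a by auto
    let ?env = "[enc d, enc xs, enc a]"
    have v1: "evaluates Q ([] @ [?e]) ?env (EVar 1) (enc xs) 1"
      and v0: "evaluates Q ([] @ [?e]) ?env (EVar 0) (enc d) 1"
      using ev_var[of 1 ?env Q] ev_var[of 0 ?env Q] by auto
    have "evaluates Q ([] @ [?e]) ?env ?c (enc (head d xs)) 3"
    proof (cases xs)
      case Nil
      then show ?thesis using ev_case_leaf[of Q "[] @ [?e]" ?env "EVar 1" 1] v1 v0
        by (force simp: head_def eval_nat_numeral)
    next
      case (Cons x ys)
      then show ?thesis using ev_case_node[of Q "[] @ [?e]" ?env "EVar 1" "enc x" "enc ys" 1 "EVar 0" "enc x" 1]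
        v1 ev_var[of 0 "enc x # enc ys # ?env" Q] by (simp add: head_def eval_nat_numeral)
    qed
    from ev_case_node[OF v this]
    show "\<exists>t. t \<le> poly 5 (size (enc a)) \<and>
       evaluates Q ([] @ [?e]) [enc a] ?e (enc (head (fst a) (snd a))) t"
      using a by (intro exI[of _ 5]) (simp add: eval_nat_numeral)
  qed
  from PT_comp[OF this PT_Pair[OF assms]] show ?thesis by simp
qed

text \<open>Simultaneous descent into two trees \<open>u\<close> and \<open>v\<close>. After both
  case distinctions the environment consists of the halves of \<open>v\<close>, the halves of
  \<open>u\<close>, \<open>u\<close> and \<open>v\<close>. A positive comparison of the left halves
  puts two leaves in front, which turns the indices of the right halves into 5 and 3.\<close>

definition eq_body :: expr where
  "eq_body = ECase (EVar 0)
     (ECase (EVar 1) (ENode ELeaf ELeaf) ELeaf)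
     (ECase (EVar 3) ELeaf
        (ECase (ECall 0 [EVar 2, EVar 0]) ELeaf (ECall 0 [EVar 5, EVar 3])))"

lemma evaluates_var: "i < length env \<Longrightarrow> v = env ! i \<Longrightarrow> evaluates Q P env (EVar i) v 1"
  by (metis ev_var)

lemma evaluates_call2:
  assumes "evaluates Q P [env ! i, env ! j] (P ! f) v t" "f < length P" "i < length env" "j < length env"
  shows "evaluates Q P env (ECall f [EVar i, EVar j]) v (t + 3)"
  using ev_call[OF ev_cons[OF ev_var ev_cons[OF ev_var ev_nil]] assms(2), of i env j Q v t] assms
  by (simp add: eval_nat_numeral)

text \<open>The second function \<open>e\<close> stands for the caller that \<open>PT_eq\<close>
  places behind \<open>eq_body\<close>; the recursive calls never reach it.\<close>

lemma evaluates_eq_body: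
  "\<exists>t. t \<le> 40 * size u + 20 \<and> evaluates Q [eq_body, e] [u, v] eq_body (enc (u = v)) t"
proof (induction u arbitrary: v)
  case Leaf
  let ?P = "[eq_body, e]"
  have z: "evaluates Q ?P [Leaf, v] (EVar 0) Leaf 1"
    and o: "evaluates Q ?P [Leaf, v] (EVar 1) v 1" by (rule evaluates_var; simp)+
  have "\<exists>t. t \<le> 10 \<and> evaluates Q ?P [Leaf, v] (ECase (EVar 1) (ENode ELeaf ELeaf) ELeaf) (enc (Leaf = v)) t"
  proof (cases v)
    case Leaf
    then have "evaluates Q ?P [Leaf, v] (ECase (EVar 1) (ENode ELeaf ELeaf) ELeaf) (Node Leaf Leaf)
        (1 + (1 + 1 + size (Node Leaf Leaf)) + 1)"
      using o by (intro ev_case_leaf ev_node ev_leaf) simp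
    then show ?thesis by (rule ex_timeI) (simp_all add: Leaf)
  next
    case (Node a b)
    then have "evaluates Q ?P [Leaf, v] (ECase (EVar 1) (ENode ELeaf ELeaf) ELeaf) Leaf (1 + 1 + 1)"
      using o by (intro ev_case_node ev_leaf) simp
    then show ?thesis by (rule ex_timeI) (simp_all add: Node)
  qed
  then obtain t where "t \<le> 10" "evaluates Q ?P [Leaf, v] (ECase (EVar 1) (ENode ELeaf ELeaf) ELeaf) (enc (Leaf = v)) t"
    by blast
  with ev_case_leaf[OF z this(2)] show ?case unfolding eq_body_def by (intro exI[of _ "1 + t + 1"]) auto
next
  case (Node a b)
  let ?P = "[eq_body, e]"
  let ?u = "Node a b"
  let ?env = "[a, b, ?u, v]"
  let ?c = "ECase (ECall 0 [EVar 2, EVar 0]) ELeaf (ECall 0 [EVar 5, EVar 3])"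
  have z: "evaluates Q ?P [?u, v] (EVar 0) ?u 1" by (intro evaluates_var) simp_all
  have "\<exists>t. t \<le> 40 * size ?u + 10 \<and> evaluates Q ?P ?env (ECase (EVar 3) ELeaf ?c) (enc (?u = v)) t"
  proof (cases v)
    case Leaf
    then have "evaluates Q ?P ?env (ECase (EVar 3) ELeaf ?c) Leaf (1 + 1 + 1)"
      by (intro ev_case_leaf ev_leaf evaluates_var) auto
    then show ?thesis by (rule ex_timeI) (simp_all add: Leaf)
  next
    case (Node c d)
    let ?env' = "c # d # ?env"
    from Node.IH(1)[of c] obtain t1 where t1: "t1 \<le> 40 * size a + 20"
      "evaluates Q ?P [a, c] eq_body (enc (a = c)) t1" by blast
    have c1: "evaluates Q ?P ?env' (ECall 0 [EVar 2, EVar 0]) (enc (a = c)) ((1 + (1 + 0)) + t1 + 1)"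
      using evaluates_call2[of Q ?P ?env' 2 0 0] t1(2) by (simp add: eval_nat_numeral)
    from Node.IH(2)[of d] obtain t2 where t2: "t2 \<le> 40 * size b + 20"
      "evaluates Q ?P [b, d] eq_body (enc (b = d)) t2" by blast
    have "\<exists>t. t \<le> 40 * size a + 40 * size b + 50 - 3 \<and> evaluates Q ?P ?env' ?c (enc (?u = v)) t"
    proof (cases "a = c")
      case True
      have "evaluates Q ?P (Leaf # Leaf # ?env') (ECall 0 [EVar 5, EVar 3]) (enc (b = d)) ((1 + (1 + 0)) + t2 + 1)"
        using evaluates_call2[of Q ?P "Leaf # Leaf # ?env'" 5 3 0] t2(2) by (simp add: eval_nat_numeral)
      from ev_case_node[OF _ this, of "ECall 0 [EVar 2, EVar 0]" "2 + t1 + 1" ELeaf] c1 True Node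
      have "evaluates Q ?P ?env' ?c (enc (?u = v)) (2 + t1 + 1 + (1 + (1 + 0) + t2 + 1) + 1)" by simp
      then show ?thesis by (rule ex_timeI) (use t1(1) t2(1) in simp_all)
    next
      case False
      from ev_case_leaf[OF _ ev_leaf, of Q ?P ?env' "ECall 0 [EVar 2, EVar 0]" "2 + t1 + 1"] c1 False Node
      have "evaluates Q ?P ?env' ?c (enc (?u = v)) (2 + t1 + 1 + 1 + 1)" by simp
      then show ?thesis by (rule ex_timeI) (use t1(1) in simp_all)
    qed
    then obtain t where t: "t \<le> 40 * size a + 40 * size b + 50 - 3" "evaluates Q ?P ?env' ?c (enc (?u = v)) t" by blast
    have "evaluates Q ?P ?env (EVar 3) (Node c d) 1" by (intro evaluates_var) (simp_all add: Node)
    from ev_case_node[OF this t(2)] show ?thesis by (rule ex_timeI) (use t(1) in simp_all)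
  qed
  then obtain t where t: "t \<le> 40 * size ?u + 10" "evaluates Q ?P ?env (ECase (EVar 3) ELeaf ?c) (enc (?u = v)) t"
    by blast
  from ev_case_node[OF z t(2)] show ?case unfolding eq_body_def[symmetric]
    by (subst (2) eq_body_def, rule ex_timeI) (use t(1) in simp_all)
qed

lemma PT_eq [pt]:
  assumes "PT A" "PT B"
  shows "PT (\<lambda>Q a. A Q a = B Q a)"
proof -
  have "PT (\<lambda>Q (a::'b \<times> 'b). fst a = snd a)"
  proof (rule PT_intro[where e = "ECase (EVar 0) ELeaf (ECall 0 [EVar 0, EVar 1])" and P = "[eq_body]" and p = "[:30, 40:]"])
    fix Q and a :: "'b \<times> 'b"
    let ?e = "ECase (EVar 0) ELeaf (ECall 0 [EVar 0, EVar 1])"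
    obtain x y where a: "a = (x, y)" by (cases a)
    have v: "evaluates Q ([eq_body] @ [?e]) [enc a] (EVar 0) (Node (enc x) (enc y)) 1"
      using ev_var[of 0 "[enc a]" Q] a by auto
    obtain t where t: "t \<le> 40 * size (enc x) + 20"
      "evaluates Q ([eq_body] @ [?e]) [enc x, enc y] eq_body (enc (enc x = enc y)) t"
      using evaluates_eq_body[of "enc x" Q ?e "enc y"] by auto
    have "evaluates Q ([eq_body] @ [?e]) [enc x, enc y, enc a] (ECall 0 [EVar 0, EVar 1]) (enc (enc x = enc y)) ((1 + (1 + 0)) + t + 1)"
      using evaluates_call2[of Q _ "[enc x, enc y, enc a]" 0 1 0] t(2) by (simp add: eval_nat_numeral)
    from ev_case_node[OF v this]
    show "\<exists>t. t \<le> poly [:30, 40:] (size (enc a)) \<and> evaluates Q ([eq_body] @ [?e]) [enc a] ?e (enc (fst a = snd a)) t"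
      by (rule ex_timeI) (use t(1) a in simp_all)
  qed
  from PT_comp[OF this PT_Pair[OF assms]] show ?thesis by simp
qed

section \<open>Bounded folds and the list operations obtained from them\<close>

text \<open>\<open>bound\<close> concerns every list because the recursion passes through the folds
  over all suffixes of \<open>L Q a\<close>, and each of these accumulators is an argument of
  \<open>H\<close>. A polynomial-time step alone would not do: one that doubles its accumulator
  leads to exponential size.\<close>

lemma PT_foldr:
  fixes H :: "query \<Rightarrow> 'x::enc \<Rightarrow> 'c::enc \<Rightarrow> 'a::enc \<Rightarrow> 'c"
    and L :: "query \<Rightarrow> 'a \<Rightarrow> 'x list" and B :: "query \<Rightarrow> 'a \<Rightarrow> 'c"
  assumes L: "PT L" and B: "PT B"
    and H: "PT (\<lambda>Q z. H Q (fst z) (fst (snd z)) (snd (snd z)))"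
    and bound: "\<And>Q a xs. size (enc (foldr (\<lambda>x acc. H Q x acc a) xs (B Q a)))
      \<le> poly s (size (enc xs) + size (enc (B Q a)) + size (enc a))"
  shows "PT (\<lambda>Q a. foldr (\<lambda>x acc. H Q x acc a) (L Q a) (B Q a))"
proof -
  obtain P l pl b pb h ph where l: "computes P l pl L" and b: "computes P b pb B"
    and h: "computes P h ph (\<lambda>Q z. H Q (fst z) (fst (snd z)) (snd (snd z)))"
    using PT_merge3[OF L B H] .
  define n where "n = length P"
  \<comment> \<open>\<open>rec\<close> runs in the environment of list, start value and parameter.
    The case distinction puts head and tail in front, so 1, 3 and 4 are tail, start value and
    parameter.\<close>
  let ?arg = "ENode (EVar 0) (ENode (ECall n [EVar 1, EVar 3, EVar 4]) (EVar 4))"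
  define rec where "rec = ECase (EVar 0) (EVar 1) (ECall h [?arg])"
  define main where "main = ECall n [ECall l [EVar 0], ECall b [EVar 0], EVar 0]"
  let ?P = "(P @ [rec]) @ [main]"
  \<comment> \<open>\<open>Z\<close> bounds the size of the triple passed to \<open>H\<close>, and
    \<open>W\<close> the cost of one level of the recursion.\<close>
  define Z where "Z = [:2, 2:] + s"
  define W where "W = 20 + 2 * Z + pcompose ph Z"
  have rec: "\<exists>t. t \<le> (length xs + 1) * poly W N \<and>
      evaluates Q ?P [enc xs, enc (B Q a), enc a] rec (enc (foldr (\<lambda>x acc. H Q x acc a) xs (B Q a))) t"
    if "size (enc xs) + size (enc (B Q a)) + size (enc a) \<le> N" for Q a xs N
    using that
  proof (induction xs)
    case Nil
    have "evaluates Q ?P [Leaf, enc (B Q a), enc a] rec (enc (B Q a)) (1 + 1 + 1)"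
      unfolding rec_def by (intro ev_case_leaf evaluates_var) simp_all
    then show ?case by (intro ex_timeI) (auto simp: W_def)
  next
    case (Cons x xs)
    let ?acc = "foldr (\<lambda>x acc. H Q x acc a) xs (B Q a)"
    let ?env = "[enc x, enc xs, enc (x # xs), enc (B Q a), enc a]"
    from Cons obtain t where t: "t \<le> (length xs + 1) * poly W N"
      "evaluates Q ?P [enc xs, enc (B Q a), enc a] rec (enc ?acc) t" by auto
    have "evaluates_list Q ?P ?env [EVar 1, EVar 3, EVar 4] [enc xs, enc (B Q a), enc a] (1 + (1 + (1 + 0)))"
      by (intro ev_cons ev_nil evaluates_var) (simp_all add: eval_nat_numeral)
    from ev_call[OF this, of n] t(2) have e1:
      "evaluates Q ?P ?env (ECall n [EVar 1, EVar 3, EVar 4]) (enc ?acc) (3 + t + 1)"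
      by (simp add: n_def nth_append eval_nat_numeral)
    have e2: "evaluates Q ?P ?env (EVar 4) (enc a) 1"
      by (intro evaluates_var) (simp_all add: eval_nat_numeral)
    have e3: "evaluates Q ?P ?env (EVar 0) (enc x) 1"
      by (intro evaluates_var) simp_all
    have arg: "evaluates Q ?P ?env ?arg (enc (x, ?acc, a))
       (1 + (3 + t + 1 + 1 + size (enc (?acc, a))) + size (enc (x, ?acc, a)))"
      using ev_node[OF e3 ev_node[OF e1 e2]] by simp
    have acc: "size (enc ?acc) \<le> poly s N"
      using bound[where Q = Q and xs = xs and a = a] Cons.prems by (elim order_trans) (intro poly_nat_mono, simp)
    have z: "size (enc (x, ?acc, a)) \<le> poly Z N" using acc Cons.prems by (simp add: Z_def)
    from computes_call[OF h, of Q "[rec, main]"] arg obtain t' where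
      t': "t' \<le> (1 + (3 + t + 1 + 1 + size (enc (?acc, a))) + size (enc (x, ?acc, a))) +
         poly ph (size (enc (x, ?acc, a))) + 1"
      "evaluates Q ?P ?env (ECall h [?arg]) (enc (H Q x ?acc a)) t'" by fastforce
    have "evaluates Q ?P [enc (x # xs), enc (B Q a), enc a] rec (enc (H Q x ?acc a)) (1 + t' + 1)"
      by (subst (2) rec_def, rule ev_case_node[OF evaluates_var]) (use t'(2) in simp_all)
    moreover have "poly ph (size (enc (x, ?acc, a))) \<le> poly ph (poly Z N)"
      using z by (rule poly_nat_mono)
    moreover have "t' \<le> 8 + t + 2 * size (enc (x, ?acc, a)) + poly ph (size (enc (x, ?acc, a)))"
      using t'(1) by simp
    ultimately show ?case using t(1) z
      by (intro ex_timeI) (auto simp: W_def poly_pcompose)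
  qed
  define N where "N = [:0, 3:] + pl + pb"
  define T where "T = (pl + [:1,1:]) * pcompose W N + pl + pb + 20"
  show ?thesis
  proof (rule PT_intro[where e = main and P = "P @ [rec]" and p = T])
    fix Q and a :: 'a
    have v: "evaluates Q ?P [enc a] (EVar 0) (enc a) 1" by (intro evaluates_var) simp_all
    have v': "evaluates Q (P @ [rec, main]) [enc a] (EVar 0) (enc a) 1" using v by simp
    obtain t1 where t1: "t1 \<le> 1 + poly pl (size (enc a)) + 1"
      "evaluates Q ?P [enc a] (ECall l [EVar 0]) (enc (L Q a)) t1"
      using computes_call[OF l v'] by auto
    obtain t2 where t2: "t2 \<le> 1 + poly pb (size (enc a)) + 1"
      "evaluates Q ?P [enc a] (ECall b [EVar 0]) (enc (B Q a)) t2"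
      using computes_call[OF b v'] by auto
    have sz: "size (enc (L Q a)) \<le> size (enc a) + poly pl (size (enc a))"
      "size (enc (B Q a)) \<le> size (enc a) + poly pb (size (enc a))"
      using computes_size[OF l] computes_size[OF b] by auto
    then have "size (enc (L Q a)) + size (enc (B Q a)) + size (enc a) \<le> poly N (size (enc a))"
      by (simp add: N_def)
    from rec[OF this] obtain t3 where t3:
      "t3 \<le> (length (L Q a) + 1) * poly W (poly N (size (enc a)))"
      "evaluates Q ?P [enc (L Q a), enc (B Q a), enc a] rec
         (enc (foldr (\<lambda>x acc. H Q x acc a) (L Q a) (B Q a))) t3" by blast
    have "evaluates Q ?P [enc a] main (enc (foldr (\<lambda>x acc. H Q x acc a) (L Q a) (B Q a)))
       (t1 + (t2 + (1 + 0)) + t3 + 1)"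
      by (subst (2) main_def,
          rule ev_call[OF ev_cons[OF t1(2) ev_cons[OF t2(2) ev_cons[OF v ev_nil]]]])
         (use t3(2) in \<open>simp_all add: n_def nth_append\<close>)
    moreover have "(length (L Q a) + 1) * poly W (poly N (size (enc a)))
        \<le> (size (enc a) + poly pl (size (enc a)) + 1) * poly W (poly N (size (enc a)))"
      using sz(1) length_le_size[of "L Q a"] by (intro mult_right_mono) auto
    ultimately show "\<exists>t. t \<le> poly T (size (enc a)) \<and> evaluates Q ?P [enc a] main
         (enc (foldr (\<lambda>x acc. H Q x acc a) (L Q a) (B Q a))) t"
      using t1(1) t2(1) t3(1)
      by (intro ex_timeI) (auto simp: T_def poly_pcompose algebra_simps)
  qed
qed

lemma PT_Let [pt]:
  assumes "PT A" "PT (\<lambda>Q z. B Q (fst z) (snd z))"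
  shows "PT (\<lambda>Q a. let x = A Q a in B Q x a)"
  using PT_comp[OF assms(2) PT_Pair[OF assms(1) PT_id]] by simp

lemma PT_not [pt]:
  assumes "PT A" shows "PT (\<lambda>Q a. \<not> A Q a)"
  using PT_if[OF assms PT_const[of False] PT_const[of True]] by (rule PT_retype) auto

lemma PT_and [pt]:
  assumes "PT A" "PT B" shows "PT (\<lambda>Q a. A Q a \<and> B Q a)"
  using PT_if[OF assms PT_const[of False]] by (rule PT_retype) auto

lemma PT_or [pt]:
  assumes "PT A" "PT B" shows "PT (\<lambda>Q a. A Q a \<or> B Q a)"
  using PT_if[OF assms(1) PT_const[of True] assms(2)] by (rule PT_retype) auto

lemma PT_append [pt]:
  assumes "PT A" "PT B"
  shows "PT (\<lambda>Q a. A Q a @ B Q a)"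
proof -
  have *: "foldr (\<lambda>x acc. x # acc) xs ys = xs @ ys" for xs ys :: "'b list"
    by (induction xs) auto
  have "PT (\<lambda>Q a. foldr (\<lambda>x acc. x # acc) (A Q a) (B Q a))"
    by (rule PT_foldr[where s = "[:0,1:]"])
       (intro pt assms | simp add: size_enc_append *)+
  then show ?thesis by (simp add: *)
qed

lemma PT_map [pt]:
  fixes h :: "query \<Rightarrow> 'x::enc \<Rightarrow> 'a::enc \<Rightarrow> 'c::enc" and L :: "query \<Rightarrow> 'a \<Rightarrow> 'x list"
  assumes L: "PT L" and h: "PT (\<lambda>Q z. h Q (fst z) (snd z))"
  shows "PT (\<lambda>Q a. map (\<lambda>x. h Q x a) (L Q a))"
proof -
  obtain p where p: "\<And>Q z. size (enc (h Q (fst z) (snd z))) \<le> poly p (size (enc z))"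
    using PT_size[OF h] by blast
  have *: "foldr (\<lambda>x acc. f x # acc) xs [] = map f xs" for f :: "'x \<Rightarrow> 'c" and xs
    by (induction xs) auto
  have "PT (\<lambda>Q a. foldr (\<lambda>x acc. h Q x a # acc) (L Q a) [])"
  proof (rule PT_foldr[where s = "[:0,1:] * (pcompose p [:1,1:] + 1)"])
    have "PT (\<lambda>Q z. h Q (fst (fst z, snd (snd z))) (snd (fst z, snd (snd z))))"
      by (rule PT_comp[OF h]) (intro pt)
    then show "PT (\<lambda>Q z. h Q (fst z) (snd (snd z)) # fst (snd z))"
      by (intro pt) simp
    fix Q and a :: 'a and xs :: "'x list"
    have "size (enc (map (\<lambda>x. h Q x a) xs)) \<le> length xs * (poly p (1 + size (enc xs) + size (enc a)) + 1)"
    proof (rule size_enc_map_le)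
      fix x assume "x \<in> set xs"
      then have "size (enc (x, a)) \<le> 1 + size (enc xs) + size (enc a)"
        using size_enc_mem[of x xs] by simp
      from order_trans[OF p[of Q "(x, a)"] poly_nat_mono[OF this]]
      show "size (enc (h Q x a)) \<le> poly p (1 + size (enc xs) + size (enc a))" by simp
    qed
    also have "\<dots> \<le> (size (enc xs) + size (enc a)) * (poly p (1 + size (enc xs) + size (enc a)) + 1)"
      using length_le_size[of xs] by (intro mult_right_mono) auto
    finally show "size (enc (foldr (\<lambda>x acc. h Q x a # acc) xs []))
       \<le> poly ([:0,1:] * (pcompose p [:1,1:] + 1)) (size (enc xs) + size (enc ([]::'c list)) + size (enc a))"
      by (simp add: poly_pcompose * algebra_simps)
  qed (intro pt L)+
  then show ?thesis by (simp add: *)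
qed

text \<open>The step function of a fold ignores the accumulator's slot of its argument triple.\<close>

lemma PT_drop_slot: "PT (\<lambda>Q z. h Q (fst z) (snd z)) \<Longrightarrow> PT (\<lambda>Q z. h Q (fst z) (snd (snd z)))"
proof -
  assume "PT (\<lambda>Q z. h Q (fst z) (snd z))"
  from PT_comp[OF this, of "\<lambda>Q z. (fst z, snd (snd z))"]
  show "PT (\<lambda>Q z. h Q (fst z) (snd (snd z)))" by (simp add: PT_Pair PT_fst PT_snd PT_id)
qed

lemma PT_filter [pt]:
  assumes "PT L" "PT (\<lambda>Q z. h Q (fst z) (snd z))"
  shows "PT (\<lambda>Q a. filter (\<lambda>x. h Q x a) (L Q a))"
proof -
  have *: "foldr (\<lambda>x acc. if f x then x # acc else acc) xs [] = filter f xs" for f :: "'b \<Rightarrow> bool" and xs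
    by (induction xs) auto
  have "PT (\<lambda>Q a. foldr (\<lambda>x acc. if h Q x a then x # acc else acc) (L Q a) [])"
    by (rule PT_foldr[where s = "[:0,1:]"])
       (intro pt assms PT_drop_slot | simp add: * size_enc_filter trans_le_add1)+
  then show ?thesis by (simp add: *)
qed

lemma PT_takeWhile [pt]:
  assumes "PT L" "PT (\<lambda>Q z. h Q (fst z) (snd z))"
  shows "PT (\<lambda>Q a. takeWhile (\<lambda>x. h Q x a) (L Q a))"
proof -
  have *: "foldr (\<lambda>x acc. if f x then x # acc else []) xs [] = takeWhile f xs" for f :: "'b \<Rightarrow> bool" and xs
    by (induction xs) auto
  have "PT (\<lambda>Q a. foldr (\<lambda>x acc. if h Q x a then x # acc else []) (L Q a) [])"
    by (rule PT_foldr[where s = "[:0,1:]"])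
       (intro pt assms PT_drop_slot | simp add: * size_enc_takeWhile trans_le_add1)+
  then show ?thesis by (simp add: *)
qed

lemma PT_Bex [pt]:
  assumes "PT L" "PT (\<lambda>Q z. h Q (fst z) (snd z))"
  shows "PT (\<lambda>Q a. \<exists>x \<in> set (L Q a). h Q x a)"
proof -
  have "PT (\<lambda>Q a. filter (\<lambda>x. h Q x a) (L Q a) \<noteq> [])" by (intro pt assms)
  then show ?thesis by (rule PT_retype) (simp add: filter_empty_conv)
qed

lemma PT_Ball [pt]:
  assumes "PT L" "PT (\<lambda>Q z. h Q (fst z) (snd z))"
  shows "PT (\<lambda>Q a. \<forall>x \<in> set (L Q a). h Q x a)"
proof -
  have "PT (\<lambda>Q a. filter (\<lambda>x. \<not> h Q x a) (L Q a) = [])" by (intro pt assms)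
  then show ?thesis by (rule PT_retype) (simp add: filter_empty_conv)
qed

lemma PT_imp [pt]:
  assumes "PT A" "PT B" shows "PT (\<lambda>Q a. A Q a \<longrightarrow> B Q a)"
  using PT_if[OF assms PT_const[of True]] by (rule PT_retype) auto

lemma PT_mem [pt]:
  assumes "PT A" "PT L"
  shows "PT (\<lambda>Q a. A Q a \<in> set (L Q a))"
proof -
  have "PT (\<lambda>Q z. fst z = A Q (snd z))" by (intro pt PT_comp[OF assms(1)])
  from PT_Bex[OF assms(2) this] show ?thesis by (rule PT_retype) auto
qed

lemma PT_concat [pt]:
  assumes "PT L" shows "PT (\<lambda>Q a. concat (L Q a))"
proof -
  have *: "foldr (\<lambda>x acc. x @ acc) xs [] = concat xs" for xs :: "'b list list"
    by (induction xs) auto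
  have "PT (\<lambda>Q a. foldr (\<lambda>x acc. x @ acc) (L Q a) [])"
    by (rule PT_foldr[where s = "[:0,1:]"])
       (intro pt assms | simp add: * size_enc_concat trans_le_add1)+
  then show ?thesis by (simp add: *)
qed

lemma PT_remdups [pt]:
  assumes "PT L" shows "PT (\<lambda>Q a. remdups (L Q a))"
proof -
  have *: "foldr (\<lambda>x acc. if x \<in> set acc then acc else x # acc) xs [] = remdups xs" for xs :: "'b list"
    by (induction xs) auto
  have "PT (\<lambda>Q a. foldr (\<lambda>x acc. if x \<in> set acc then acc else x # acc) (L Q a) [])"
    by (rule PT_foldr[where s = "[:0,1:]"])
       (intro pt assms | simp add: * size_enc_remdups trans_le_add1)+
  then show ?thesis by (simp add: *)
qed

lemma PT_length [pt]:
  assumes "PT L" shows "PT (\<lambda>Q a. length (L Q a))"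
proof -
  have "PT (\<lambda>Q a. map (\<lambda>x. ()) (L Q a))" by (intro pt assms)
  then show ?thesis by (rule PT_retype) (simp add: enc_length)
qed

text \<open>Removing one element of the second list for each element of the first leaves something
  exactly if the second is longer.\<close>

lemma PT_length_less [pt]:
  assumes "PT A" "PT B" shows "PT (\<lambda>Q a. length (A Q a) < length (B Q a))"
proof -
  have *: "foldr (\<lambda>x acc. tl acc) xs ys = drop (length xs) ys" for xs :: "'b list" and ys :: "'c list"
    by (induction xs) (auto simp: drop_Suc tl_drop)
  have "PT (\<lambda>Q a. foldr (\<lambda>x acc. tl acc) (A Q a) (B Q a))"
    by (rule PT_foldr[where s = "[:0,1:]"])
       (intro pt assms | simp add: * trans_le_add1 trans_le_add2 size_enc_drop)+
  then have "PT (\<lambda>Q a. foldr (\<lambda>x acc. tl acc) (A Q a) (B Q a) \<noteq> [])" by (intro pt)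
  then show ?thesis by (rule PT_retype) (auto simp: *)
qed

lemma PT_add_const [pt]:
  fixes k :: nat
  assumes "PT A" shows "PT (\<lambda>Q a. k + A Q a)"
  by (induction k) (simp_all add: assms PT_Suc)

lemma PT_less_const [pt]:
  fixes k :: nat
  assumes "PT A" shows "PT (\<lambda>Q a. A Q a < k)"
proof -
  have "PT (\<lambda>Q a. A Q a \<in> set [0..<k])" by (intro pt assms)
  then show ?thesis by simp
qed

section \<open>The unbounded loop\<close>

text \<open>The program knows neither \<open>N\<close> nor \<open>B\<close>; it stops at the first
  state that \<open>step\<close> fixes. A fixed state persists, so this is the \<open>N\<close>-th
  iterate even if it is reached earlier. Thus the number of rounds may depend on the unknown
  goal.\<close>

theorem PT_iterate:
  fixes step :: "query \<Rightarrow> 's::enc \<Rightarrow> 's" and init :: "query \<Rightarrow> unit \<Rightarrow> 's"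
  assumes "PT init" "PT step"
  obtains P p where
    "\<And>Q N B. step Q ((step Q ^^ N) (init Q ())) = (step Q ^^ N) (init Q ()) \<Longrightarrow>
       (\<And>i. size (enc ((step Q ^^ i) (init Q ()))) \<le> B) \<Longrightarrow>
       \<exists>t \<le> (N + 2) * poly p B. outputs_in_time Q P (enc ((step Q ^^ N) (init Q ()))) t"
proof -
  have "PT (\<lambda>Q s. step Q s = s)" by (intro pt assms)
  from PT_merge3[OF assms this] obtain P0 i pi s ps d pd where
    "computes P0 i pi init" "computes P0 s ps step" "computes P0 d pd (\<lambda>Q s. step Q s = s)" .
  note c = this
  define n where "n = length P0"
  \<comment> \<open>\<open>main\<close> has to be function 0, where a run begins; the relocated
    functions of \<open>P0\<close> occupy 1 to \<open>n\<close>, and \<open>loop\<close> comes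
    behind them.\<close>
  define main where "main = ECall (1 + n) [ECall (1 + i) [ELeaf]]"
  define P where "P = [main] @ map (shift (length [main])) P0"
  \<comment> \<open>A positive test binds two leaves, hence the index 2 for the state.\<close>
  define loop where "loop = ECase (ECall (1 + d) [EVar 0]) (ECall (1 + n) [ECall (1 + s) [EVar 0]]) (EVar 2)"
  have i: "computes P (1 + i) pi init" and s: "computes P (1 + s) ps step"
    and d: "computes P (1 + d) pd (\<lambda>Q s. step Q s = s)"
    using c[THEN computes_shift[where L = "[main]"]] unfolding P_def by simp_all
  let ?P = "P @ [loop]"
  have P: "?P ! (1 + n) = loop" "1 + n < length ?P" "?P ! 0 = main"
    by (simp_all add: P_def n_def nth_append)
  have loop: "\<exists>t. t \<le> (N + 1) * poly (ps + pd + 10) B \<and> evaluates Q ?P [enc x] loop (enc ((step Q ^^ N) x)) t"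
    if "step Q ((step Q ^^ N) x) = (step Q ^^ N) x" "\<And>i. size (enc ((step Q ^^ i) x)) \<le> B" for Q N B x
    using that
  proof (induction N arbitrary: x)
    case N: (0 x)
    have "evaluates Q ?P [enc x] (EVar 0) (enc x) 1" by (intro evaluates_var) simp_all
    from computes_call[OF d this] obtain t where t: "t \<le> 1 + poly pd (size (enc x)) + 1"
      "evaluates Q ?P [enc x] (ECall (1 + d) [EVar 0]) (enc (step Q x = x)) t" by blast
    have "evaluates Q ?P [enc x] loop (enc x) (t + 1 + 1)"
      by (subst (2) loop_def, rule ev_case_node[where a = Leaf and b = Leaf, OF _ evaluates_var]) (use N t(2) in simp_all)
    moreover have "poly pd (size (enc x)) \<le> poly pd B" using N(2)[of 0] by (intro poly_nat_mono) simp
    ultimately show ?case using t(1) by (intro ex_timeI) auto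
  next
    case (Suc N x)
    have v: "evaluates Q ?P [enc x] (EVar 0) (enc x) 1" by (intro evaluates_var) simp_all
    from computes_call[OF d this] obtain t where t: "t \<le> 1 + poly pd (size (enc x)) + 1"
      "evaluates Q ?P [enc x] (ECall (1 + d) [EVar 0]) (enc (step Q x = x)) t" by blast
    have le: "poly pd (size (enc x)) \<le> poly pd B" "poly ps (size (enc x)) \<le> poly ps B"
      using Suc.prems(2)[of 0] by (auto intro: poly_nat_mono)
    show ?case
    proof (cases "step Q x = x")
      case True
      then have "(step Q ^^ k) x = x" for k by (induction k) auto
      moreover have "evaluates Q ?P [enc x] loop (enc x) (t + 1 + 1)"
        by (subst (2) loop_def, rule ev_case_node[where a = Leaf and b = Leaf, OF _ evaluates_var]) (use True t(2) in simp_all)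
      ultimately show ?thesis using t(1) le by (intro ex_timeI) (auto simp del: funpow.simps)
    next
      case False
      from computes_call[OF s v] obtain t1 where t1: "t1 \<le> 1 + poly ps (size (enc x)) + 1"
        "evaluates Q ?P [enc x] (ECall (1 + s) [EVar 0]) (enc (step Q x)) t1" by blast
      obtain t2 where t2: "t2 \<le> (N + 1) * poly (ps + pd + 10) B"
        "evaluates Q ?P [enc (step Q x)] loop (enc ((step Q ^^ N) (step Q x))) t2"
        using Suc.IH[of "step Q x"] Suc.prems(1) Suc.prems(2)[of "Suc _"]
        by (auto simp: funpow_swap1 simp del: funpow.simps simp: funpow_Suc_right)
      have "evaluates Q ?P [enc x] (ECall (1 + n) [ECall (1 + s) [EVar 0]])
          (enc ((step Q ^^ N) (step Q x))) (t1 + 0 + t2 + 1)"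
        by (rule ev_call[OF ev_cons[OF t1(2) ev_nil]]) (use P t2(2) in simp_all)
      from ev_case_leaf[OF _ this, of "ECall (1 + d) [EVar 0]" t "EVar 2"] t(2) False
      have "evaluates Q ?P [enc x] loop (enc ((step Q ^^ Suc N) x)) (t + (t1 + 0 + t2 + 1) + 1)"
        by (simp add: loop_def funpow_Suc_right del: funpow.simps)
      then show ?thesis using t(1) t1(1) t2(1) le by (intro ex_timeI) auto
    qed
  qed
  define p where "p = ps + pd + 10 + [:poly pi 0 + 10:]"
  show ?thesis
  proof (rule that[of p ?P])
    fix Q N B
    assume fp: "step Q ((step Q ^^ N) (init Q ())) = (step Q ^^ N) (init Q ())"
      and sz: "\<And>i. size (enc ((step Q ^^ i) (init Q ()))) \<le> B"
    have "evaluates Q ?P [] ELeaf (enc ()) 1" using ev_leaf by simp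
    from computes_call[OF i this] obtain t1 where t1: "t1 \<le> 1 + poly pi 0 + 1"
      "evaluates Q ?P [] (ECall (1 + i) [ELeaf]) (enc (init Q ())) t1" by auto
    from loop[OF fp sz] obtain t2 where t2: "t2 \<le> (N + 1) * poly (ps + pd + 10) B"
      "evaluates Q ?P [enc (init Q ())] loop (enc ((step Q ^^ N) (init Q ()))) t2" by blast
    have "evaluates Q ?P [] main (enc ((step Q ^^ N) (init Q ()))) (t1 + 0 + t2 + 1)"
      unfolding main_def by (rule ev_call[OF ev_cons[OF t1(2) ev_nil]]) (use P t2(2) in simp_all)
    then have *: "evaluates Q ?P [] (ECall 0 []) (enc ((step Q ^^ N) (init Q ()))) (0 + (t1 + 0 + t2 + 1) + 1)"
      by (intro ev_call[OF ev_nil]) (use P in simp_all)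
    have "t2 + (poly pi 0 + 10) \<le> (N + 2) * poly p B"
    proof -
      have "(N + 1) * poly (ps + pd + 10) B \<le> (N + 1) * poly p B" by (intro mult_left_mono) (auto simp: p_def)
      then show ?thesis using t2(1) by (simp add: p_def)
    qed
    then show "\<exists>t \<le> (N + 2) * poly p B. outputs_in_time Q ?P (enc ((step Q ^^ N) (init Q ()))) t"
      unfolding outputs_in_time_def using t1(1) by (intro ex_timeI[OF * _ refl]) linarith
  qed
qed

section \<open>The learning algorithm\<close>

lemma PT_app2:
  assumes "PT (\<lambda>Q z. f Q (fst z) (snd z))" "PT A" "PT B"
  shows "PT (\<lambda>Q a. f Q (A Q a) (B Q a))"
  using PT_comp[OF assms(1) PT_Pair[OF assms(2,3)]] by simp

lemma PT_app3:
  assumes "PT (\<lambda>Q z. f Q (fst z) (fst (snd z)) (snd (snd z)))" "PT A" "PT B" "PT C"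
  shows "PT (\<lambda>Q a. f Q (A Q a) (B Q a) (C Q a))"
  using PT_comp[OF assms(1) PT_Pair[OF assms(2) PT_Pair[OF assms(3,4)]]] by simp

text \<open>A hypothesis is a list of facts whose elements below \<open>K\<close> are constants. The refinements of a
  hypothesis have as elements pairs of an element and a label. The trivial label is \<open>[]\<close>; a
  constant with the trivial label is that constant, all other pairs are existential.\<close>

type_synonym label = "fact list"
type_synonym lfact = "nat \<times> (nat \<times> label) list"

text \<open>Without the cut-off after \<open>n\<close> factors, this product would be of exponential size.\<close>

primrec plist :: "nat \<Rightarrow> 'a list list \<Rightarrow> 'a list list" where
  "plist 0 xss = [[]]"
| "plist (Suc n) xss =
     (if xss = [] then [[]] else concat (map (\<lambda>x. map (\<lambda>ys. x # ys) (plist n (tl xss))) (head [] xss)))"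

definition lifts :: "nat \<Rightarrow> (nat \<Rightarrow> label list) \<Rightarrow> fact \<Rightarrow> (nat \<times> label) list list" where
  "lifts r lab g = plist r (map (\<lambda>u. map (\<lambda>l. (u, l)) (lab u)) (snd g))"

definition refinement ::
    "nat \<Rightarrow> (nat \<Rightarrow> label list) \<Rightarrow> (fact \<Rightarrow> (nat \<times> label) list \<Rightarrow> bool) \<Rightarrow> fact list \<Rightarrow> lfact list" where
  "refinement r lab ok J =
     concat (map (\<lambda>g. map (\<lambda>zs. (fst g, zs)) (filter (\<lambda>zs. ok g zs) (lifts r lab g))) J)"

text \<open>Splitting at the fact \<open>f\<close> yields a double cover: along \<open>f\<close> the sheets are interchanged
  according to \<open>p\<close>.\<close>

definition split_labels :: "nat \<Rightarrow> fact \<Rightarrow> nat \<Rightarrow> label list" where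
  "split_labels K f u = (if u < K then [[]] else [[], [f]])"

definition flip :: "nat \<Rightarrow> fact \<Rightarrow> nat \<times> label \<Rightarrow> nat \<times> label" where
  "flip K f z = (if fst z < K then z else (fst z, if snd z = [] then [f] else []))"

text \<open>A fact other than \<open>f\<close> has all its existential arguments in one sheet. Over
  \<open>f\<close> only \<open>p\<close> and its mirror image remain, so passing through
  \<open>f\<close> changes the sheet as \<open>p\<close> prescribes, from whichever sheet one
  comes.\<close>

definition split_ok :: "nat \<Rightarrow> fact \<Rightarrow> (nat \<times> label) list \<Rightarrow> fact \<Rightarrow> (nat \<times> label) list \<Rightarrow> bool" where
  "split_ok K f p g zs \<longleftrightarrow>
     (if g = f then zs = p \<or> zs = map (\<lambda>z. flip K f z) p
      else \<forall>z \<in> set zs. \<forall>z' \<in> set zs. fst z < K \<or> fst z' < K \<or> snd z = snd z')"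

definition split_at :: "nat \<Rightarrow> nat \<Rightarrow> fact list \<Rightarrow> fact \<Rightarrow> (nat \<times> label) list \<Rightarrow> lfact list" where
  "split_at K r J f p = refinement r (\<lambda>u. split_labels K f u) (\<lambda>g zs. split_ok K f p g zs) J"

text \<open>The frontier of a component \<open>C\<close>: the label \<open>[g]\<close> of an existential element says that the
  part of \<open>C\<close> hanging off that element along \<open>g\<close> is missing.\<close>

definition frontier_labels :: "nat \<Rightarrow> fact list \<Rightarrow> nat \<Rightarrow> label list" where
  "frontier_labels K J u =
     (if u < K then [[]] else []) @ map (\<lambda>g. [g]) (filter (\<lambda>g. u \<in> set (snd g)) J)"

text \<open>Each lift of a fact of \<open>C\<close> needs a witness: an existential argument whose
  missing part lies along another fact, or a copy of a constant in place of the constant itself.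
  Such copies exist because the query may map an existential variable to a constant.\<close>

definition frontier_ok :: "nat \<Rightarrow> fact list \<Rightarrow> fact \<Rightarrow> (nat \<times> label) list \<Rightarrow> bool" where
  "frontier_ok K C g zs \<longleftrightarrow>
     (g \<in> set C \<longrightarrow> (\<exists>z \<in> set zs. if fst z < K then snd z \<noteq> [] else snd z \<noteq> [g]))"

definition frontier :: "nat \<Rightarrow> nat \<Rightarrow> fact list \<Rightarrow> fact list \<Rightarrow> lfact list" where
  "frontier K r J C = refinement r (\<lambda>u. frontier_labels K J u) (\<lambda>g zs. frontier_ok K C g zs) J"

definition grow :: "nat \<Rightarrow> fact list \<Rightarrow> fact list \<Rightarrow> fact list" where
  "grow K J C = filter (\<lambda>g. g \<in> set C \<or>
     (\<exists>h \<in> set C. \<exists>u \<in> set (snd g). \<not> u < K \<and> u \<in> set (snd h))) J"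

definition component :: "nat \<Rightarrow> fact list \<Rightarrow> fact \<Rightarrow> fact list" where
  "component K J g = foldr (\<lambda>_ C. grow K J C) J [g]"

definition refinements :: "nat \<Rightarrow> nat \<Rightarrow> fact list \<Rightarrow> lfact list list" where
  "refinements K r J = map (\<lambda>g. frontier K r J (component K J g)) J @
     concat (map (\<lambda>f. map (\<lambda>p. split_at K r J f p) (lifts r (\<lambda>u. split_labels K f u) f)) J)"

text \<open>Renumbering from \<open>K\<close> upwards turns a refinement into a hypothesis again.
  Names are bounded through the length of \<open>E\<close>, so labels do not accumulate over the
  rounds.\<close>

definition name_elem :: "nat \<Rightarrow> (nat \<times> label) list \<Rightarrow> nat \<times> label \<Rightarrow> nat" where
  "name_elem K E z =
     (if fst z < K \<and> snd z = [] then fst z else K + length (takeWhile (\<lambda>y. y \<noteq> z) E))"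

definition name_facts :: "nat \<Rightarrow> lfact list \<Rightarrow> fact list" where
  "name_facts K L = (let E = concat (map (\<lambda>c. snd c) L) in
     map (\<lambda>c. (fst c, map (\<lambda>z. name_elem K E z) (snd c))) L)"

text \<open>The argument of \<open>Q\<close> is literally an encoding of the example with the one
  source fact \<open>\<alpha>\<close>; its elements are the arguments that occur.\<close>

definition query_pos :: "query \<Rightarrow> fact \<Rightarrow> fact list \<Rightarrow> bool" where
  "query_pos Q \<alpha> J = Q (enc ((snd \<alpha>, [\<alpha>]), (concat (map (\<lambda>f. snd f) J), J)))"

definition minimize :: "query \<Rightarrow> fact \<Rightarrow> fact list \<Rightarrow> fact list" where
  "minimize Q \<alpha> J = foldr (\<lambda>f acc. if query_pos Q \<alpha> (filter (\<lambda>g. g \<noteq> f) acc)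
     then filter (\<lambda>g. g \<noteq> f) acc else acc) (remdups J) (remdups J)"

text \<open>Only the length matters; comparing lengths of lists saves arithmetic in the algorithm.\<close>

definition bulk :: "nat \<Rightarrow> fact list \<Rightarrow> unit list" where
  "bulk K J = map (\<lambda>_. ()) (remdups J) @
     map (\<lambda>_. ()) (remdups (filter (\<lambda>u. \<not> u < K) (concat (map (\<lambda>f. snd f) J))))"

text \<open>The default of \<open>head\<close> is the current hypothesis, and every candidate in the
  list has larger bulk. Hence a hypothesis is fixed exactly if no refinement makes progress.\<close>

definition improve :: "query \<Rightarrow> nat \<Rightarrow> nat \<Rightarrow> fact \<times> fact list \<Rightarrow> fact \<times> fact list" where
  "improve Q K r c = (fst c, head (snd c)
     (filter (\<lambda>J. length (bulk K (snd c)) < length (bulk K J))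
       (map (\<lambda>J. minimize Q (fst c) J) (filter (\<lambda>J. query_pos Q (fst c) J)
         (map (\<lambda>L. name_facts K L) (refinements K r (snd c)))))))"

definition step :: "nat \<Rightarrow> nat \<Rightarrow> query \<Rightarrow> (fact \<times> fact list) list \<Rightarrow> (fact \<times> fact list) list" where
  "step K r Q cs = map (\<lambda>c. improve Q K r c) cs"

definition start :: "(fact \<times> fact list) list \<Rightarrow> query \<Rightarrow> unit \<Rightarrow> (fact \<times> fact list) list" where
  "start cs Q _ = map (\<lambda>c. (fst c, minimize Q (fst c) (snd c))) cs"

section \<open>Running time of the operations of the algorithm\<close>

text \<open>\<open>n\<close> belongs to the program, not to its input: it is an arity bound, on
  which the degree of the polynomial may depend.\<close>

lemma PT_plist [pt]:
  assumes "PT A" shows "PT (\<lambda>Q a. plist n (A Q a))"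
proof -
  have "PT (\<lambda>Q (xss :: 'b::enc list list). plist n xss)"
  proof (induction n)
    case 0
    show ?case by (simp add: PT_const)
  next
    case (Suc n)
    have "PT (\<lambda>Q (z :: 'b \<times> 'b list list). plist n (tl (snd z)))"
      by (rule PT_comp[OF Suc.IH]) (intro pt)
    then show ?case unfolding plist.simps by (intro pt)
  qed
  from PT_comp[OF this assms] show ?thesis .
qed

lemma PT_split_labels [pt]: "PT A \<Longrightarrow> PT B \<Longrightarrow> PT (\<lambda>Q a. split_labels K (A Q a) (B Q a))"
  by (rule PT_app2) (unfold split_labels_def, intro pt)

lemma PT_flip [pt]: "PT A \<Longrightarrow> PT B \<Longrightarrow> PT (\<lambda>Q a. flip K (A Q a) (B Q a))"
  by (rule PT_app2) (unfold flip_def, intro pt)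

lemma PT_split_at [pt]: "PT A \<Longrightarrow> PT B \<Longrightarrow> PT C \<Longrightarrow> PT (\<lambda>Q a. split_at K r (A Q a) (B Q a) (C Q a))"
  by (rule PT_app3) (unfold split_at_def refinement_def split_ok_def lifts_def, intro pt)

lemma PT_frontier [pt]: "PT A \<Longrightarrow> PT B \<Longrightarrow> PT (\<lambda>Q a. frontier K r (A Q a) (B Q a))"
  by (rule PT_app2) (unfold frontier_def refinement_def frontier_labels_def frontier_ok_def lifts_def, intro pt)

lemma PT_grow [pt]: "PT A \<Longrightarrow> PT B \<Longrightarrow> PT (\<lambda>Q a. grow K (A Q a) (B Q a))"
  by (rule PT_app2) (unfold grow_def, intro pt)

text \<open>The accumulator stays small since \<open>grow\<close> only selects facts of
  \<open>J\<close>.\<close>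

lemma PT_component [pt]: "PT A \<Longrightarrow> PT B \<Longrightarrow> PT (\<lambda>Q a. component K (A Q a) (B Q a))"
proof (rule PT_app2[of "\<lambda>Q. component K"])
  show "PT (\<lambda>Q z. component K (fst z) (snd z))" unfolding component_def
  proof (rule PT_foldr[where s = "[:0,1:]"])
    fix a :: "fact list \<times> fact" and xs :: "fact list"
    have "size (enc (grow K J C)) \<le> size (enc J)" for J C
      by (simp add: grow_def size_enc_filter)
    then show "size (enc (foldr (\<lambda>_ C. grow K (fst a) C) xs [snd a]))
        \<le> poly [:0, 1:] (size (enc xs) + size (enc [snd a]) + size (enc a))"
      using size_enc_fst[of a] by (cases xs) (auto intro!: trans_le_add2 le_SucI intro: order_trans)
  qed (intro pt)+
qed

lemma PT_refinements [pt]: "PT A \<Longrightarrow> PT (\<lambda>Q a. refinements K r (A Q a))"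
  by (rule PT_comp[of "\<lambda>Q. refinements K r"]) (unfold refinements_def lifts_def, intro pt)

lemma PT_name_elem [pt]: "PT A \<Longrightarrow> PT B \<Longrightarrow> PT (\<lambda>Q a. name_elem K (A Q a) (B Q a))"
  by (rule PT_app2) (unfold name_elem_def, intro pt)

lemma PT_name_facts [pt]: "PT A \<Longrightarrow> PT (\<lambda>Q a. name_facts K (A Q a))"
  by (rule PT_comp[of "\<lambda>Q. name_facts K"]) (unfold name_facts_def, intro pt)

lemma PT_query_pos [pt]: "PT A \<Longrightarrow> PT B \<Longrightarrow> PT (\<lambda>Q a. query_pos Q (A Q a) (B Q a))"
  by (rule PT_app2) (unfold query_pos_def, intro pt)

lemma size_minimize_fold:
  "size (enc (foldr (\<lambda>f acc. if query_pos Q \<alpha> (filter (\<lambda>g. g \<noteq> f) acc)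
     then filter (\<lambda>g. g \<noteq> f) acc else acc) xs ys)) \<le> size (enc ys)"
  by (induction xs) (auto intro: order_trans[OF size_enc_filter])

lemma PT_minimize [pt]: "PT A \<Longrightarrow> PT B \<Longrightarrow> PT (\<lambda>Q a. minimize Q (A Q a) (B Q a))"
proof (rule PT_app2[of "\<lambda>Q. minimize Q"])
  show "PT (\<lambda>Q z. minimize Q (fst z) (snd z))" unfolding minimize_def
  proof (rule PT_foldr[where s = "[:0,1:]" and H = "\<lambda>Q f acc z. if query_pos Q (fst z) (filter (\<lambda>g. g \<noteq> f) acc)
      then filter (\<lambda>g. g \<noteq> f) acc else acc"])
    fix Q and a :: "fact \<times> fact list" and xs :: "fact list"
    show "size (enc (foldr (\<lambda>f acc. if query_pos Q (fst a) (filter (\<lambda>g. g \<noteq> f) acc)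
        then filter (\<lambda>g. g \<noteq> f) acc else acc) xs (remdups (snd a))))
      \<le> poly [:0, 1:] (size (enc xs) + size (enc (remdups (snd a))) + size (enc a))"
      using size_minimize_fold[of Q "fst a" xs "remdups (snd a)"] by simp
  qed (intro pt)+
qed

lemma PT_bulk [pt]: "PT A \<Longrightarrow> PT (\<lambda>Q a. bulk K (A Q a))"
  by (rule PT_comp[of "\<lambda>Q. bulk K"]) (unfold bulk_def, intro pt)

lemma PT_step: "PT (step K r)"
  unfolding step_def improve_def by (intro pt)

lemma PT_start: "PT (start cs)"
  unfolding start_def by (intro pt)

section \<open>Acyclic sets of facts\<close>

text \<open>Throughout, \<open>E\<close> is the set of existential elements.\<close>

definition no_cycle :: "(nat \<Rightarrow> bool) \<Rightarrow> fact set \<Rightarrow> bool" where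
  "no_cycle E F \<longleftrightarrow> (\<forall>vs es. incidence_cycle \<lparr>elements = {}, facts = F\<rparr> vs es \<longrightarrow>
     (\<exists>x. \<not> E x \<and> Elem x \<in> set vs))"

definition exs :: "(nat \<Rightarrow> bool) \<Rightarrow> fact set \<Rightarrow> nat set" where
  "exs E F = {u. E u \<and> (\<exists>g \<in> F. u \<in> set (snd g))}"

text \<open>The condition against cycles of length 2, which arise from parallel edges.\<close>

definition no_repeat :: "(nat \<Rightarrow> bool) \<Rightarrow> fact \<Rightarrow> bool" where
  "no_repeat E g \<longleftrightarrow> (\<forall>i < length (snd g). \<forall>j < length (snd g).
     E (snd g ! i) \<longrightarrow> snd g ! i = snd g ! j \<longrightarrow> i = j)"

text \<open>A construction order of an acyclic component: each fact is attached to the earlier ones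
  at exactly one existential element. Inductions thus remove a leaf, the fact attached last.\<close>

inductive tree :: "(nat \<Rightarrow> bool) \<Rightarrow> fact list \<Rightarrow> bool" for E where
  tree_single: "no_repeat E g \<Longrightarrow> tree E [g]"
| tree_Cons: "tree E gs \<Longrightarrow> no_repeat E g \<Longrightarrow> g \<notin> set gs \<Longrightarrow>
    exs E {g} \<inter> exs E (set gs) = {a} \<Longrightarrow> tree E (g # gs)"

definition ipath :: "(nat \<Rightarrow> bool) \<Rightarrow> fact set \<Rightarrow> vertex list \<Rightarrow> edge list \<Rightarrow> bool" where
  "ipath E F vs es \<longleftrightarrow> length vs = Suc (length es) \<and> distinct vs \<and>
     (\<forall>i < length es. endpoints (es ! i) = {vs ! i, vs ! Suc i}) \<and>
     (\<forall>e \<in> set es. fst e \<in> F \<and> snd e < length (snd (fst e))) \<and>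
     (\<forall>v \<in> set vs. case v of Elem u \<Rightarrow> u \<in> exs E F | Fact f \<Rightarrow> f \<in> F)"

section \<open>Paths and connected components\<close>

lemma exs_mono: "F \<subseteq> G \<Longrightarrow> exs E F \<subseteq> exs E G"
  by (auto simp: exs_def)

lemma exs_nth:
  assumes "u \<in> exs E {g}"
  obtains i where "i < length (snd g)" "snd g ! i = u" "E u"
  using assms by (auto simp: exs_def in_set_conv_nth)

lemma no_cycle_subset: "no_cycle E F \<Longrightarrow> G \<subseteq> F \<Longrightarrow> no_cycle E G"
  unfolding no_cycle_def incidence_cycle_def incidence_edges_def by (simp add: subset_iff) blast

lemma ipath_mono: "ipath E F vs es \<Longrightarrow> F \<subseteq> G \<Longrightarrow> ipath E G vs es"
  using exs_mono[of F G E] unfolding ipath_def by (fastforce split: vertex.splits)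

lemma ipath_distinct_edges:
  assumes "ipath E F vs es" shows "distinct es"
  unfolding distinct_conv_nth
proof (intro allI impI)
  fix i j assume *: "i < length es" "j < length es" "i \<noteq> j"
  have v: "length vs = Suc (length es)" "distinct vs"
    "\<And>i. i < length es \<Longrightarrow> endpoints (es ! i) = {vs ! i, vs ! Suc i}"
    using assms unfolding ipath_def by auto
  show "es ! i \<noteq> es ! j"
  proof
    assume "es ! i = es ! j"
    then have "{vs ! i, vs ! Suc i} = {vs ! j, vs ! Suc j}" using v(3) * by metis
    then consider "vs ! i = vs ! j" | "vs ! i = vs ! Suc j \<and> vs ! Suc i = vs ! j"
      by (auto simp: doubleton_eq_iff)
    then show False using v(1,2) * by cases (auto simp: nth_eq_iff_index_eq)
  qed
qed

lemma ipath_rev: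
  assumes "ipath E F vs es" shows "ipath E F (rev vs) (rev es)"
proof -
  have "endpoints (rev es ! i) = {rev vs ! i, rev vs ! Suc i}" if "i < length es" for i
  proof -
    have l: "length vs = Suc (length es)" using assms by (simp add: ipath_def)
    have "rev es ! i = es ! (length es - Suc i)" using that by (simp add: rev_nth)
    moreover have "rev vs ! i = vs ! (Suc (length es - Suc i))" "rev vs ! Suc i = vs ! (length es - Suc i)"
      using that l by (simp_all add: rev_nth Suc_diff_Suc)
    moreover have "endpoints (es ! (length es - Suc i)) =
        {vs ! (length es - Suc i), vs ! (Suc (length es - Suc i))}"
      using assms that by (simp add: ipath_def)
    ultimately show ?thesis by auto
  qed
  then show ?thesis using assms by (simp add: ipath_def)
qed

lemma ipath_extend:
  assumes p: "ipath E F vs es" and "last vs = Elem (snd g ! i)" "g \<notin> F"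
    and i: "i < length (snd g)" "j < length (snd g)" and v: "E (snd g ! j)" "snd g ! j \<notin> exs E F"
  shows "ipath E (insert g F) (vs @ [Fact g, Elem (snd g ! j)]) (es @ [(g, i), (g, j)])"
proof -
  have l: "length vs = Suc (length es)" using p by (simp add: ipath_def)
  then have last: "vs ! length es = Elem (snd g ! i)" using assms(2) by (metis diff_Suc_1 last_conv_nth length_0_conv nat.distinct(1))
  have new: "Fact g \<notin> set vs" "Elem (snd g ! j) \<notin> set vs"
    using p assms(3) v by (auto simp: ipath_def)
  have "endpoints ((es @ [(g, i), (g, j)]) ! k) =
      {(vs @ [Fact g, Elem (snd g ! j)]) ! k, (vs @ [Fact g, Elem (snd g ! j)]) ! Suc k}"
    if "k < length (es @ [(g, i), (g, j)])" for k
  proof -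
    have "k < Suc (Suc (length es))" using that by simp
    then consider "k < length es" | "k = length es" | "k = Suc (length es)" by linarith
    then show ?thesis
    proof cases
      case 1 then show ?thesis using p l by (simp add: ipath_def nth_append)
    next
      case 2 then show ?thesis using l last by (simp add: nth_append endpoints_def)
    next
      case 3 then show ?thesis using l by (auto simp add: nth_append endpoints_def)
    qed
  qed
  moreover have "\<forall>v \<in> set vs. case v of Elem u \<Rightarrow> u \<in> exs E (insert g F) | Fact f \<Rightarrow> f \<in> insert g F"
    using ipath_mono[OF p, of "insert g F"] by (auto simp: ipath_def)
  ultimately show ?thesis using p new i v
    unfolding ipath_def by (auto simp: exs_def)
qed

text \<open>A path from the earlier facts to an element that only the last attached fact contains
  passes from one to the other at the joint \<open>a\<close>.\<close>

lemma tree_path: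
  assumes "tree E gs" "u \<in> exs E (set gs)" "v \<in> exs E (set gs)"
  shows "\<exists>vs es. ipath E (set gs) vs es \<and> hd vs = Elem u \<and> last vs = Elem v"
  using assms
proof (induction arbitrary: u v rule: tree.induct)
  case (tree_single g)
  then have *: "u \<in> exs E {g}" "v \<in> exs E {g}" by auto
  show ?case
  proof (cases "u = v")
    case True
    then show ?thesis using * by (intro exI[of _ "[Elem u]"] exI[of _ "[]"]) (simp add: ipath_def)
  next
    case False
    obtain i where i: "i < length (snd g)" "snd g ! i = u" "E u" using exs_nth[OF *(1)] .
    obtain j where j: "j < length (snd g)" "snd g ! j = v" "E v" using exs_nth[OF *(2)] .
    show ?thesis using i j False *
      by (intro exI[of _ "[Elem u, Fact g, Elem v]"] exI[of _ "[(g, i), (g, j)]"])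
         (auto simp: ipath_def endpoints_def less_Suc_eq)
  qed
next
  case (tree_Cons gs g a)
  have a: "a \<in> exs E {g}" "a \<in> exs E (set gs)" using tree_Cons.hyps by auto
  obtain k where k: "k < length (snd g)" "snd g ! k = a" "E a" using exs_nth[OF a(1)] .
  have ext: "\<exists>vs es. ipath E (set (g # gs)) vs es \<and> hd vs = Elem u \<and> last vs = Elem v"
    if uv: "u \<in> exs E (set gs)" "v \<in> exs E {g}" "v \<notin> exs E (set gs)" for u v
  proof -
    obtain vs es where p: "ipath E (set gs) vs es" "hd vs = Elem u" "last vs = Elem a"
      using tree_Cons.IH[OF uv(1) a(2)] by blast
    obtain j where j: "j < length (snd g)" "snd g ! j = v" "E v" using exs_nth[OF uv(2)] .
    have "vs \<noteq> []" using p(1) by (auto simp: ipath_def)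
    with ipath_extend[OF p(1), of g k j] p j k uv tree_Cons.hyps show ?thesis
      by (intro exI[of _ "vs @ [Fact g, Elem v]"] exI[of _ "es @ [(g, k), (g, j)]"]) auto
  qed
  have split: "x \<in> exs E {g}" if "x \<in> exs E (set (g # gs))" "x \<notin> exs E (set gs)" for x
    using that by (auto simp: exs_def)
  consider "u \<in> exs E (set gs)" "v \<in> exs E (set gs)" | "u \<in> exs E (set gs)" "v \<notin> exs E (set gs)"
    | "u \<notin> exs E (set gs)" "v \<in> exs E (set gs)" | "u \<notin> exs E (set gs)" "v \<notin> exs E (set gs)" by blast
  then show ?case
  proof cases
    case 1
    with tree_Cons.IH obtain vs es where "ipath E (set gs) vs es" "hd vs = Elem u" "last vs = Elem v"
      by blast
    then show ?thesis using ipath_mono[of E "set gs" vs es "set (g # gs)"] by auto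
  next
    case 2
    then show ?thesis using ext split tree_Cons.prems by blast
  next
    case 3
    then obtain vs es where p: "ipath E (set (g # gs)) vs es" "hd vs = Elem v" "last vs = Elem u"
      using ext split tree_Cons.prems by blast
    from ipath_rev[OF p(1)] p show ?thesis
      by (intro exI[of _ "rev vs"] exI[of _ "rev es"]) (auto simp: hd_rev last_rev)
  next
    case 4
    then have *: "u \<in> exs E {g}" "v \<in> exs E {g}" using split tree_Cons.prems by blast+
    show ?thesis
    proof (cases "u = v")
      case True
      then show ?thesis using tree_Cons.prems
        by (intro exI[of _ "[Elem u]"] exI[of _ "[]"]) (simp add: ipath_def)
    next
      case False
      obtain i where i: "i < length (snd g)" "snd g ! i = u" "E u" using exs_nth[OF *(1)] .
      obtain j where j: "j < length (snd g)" "snd g ! j = v" "E v" using exs_nth[OF *(2)] .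
      show ?thesis using i j False tree_Cons.prems
        by (intro exI[of _ "[Elem u, Fact g, Elem v]"] exI[of _ "[(g, i), (g, j)]"])
           (auto simp: ipath_def endpoints_def less_Suc_eq)
    qed
  qed
qed

lemma no_cycle_no_repeat:
  assumes "no_cycle E F" "g \<in> F" shows "no_repeat E g"
  unfolding no_repeat_def
proof (intro allI impI)
  fix i j assume *: "i < length (snd g)" "j < length (snd g)" "E (snd g ! i)" "snd g ! i = snd g ! j"
  show "i = j"
  proof (rule ccontr)
    assume "i \<noteq> j"
    then have "incidence_cycle \<lparr>elements = {}, facts = F\<rparr> [Elem (snd g ! i), Fact g] [(g, i), (g, j)]"
      using * assms(2) by (auto simp: incidence_cycle_def incidence_edges_def endpoints_def less_Suc_eq)
    then show False using assms(1) * unfolding no_cycle_def by fastforce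
  qed
qed

text \<open>Two common elements would be joined by a path inside the tree and by a second one
  through \<open>g\<close>. Both avoid constants, so together they would form a forbidden
  cycle.\<close>

lemma no_cycle_tree_meet:
  assumes nc: "no_cycle E F" and t: "tree E gs" "set gs \<subseteq> F" and g: "g \<in> F" "g \<notin> set gs"
    and u: "u \<in> exs E {g}" "u \<in> exs E (set gs)" and v: "v \<in> exs E {g}" "v \<in> exs E (set gs)"
  shows "u = v"
proof (rule ccontr)
  assume "u \<noteq> v"
  obtain vs es where p: "ipath E (set gs) vs es" "hd vs = Elem u" "last vs = Elem v"
    using tree_path[OF t(1) u(2) v(2)] by blast
  obtain i where i: "i < length (snd g)" "snd g ! i = u" "E u" using exs_nth[OF u(1)] .
  obtain j where j: "j < length (snd g)" "snd g ! j = v" "E v" using exs_nth[OF v(1)] .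
  have l: "length vs = Suc (length es)" "vs \<noteq> []" using p(1) by (auto simp: ipath_def)
  have first: "vs ! 0 = Elem u" using p(2) l by (simp add: hd_conv_nth)
  have last: "vs ! length es = Elem v" using p(3) l by (simp add: last_conv_nth)
  let ?vs = "vs @ [Fact g]" and ?es = "es @ [(g, j), (g, i)]"
  have "endpoints (?es ! k) = {?vs ! k, ?vs ! (Suc k mod length ?es)}" if "k < length ?es" for k
  proof -
    have "k < Suc (Suc (length es))" using that by simp
    then consider "k < length es" | "k = length es" | "k = Suc (length es)" by linarith
    then show ?thesis
    proof cases
      case 1 then show ?thesis using p l by (simp add: ipath_def nth_append)
    next
      case 2 then show ?thesis using l last j by (simp add: nth_append endpoints_def)
    next
      case 3 then show ?thesis using l first i by (auto simp add: nth_append endpoints_def)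
    qed
  qed
  moreover have "distinct ?vs" using p(1) g by (auto simp: ipath_def)
  moreover have "distinct ?es" using ipath_distinct_edges[OF p(1)] p(1) g i j \<open>u \<noteq> v\<close>
    by (auto simp: ipath_def)
  moreover have "set ?es \<subseteq> incidence_edges \<lparr>elements = {}, facts = F\<rparr>"
    using p(1) t g i j by (auto simp: ipath_def incidence_edges_def)
  ultimately have "incidence_cycle \<lparr>elements = {}, facts = F\<rparr> ?vs ?es"
    using l unfolding incidence_cycle_def by auto
  with nc obtain x where "\<not> E x" "Elem x \<in> set vs" unfolding no_cycle_def by fastforce
  then show False using p(1) by (auto simp: ipath_def exs_def)
qed

lemma tree_distinct: "tree E gs \<Longrightarrow> distinct gs"
  by (induction rule: tree.induct) auto

text \<open>A longest tree through \<open>g0\<close> is closed: a further fact that shares an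
  existential element with it shares exactly one and could be attached.\<close>

lemma no_cycle_component:
  assumes nc: "no_cycle E F" and "finite F" "g0 \<in> F"
  obtains gs where "tree E gs" "g0 \<in> set gs" "set gs \<subseteq> F"
    "\<And>g. g \<in> F \<Longrightarrow> exs E {g} \<inter> exs E (set gs) \<noteq> {} \<Longrightarrow> g \<in> set gs"
proof -
  let ?P = "\<lambda>gs. tree E gs \<and> g0 \<in> set gs \<and> set gs \<subseteq> F"
  have "?P [g0]" using no_cycle_no_repeat[OF nc assms(3)] assms(3) by (auto intro: tree_single)
  moreover have "\<forall>gs. ?P gs \<longrightarrow> length gs < Suc (card F)"
    using tree_distinct distinct_card card_mono[OF assms(2)] by (metis less_Suc_eq_le)
  ultimately obtain gs where gs: "?P gs" "\<forall>hs. ?P hs \<longrightarrow> length hs \<le> length gs"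
    using ex_has_greatest_nat[of ?P "[g0]" length "Suc (card F)"] by auto
  show ?thesis
  proof (rule that[of gs])
    fix g assume g: "g \<in> F" "exs E {g} \<inter> exs E (set gs) \<noteq> {}"
    then obtain a where a: "a \<in> exs E {g} \<inter> exs E (set gs)" by blast
    show "g \<in> set gs"
    proof (rule ccontr)
      assume "g \<notin> set gs"
      moreover from this have "exs E {g} \<inter> exs E (set gs) = {a}"
        using no_cycle_tree_meet[OF nc, of gs g] gs g a by blast
      ultimately have "?P (g # gs)"
        using tree_Cons[of E gs g a] gs(1) no_cycle_no_repeat[OF nc g(1)] g by auto
      then show False using gs(2) by fastforce
    qed
  qed (use gs in auto)
qed

section \<open>Colourings of the incidence graph\<close>

text \<open>Deleting an edge of a tree disconnects it; hence every assignment of parities to the edges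
  comes from a 2-colouring of the vertices.\<close>

lemma tree_colouring:
  fixes w :: "fact \<Rightarrow> nat \<Rightarrow> bool"
  shows "tree E gs \<Longrightarrow> \<exists>col b. \<forall>g \<in> set gs. \<forall>j < length (snd g). E (snd g ! j) \<longrightarrow>
     (col (snd g ! j) \<longleftrightarrow> b g \<noteq> w g j)"
proof (induction rule: tree.induct)
  case (tree_single g)
  define pos where "pos u = (THE j. j < length (snd g) \<and> snd g ! j = u)" for u
  have "pos (snd g ! j) = j" if "j < length (snd g)" "E (snd g ! j)" for j
    using tree_single that unfolding pos_def no_repeat_def by (intro the_equality) auto
  then show ?case by (intro exI[of _ "\<lambda>u. False \<noteq> w g (pos u)"] exI[of _ "\<lambda>_. False"]) auto
next
  case (tree_Cons gs g a)
  define pos where "pos u = (THE j. j < length (snd g) \<and> snd g ! j = u)" for u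
  have pos: "pos (snd g ! j) = j" if "j < length (snd g)" "E (snd g ! j)" for j
    using tree_Cons.hyps(2) that unfolding pos_def no_repeat_def by (intro the_equality) auto
  obtain col b where IH: "\<And>g j. g \<in> set gs \<Longrightarrow> j < length (snd g) \<Longrightarrow> E (snd g ! j) \<Longrightarrow>
     (col (snd g ! j) \<longleftrightarrow> b g \<noteq> w g j)" using tree_Cons.IH by blast
  \<comment> \<open>The colour of \<open>a\<close> is already fixed by the other facts;
    \<open>bg\<close> is the one value for \<open>g\<close> that agrees with it.\<close>
  define bg where "bg \<longleftrightarrow> (col a \<noteq> w g (pos a))"
  define col' where "col' u = (if u \<in> exs E (set gs) then col u else bg \<noteq> w g (pos u))" for u
  have "col' (snd h ! j) \<longleftrightarrow> (b(g := bg)) h \<noteq> w h j"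
    if h: "h \<in> set (g # gs)" "j < length (snd h)" "E (snd h ! j)" for h j
  proof (cases "h = g")
    case True
    show ?thesis
    proof (cases "snd h ! j \<in> exs E (set gs)")
      case in_gs: True
      moreover have "snd h ! j \<in> exs E {g}" using h True by (auto simp: exs_def)
      ultimately have "snd h ! j = a" using tree_Cons.hyps(4) by blast
      moreover from this have "pos a = j" using pos[of j] h True by simp
      ultimately show ?thesis using True in_gs by (auto simp: col'_def bg_def)
    next
      case False
      then show ?thesis using True h pos[of j] by (auto simp: col'_def)
    qed
  next
    case False
    with h have "h \<in> set gs" by auto
    moreover from this h have "snd h ! j \<in> exs E (set gs)" using nth_mem unfolding exs_def by blast
    ultimately show ?thesis using IH[of h j] h False by (auto simp: col'_def)
  qed
  then show ?case by blast
qed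

text \<open>Components share no existential elements, so their colourings can be chosen
  independently.\<close>

lemma no_cycle_colouring:
  fixes w :: "fact \<Rightarrow> nat \<Rightarrow> bool"
  assumes "finite F" "no_cycle E F"
  shows "\<exists>col b. \<forall>g \<in> F. \<forall>j < length (snd g). E (snd g ! j) \<longrightarrow> (col (snd g ! j) \<longleftrightarrow> b g \<noteq> w g j)"
  using assms
proof (induction F rule: finite_psubset_induct)
  case (psubset F)
  show ?case
  proof (cases "F = {}")
    case True then show ?thesis by simp
  next
    case False
    then obtain g0 where "g0 \<in> F" by blast
    then obtain gs where
      gs: "tree E gs" "g0 \<in> set gs" "set gs \<subseteq> F"
      "\<And>g. g \<in> F \<Longrightarrow> exs E {g} \<inter> exs E (set gs) \<noteq> {} \<Longrightarrow> g \<in> set gs"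
      using no_cycle_component[OF psubset.prems psubset.hyps, of g0 thesis] by blast
    have "F - set gs \<subset> F" using gs(2) \<open>g0 \<in> F\<close> by blast
    moreover have "no_cycle E (F - set gs)" using no_cycle_subset[OF psubset.prems] by blast
    ultimately obtain col b where 1: "\<And>g j. g \<in> F - set gs \<Longrightarrow> j < length (snd g) \<Longrightarrow> E (snd g ! j) \<Longrightarrow>
        (col (snd g ! j) \<longleftrightarrow> b g \<noteq> w g j)" using psubset.IH[of "F - set gs"] by blast
    obtain col' b' where 2: "\<And>g j. g \<in> set gs \<Longrightarrow> j < length (snd g) \<Longrightarrow> E (snd g ! j) \<Longrightarrow>
        (col' (snd g ! j) \<longleftrightarrow> b' g \<noteq> w g j)" using tree_colouring[OF gs(1), of w] by blast
    have "(if snd g ! j \<in> exs E (set gs) then col' (snd g ! j) else col (snd g ! j))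
        \<longleftrightarrow> (if g \<in> set gs then b' g else b g) \<noteq> w g j"
      if "g \<in> F" "j < length (snd g)" "E (snd g ! j)" for g j
    proof (cases "g \<in> set gs")
      case True
      moreover from this that have "snd g ! j \<in> exs E (set gs)" using nth_mem unfolding exs_def by blast
      ultimately show ?thesis using 2 that by simp
    next
      case False
      moreover have "snd g ! j \<in> exs E {g}" using that by (auto simp: exs_def)
      ultimately have "snd g ! j \<notin> exs E (set gs)" using gs(4)[OF that(1)] by blast
      then show ?thesis using 1 that False by simp
    qed
    then show ?thesis
      by (intro exI[of _ "\<lambda>u. if u \<in> exs E (set gs) then col' u else col u"]
          exI[of _ "\<lambda>g. if g \<in> set gs then b' g else b g"]) blast
  qed
qed

text \<open>A converse by parity: around a cycle the colour changes an even number of times, whereas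
  the colouring assumed for the first edge of the cycle would change exactly once.\<close>

lemma no_cycle_by_colouring:
  assumes "\<And>f i. f \<in> F \<Longrightarrow> i < length (snd f) \<Longrightarrow> E (snd f ! i) \<Longrightarrow>
     \<exists>col :: vertex \<Rightarrow> bool. \<forall>g \<in> F. \<forall>j < length (snd g). E (snd g ! j) \<longrightarrow>
       (col (Elem (snd g ! j)) \<noteq> col (Fact g) \<longleftrightarrow> g = f \<and> j = i)"
  shows "no_cycle E F"
  unfolding no_cycle_def
proof (intro allI impI, rule ccontr)
  fix vs es
  assume cyc: "incidence_cycle \<lparr>elements = {}, facts = F\<rparr> vs es" and "\<nexists>x. \<not> E x \<and> Elem x \<in> set vs"
  then have ex: "\<And>x. Elem x \<in> set vs \<Longrightarrow> E x" by blast
  let ?n = "length es"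
  have c: "es \<noteq> []" "length vs = ?n" "distinct es"
    "\<And>e. e \<in> set es \<Longrightarrow> fst e \<in> F \<and> snd e < length (snd (fst e))"
    "\<And>i. i < ?n \<Longrightarrow> endpoints (es ! i) = {vs ! i, vs ! (Suc i mod ?n)}"
    using cyc unfolding incidence_cycle_def incidence_edges_def by auto
  have E: "E (snd (fst e) ! snd e)" if "e \<in> set es" for e
  proof -
    obtain i where i: "i < ?n" "e = es ! i" using \<open>e \<in> set es\<close> by (auto simp: in_set_conv_nth)
    then have "Suc i mod ?n < ?n" by (intro mod_less_divisor) auto
    then have "endpoints e \<subseteq> set vs" using i c(2) c(5)[OF i(1)] by auto
    then show ?thesis using ex by (auto simp: endpoints_def)
  qed
  define e0 where "e0 = es ! 0"
  have e0: "e0 \<in> set es" using c(1) by (simp add: e0_def)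
  from assms[of "fst e0" "snd e0"] obtain col :: "vertex \<Rightarrow> bool" where
    col: "\<And>g j. g \<in> F \<Longrightarrow> j < length (snd g) \<Longrightarrow> E (snd g ! j) \<Longrightarrow>
       (col (Elem (snd g ! j)) \<noteq> col (Fact g) \<longleftrightarrow> g = fst e0 \<and> j = snd e0)"
    using c(4)[OF e0] E[OF e0] by metis
  have step: "col (vs ! i) \<noteq> col (vs ! (Suc i mod ?n)) \<longleftrightarrow> i = 0" if "i < ?n" for i
  proof -
    let ?e = "es ! i"
    have e: "?e \<in> set es" using that by simp
    have "{vs ! i, vs ! (Suc i mod ?n)} = {Elem (snd (fst ?e) ! snd ?e), Fact (fst ?e)}"
      using c(5)[OF that] by (simp add: endpoints_def)
    then have "col (vs ! i) \<noteq> col (vs ! (Suc i mod ?n)) \<longleftrightarrow>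
        col (Elem (snd (fst ?e) ! snd ?e)) \<noteq> col (Fact (fst ?e))"
      by (auto simp: doubleton_eq_iff)
    also have "\<dots> \<longleftrightarrow> ?e = e0" using col c(4)[OF e] E[OF e] by (simp add: prod_eq_iff)
    also have "\<dots> \<longleftrightarrow> i = 0" using nth_eq_iff_index_eq[OF c(3) that, of 0] c(1) unfolding e0_def by simp
    finally show ?thesis .
  qed
  have n: "?n > 0" using c(1) by simp
  have "col (vs ! (Suc k mod ?n)) = col (vs ! (1 mod ?n))" if "Suc k \<le> ?n" for k
    using that
  proof (induction k)
    case (Suc k)
    then show ?case using step[of "Suc k"] by simp
  qed simp
  from this[of "?n - 1"] n have "col (vs ! 0) = col (vs ! (1 mod ?n))" by simp
  with step[OF n] show False by simp
qed

section \<open>Choices, sections and labellings on trees\<close>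

text \<open>A nonbacktracking choice of incident facts would yield an infinite walk.\<close>

lemma tree_no_choice:
  "tree E gs \<Longrightarrow> (\<And>u. u \<in> exs E (set gs) \<Longrightarrow> l u \<in> set gs \<and> u \<in> set (snd (l u))) \<Longrightarrow>
    (\<And>g. g \<in> set gs \<Longrightarrow> \<exists>u \<in> exs E {g}. l u \<noteq> g) \<Longrightarrow> False"
proof (induction rule: tree.induct)
  case (tree_single g)
  then show ?case by fastforce
next
  case (tree_Cons gs g a)
  \<comment> \<open>Elements of the leaf \<open>g\<close> other than \<open>a\<close> lie in no
    other fact, so the choice there is \<open>g\<close>. Hence the choice must leave
    \<open>g\<close> at \<open>a\<close>, and the choices on the rest stay within the rest.\<close>
  have only: "l u = g" if "u \<in> exs E {g}" "u \<noteq> a" for u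
  proof -
    have "u \<notin> exs E (set gs)" using that tree_Cons.hyps(4) by blast
    moreover have "u \<in> exs E (set (g # gs))" using that by (auto simp: exs_def)
    ultimately show ?thesis using tree_Cons.prems(1)[of u] that(1) by (auto simp: exs_def)
  qed
  obtain u where "u \<in> exs E {g}" "l u \<noteq> g" using tree_Cons.prems(2)[of g] by auto
  then have la: "l a \<noteq> g" using only by blast
  have "l u \<in> set gs \<and> u \<in> set (snd (l u))" if "u \<in> exs E (set gs)" for u
  proof -
    have *: "l u \<in> set (g # gs) \<and> u \<in> set (snd (l u))"
      using that tree_Cons.prems(1)[of u] by (auto simp: exs_def)
    have "l u \<noteq> g"
    proof
      assume "l u = g"
      then have "u \<in> exs E {g}" using * that by (auto simp: exs_def)
      then have "u = a" using that tree_Cons.hyps(4) by blast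
      then show False using la \<open>l u = g\<close> by simp
    qed
    then show ?thesis using * by auto
  qed
  moreover have "\<exists>u \<in> exs E {h}. l u \<noteq> h" if "h \<in> set gs" for h using tree_Cons.prems(2) that by auto
  ultimately show ?case using tree_Cons.IH by blast
qed

lemma tree_connected:
  assumes "tree E gs" and cl: "\<And>g h. g \<in> set gs \<Longrightarrow> h \<in> C \<Longrightarrow> exs E {g} \<inter> exs E {h} \<noteq> {} \<Longrightarrow> g \<in> C"
  shows "set gs \<inter> C \<noteq> {} \<Longrightarrow> set gs \<subseteq> C"
  using assms
proof (induction rule: tree.induct)
  case (tree_single g)
  then show ?case by auto
next
  case (tree_Cons gs g a)
  have "a \<in> exs E (set gs)" using tree_Cons.hyps(4) by blast
  then obtain h where h: "h \<in> set gs" "a \<in> exs E {h}" by (auto simp: exs_def)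
  have a: "a \<in> exs E {g} \<inter> exs E {h}" using tree_Cons.hyps(4) h by blast
  have IH: "set gs \<inter> C \<noteq> {} \<Longrightarrow> set gs \<subseteq> C" using tree_Cons.IH tree_Cons.prems(2) by auto
  show ?case
  proof (cases "set gs \<inter> C = {}")
    case True
    then have "g \<in> C" using tree_Cons.prems(1) by auto
    then have "h \<in> C" using tree_Cons.prems(2)[of h g] h a by auto
    then show ?thesis using True h by blast
  next
    case False
    then have "set gs \<subseteq> C" using IH by blast
    moreover from this have "g \<in> C" using tree_Cons.prems(2)[of g h] h a by auto
    ultimately show ?thesis by simp
  qed
qed

text \<open>Here \<open>h\<close> maps the facts \<open>B\<close> of the unknown query to a hypothesis that has \<open>gs\<close> as a
  component, and \<open>C\<close> is the set of constants of the query. Either \<open>h\<close> has a section over \<open>gs\<close>,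
  or there is a labelling which lifts \<open>h\<close> to the frontier.\<close>

lemma tree_section_or_labelling:
  fixes h :: "nat \<Rightarrow> nat" and E :: "nat \<Rightarrow> bool" and C :: "nat set"
  defines "tc \<equiv> \<lambda>t. \<forall>y \<in> set (snd t). \<not> E (h y) \<longrightarrow> y \<in> C"
  assumes "tree E gs"
  shows "(\<exists>k. \<forall>g \<in> set gs. \<exists>t \<in> B. instantiate h t = g \<and> tc t \<and>
            (\<forall>j < length (snd g). E (snd g ! j) \<longrightarrow> snd t ! j = k (snd g ! j))) \<or>
         (\<exists>lam. (\<forall>x. h x \<in> exs E (set gs) \<longrightarrow> lam x \<in> set gs \<and> h x \<in> set (snd (lam x))) \<and>
            (\<forall>t \<in> B. tc t \<and> instantiate h t \<in> set gs \<longrightarrow>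
               (\<exists>x \<in> set (snd t). E (h x) \<and> lam x \<noteq> instantiate h t)))"
  using assms(2)
proof (induction arbitrary: B rule: tree.induct)
  case (tree_single g B)
  show ?case
  proof (cases "\<exists>t \<in> B. instantiate h t = g \<and> tc t")
    case True
    then obtain t where t: "t \<in> B" "instantiate h t = g" "tc t" by blast
    define pos where "pos u = (THE j. j < length (snd g) \<and> snd g ! j = u)" for u
    have "pos (snd g ! j) = j" if "j < length (snd g)" "E (snd g ! j)" for j
      using tree_single that unfolding pos_def no_repeat_def by (intro the_equality) auto
    then show ?thesis using t by (intro disjI1 exI[of _ "\<lambda>u. snd t ! pos u"]) auto
  next
    case False
    then show ?thesis by (intro disjI2 exI[of _ "\<lambda>_. g"]) (auto simp: exs_def)
  qed
next
  case (tree_Cons gs g a B)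
  have a: "a \<in> exs E {g}" "a \<in> exs E (set gs)" using tree_Cons.hyps(4) by auto
  then have Ea: "E a" "a \<in> set (snd g)" by (auto simp: exs_def)
  \<comment> \<open>A variable over the joint \<open>a\<close> is bad if no admissible fact over
    \<open>g\<close> contains it, so that a section through it could not be continued to
    \<open>g\<close>. The induction hypothesis is applied to the facts without bad
    variables.\<close>
  define bad where "bad x \<longleftrightarrow> h x = a \<and> \<not> (\<exists>t \<in> B. instantiate h t = g \<and> tc t \<and> x \<in> set (snd t))" for x
  define B' where "B' = {t \<in> B. \<forall>x \<in> set (snd t). \<not> bad x}"
  define pos where "pos u = (THE j. j < length (snd g) \<and> snd g ! j = u)" for u
  have pos: "pos (snd g ! j) = j" if "j < length (snd g)" "E (snd g ! j)" for j
    using tree_Cons.hyps(2) that unfolding pos_def no_repeat_def by (intro the_equality) auto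
  from tree_Cons.IH[of B'] show ?case
  proof (elim disjE exE)
    fix k assume k: "\<forall>g \<in> set gs. \<exists>t \<in> B'. instantiate h t = g \<and> tc t \<and>
        (\<forall>j < length (snd g). E (snd g ! j) \<longrightarrow> snd t ! j = k (snd g ! j))"
    obtain g' where g': "g' \<in> set gs" "a \<in> set (snd g')" using a(2) by (auto simp: exs_def)
    then obtain j' where j': "j' < length (snd g')" "snd g' ! j' = a" by (auto simp: in_set_conv_nth)
    obtain t' where t': "t' \<in> B'" "instantiate h t' = g'" "snd t' ! j' = k a"
      using k g' j' Ea by metis
    have len: "length (snd t') = length (snd g')" using t'(2) by (auto simp: instantiate_def)
    then have "k a \<in> set (snd t')" using t'(3) j'(1) nth_mem by metis
    moreover have hka: "h (k a) = a"
    proof -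
      have "snd (instantiate h t') ! j' = h (snd t' ! j')" using j'(1) len by (simp add: instantiate_def)
      then show ?thesis unfolding t'(2,3) j'(2) by (rule sym)
    qed
    ultimately obtain t where t: "t \<in> B" "instantiate h t = g" "tc t" "k a \<in> set (snd t)"
      using t'(1) by (auto simp: B'_def bad_def)
    have lent: "length (snd t) = length (snd g)" "\<And>j. j < length (snd g) \<Longrightarrow> h (snd t ! j) = snd g ! j"
      using t(2) by (auto simp: instantiate_def)
    obtain i where i: "i < length (snd g)" "snd t ! i = k a"
      using t(4) lent(1) by (auto simp: in_set_conv_nth)
    have ai: "snd g ! i = a" using lent(2)[OF i(1)] i(2) hka by simp
    \<comment> \<open>\<open>k a\<close> is not bad, so the fact \<open>t\<close> over
      \<open>g\<close> contains it and provides the values of the section on the rest of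
      \<open>g\<close>.\<close>
    define k' where "k' u = (if u \<in> exs E (set gs) then k u else snd t ! pos u)" for u
    have "\<exists>t \<in> B. instantiate h t = g' \<and> tc t \<and>
        (\<forall>j < length (snd g'). E (snd g' ! j) \<longrightarrow> snd t ! j = k' (snd g' ! j))"
      if "g' \<in> set (g # gs)" for g'
    proof (cases "g' = g")
      case True
      have "snd t ! j = k' (snd g ! j)" if j: "j < length (snd g)" "E (snd g ! j)" for j
      proof (cases "snd g ! j \<in> exs E (set gs)")
        case in_gs: True
        moreover have "snd g ! j \<in> exs E {g}" using j by (auto simp: exs_def)
        ultimately have "snd g ! j = a" using tree_Cons.hyps(4) by blast
        moreover from this have "i = j" using ai i(1) j tree_Cons.hyps(2) Ea unfolding no_repeat_def by metis
        ultimately show ?thesis using i in_gs by (simp add: k'_def)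
      next
        case False
        then show ?thesis using pos[OF j] by (simp add: k'_def)
      qed
      then show ?thesis using t True by blast
    next
      case False
      then have g'_gs: "g' \<in> set gs" using that by simp
      then obtain t where "t \<in> B'" "instantiate h t = g'" "tc t"
        "\<forall>j < length (snd g'). E (snd g' ! j) \<longrightarrow> snd t ! j = k (snd g' ! j)" using k by blast
      moreover have "snd g' ! j \<in> exs E (set gs)" if "j < length (snd g')" "E (snd g' ! j)" for j
        using that g'_gs nth_mem unfolding exs_def by blast
      ultimately show ?thesis by (intro bexI[of _ t]) (auto simp: B'_def k'_def)
    qed
    then show ?thesis by blast
  next
    fix lam assume lam: "(\<forall>x. h x \<in> exs E (set gs) \<longrightarrow> lam x \<in> set gs \<and> h x \<in> set (snd (lam x))) \<and>
      (\<forall>t \<in> B'. tc t \<and> instantiate h t \<in> set gs \<longrightarrow>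
         (\<exists>x \<in> set (snd t). E (h x) \<and> lam x \<noteq> instantiate h t))"
    \<comment> \<open>At bad variables the part along \<open>g\<close> is what is missing. This
      label also serves the discarded facts over \<open>gs\<close>, each of which contains a bad
      variable.\<close>
    define lam' where "lam' x = (if bad x \<or> (h x \<in> exs E {g} \<and> h x \<noteq> a) then g else lam x)" for x
    have "lam' x \<in> set (g # gs) \<and> h x \<in> set (snd (lam' x))" if "h x \<in> exs E (set (g # gs))" for x
    proof -
      have "h x \<in> exs E {g} \<or> h x \<in> exs E (set gs)" using that by (auto simp: exs_def)
      then show ?thesis
        using a Ea lam unfolding lam'_def bad_def by (auto simp: exs_def)
    qed
    moreover have "\<exists>x \<in> set (snd t). E (h x) \<and> lam' x \<noteq> instantiate h t"
      if t: "t \<in> B" "tc t" "instantiate h t \<in> set (g # gs)" for t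
    proof (cases "instantiate h t = g")
      case True
      then obtain x where x: "x \<in> set (snd t)" "h x = a"
        using Ea by (auto simp: instantiate_def)
      then have "\<not> bad x" using t True by (auto simp: bad_def)
      then have "lam' x = lam x" using x by (simp add: lam'_def)
      moreover have "lam x \<in> set gs" using lam x a by simp
      ultimately show ?thesis using x True tree_Cons.hyps(3) Ea by (intro bexI[of _ x]) auto
    next
      case False
      then have gs: "instantiate h t \<in> set gs" using t by simp
      show ?thesis
      proof (cases "\<exists>x \<in> set (snd t). bad x")
        case True
        then obtain x where "x \<in> set (snd t)" "bad x" by blast
        then show ?thesis using False Ea by (intro bexI[of _ x]) (auto simp: lam'_def bad_def)
      next
        case no_bad: False
        then have "t \<in> B'" using t by (auto simp: B'_def)
        with lam t gs obtain x where x: "x \<in> set (snd t)" "E (h x)" "lam x \<noteq> instantiate h t" by blast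
        have "h x \<in> set (snd (instantiate h t))" using x(1) by (simp add: instantiate_def)
        then have "h x \<in> exs E (set gs)" using gs x(2) by (auto simp: exs_def)
        then have "lam' x = lam x" using no_bad x(1) tree_Cons.hyps(4) unfolding lam'_def by auto
        then show ?thesis using x by auto
      qed
    qed
    ultimately show ?thesis by blast
  qed
qed

section \<open>The computed component\<close>

lemma foldr_const: "foldr (\<lambda>_ c. f c) xs c = (f ^^ length xs) c"
  by (induction xs) auto

lemma set_grow: "set (grow K J C) = {g \<in> set J. g \<in> set C \<or>
    (\<exists>h \<in> set C. exs (\<lambda>u. \<not> u < K) {g} \<inter> exs (\<lambda>u. \<not> u < K) {h} \<noteq> {})}"
  unfolding grow_def exs_def by auto

text \<open>As long as the set is not closed, each round adds a fact of \<open>J\<close>; hence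
  \<open>length J\<close> rounds suffice.\<close>

lemma component_closed:
  assumes "g0 \<in> set J"
  shows "set (grow K J (component K J g0)) = set (component K J g0)"
    and "set (component K J g0) \<subseteq> set J"
proof -
  define S where "S i = (grow K J ^^ i) [g0]" for i
  have S_Suc: "S (Suc i) = grow K J (S i)" for i by (simp add: S_def)
  have sub: "set (S i) \<subseteq> set J" for i
    using assms by (cases i) (auto simp: S_def set_grow)
  have inc: "set (S i) \<subseteq> set (S (Suc i))" for i
    using sub[of i] by (auto simp: S_Suc set_grow)
  have cong: "set (grow K J C) = set (grow K J C')" if "set C = set C'" for C C'
    using that by (simp add: set_grow)
  have "Suc i \<le> card (set (S i)) \<or> set (S (Suc i)) = set (S i)" for i
  proof (induction i)
    case 0 then show ?case by (simp add: S_def)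
  next
    case (Suc i)
    show ?case
    proof (cases "set (S (Suc i)) = set (S i)")
      case True
      from cong[OF this] show ?thesis by (simp add: S_Suc)
    next
      case False
      then have "card (set (S i)) < card (set (S (Suc i)))" using inc[of i] by (intro psubset_card_mono) auto
      then show ?thesis using Suc False by linarith
    qed
  qed
  moreover have "card (set (S (length J))) \<le> length J"
    using card_mono[OF _ sub, of "length J"] card_length[of J] by simp
  ultimately have "set (S (Suc (length J))) = set (S (length J))" by (metis not_less_eq_eq)
  moreover have "component K J g0 = S (length J)" by (simp add: component_def S_def foldr_const)
  ultimately show "set (grow K J (component K J g0)) = set (component K J g0)"
    "set (component K J g0) \<subseteq> set J" using sub by (simp_all add: S_Suc)
qed

text \<open>Identifies what the algorithm computes with the component found abstractly in
  \<open>no_cycle_component\<close>, for which tree induction is available.\<close>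

lemma component_eq_tree:
  fixes K :: nat
  defines "E \<equiv> \<lambda>u. \<not> u < K"
  assumes t: "tree E gs" "g0 \<in> set gs" "set gs \<subseteq> set J"
    and cl: "\<And>g. g \<in> set J \<Longrightarrow> exs E {g} \<inter> exs E (set gs) \<noteq> {} \<Longrightarrow> g \<in> set gs"
  shows "set (component K J g0) = set gs"
proof
  have g0: "g0 \<in> set J" using t by blast
  show "set gs \<subseteq> set (component K J g0)"
  proof (rule tree_connected[OF t(1)])
    have "g0 \<in> set ((grow K J ^^ i) [g0])" for i
      using g0 by (induction i) (auto simp: set_grow)
    then show "set gs \<inter> set (component K J g0) \<noteq> {}"
      using t(2) by (auto simp: component_def foldr_const)
    show "g \<in> set (component K J g0)"
      if "g \<in> set gs" "h \<in> set (component K J g0)" "exs E {g} \<inter> exs E {h} \<noteq> {}" for g h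
      using component_closed(1)[OF g0, of K] that t(3) unfolding set_grow E_def by blast
  qed
  have "set ((grow K J ^^ i) [g0]) \<subseteq> set gs" for i
  proof (induction i)
    case 0 then show ?case using t by simp
  next
    case (Suc i)
    have "exs E {h} \<subseteq> exs E (set gs)" if "h \<in> set gs" for h using that by (intro exs_mono) auto
    then show ?case using Suc cl by (fastforce simp: set_grow E_def)
  qed
  then show "set (component K J g0) \<subseteq> set gs" by (simp add: component_def foldr_const)
qed

section \<open>Facts of refinements and the names of their elements\<close>

lemma plist_iff:
  "length xss \<le> n \<Longrightarrow> ys \<in> set (plist n xss) \<longleftrightarrow> list_all2 (\<lambda>y xs. y \<in> set xs) ys xss"
proof (induction n arbitrary: xss ys)
  case 0 then show ?case by auto
next
  case (Suc n)
  then show ?case by (cases xss) (auto simp: head_def list_all2_Cons2)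
qed

lemma lifts_iff:
  assumes "length (snd g) \<le> r"
  shows "zs \<in> set (lifts r lab g) \<longleftrightarrow>
    map fst zs = snd g \<and> (\<forall>z \<in> set zs. snd z \<in> set (lab (fst z)))"
proof -
  have "list_all2 (\<lambda>y xs. y \<in> set xs) zs (map (\<lambda>u. map (\<lambda>l. (u, l)) (lab u)) us) \<longleftrightarrow>
    map fst zs = us \<and> (\<forall>z \<in> set zs. snd z \<in> set (lab (fst z)))" for us
    by (induction zs arbitrary: us; case_tac us) auto
  then show ?thesis using assms by (simp add: lifts_def plist_iff)
qed

lemma refinement_iff:
  assumes "\<And>g. g \<in> set J \<Longrightarrow> length (snd g) \<le> r"
  shows "c \<in> set (refinement r lab ok J) \<longleftrightarrow>
    (fst c, map fst (snd c)) \<in> set J \<and> (\<forall>z \<in> set (snd c). snd z \<in> set (lab (fst z))) \<and>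
    ok (fst c, map fst (snd c)) (snd c)"
proof -
  have "c \<in> set (refinement r lab ok J) \<longleftrightarrow>
     (\<exists>g \<in> set J. fst c = fst g \<and> snd c \<in> set (lifts r lab g) \<and> ok g (snd c))"
    by (cases c) (auto simp: refinement_def)
  also have "\<dots> \<longleftrightarrow> (\<exists>g \<in> set J. g = (fst c, map fst (snd c)) \<and>
     (\<forall>z \<in> set (snd c). snd z \<in> set (lab (fst z))) \<and> ok g (snd c))"
    using assms by (intro bex_cong) (auto simp: lifts_iff prod_eq_iff)
  finally show ?thesis by auto
qed

lemma name_elem_less: "name_elem K E z < K \<longleftrightarrow> fst z < K \<and> snd z = []"
  by (auto simp: name_elem_def)

lemma name_elem_inj: "inj_on (name_elem K E) (set E)"
proof (rule inj_onI)
  fix y z assume *: "y \<in> set E" "z \<in> set E" "name_elem K E y = name_elem K E z"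
  have idx: "E ! length (takeWhile (\<lambda>x. x \<noteq> z) E) = z" if "z \<in> set E" for z
    using that by (induction E) auto
  show "y = z"
  proof (cases "fst y < K \<and> snd y = []")
    case True
    then have "fst z < K \<and> snd z = []" using name_elem_less * by metis
    then show ?thesis using True *(3) by (simp add: name_elem_def prod_eq_iff)
  next
    case False
    then have "\<not> (fst z < K \<and> snd z = [])" using name_elem_less * by metis
    then have "length (takeWhile (\<lambda>x. x \<noteq> y) E) = length (takeWhile (\<lambda>x. x \<noteq> z) E)"
      using False *(3) by (auto simp: name_elem_def split: if_splits)
    then show ?thesis using idx * by metis
  qed
qed

text \<open>Undoes the naming and forgets the label. Outside the names it is the identity, so that
  constants are fixed whether or not they occur in the refinement.\<close>

definition base_elem :: "nat \<Rightarrow> (nat \<times> label) list \<Rightarrow> nat \<Rightarrow> nat" where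
  "base_elem K E v = (if v \<in> name_elem K E ` set E then fst (inv_into (set E) (name_elem K E) v) else v)"

lemma base_elem_name: "z \<in> set E \<Longrightarrow> base_elem K E (name_elem K E z) = fst z"
  by (simp add: base_elem_def inv_into_f_f[OF name_elem_inj])

lemma base_elem_const:
  assumes "a < K" shows "base_elem K E a = a"
proof (cases "a \<in> name_elem K E ` set E")
  case True
  then obtain z where z: "z \<in> set E" "a = name_elem K E z" by blast
  then have "fst z < K \<and> snd z = []" using assms name_elem_less by metis
  moreover from this have "name_elem K E z = fst z" by (simp add: name_elem_def)
  ultimately show ?thesis using z base_elem_name[OF z(1), of K] by simp
qed (simp add: base_elem_def)

lemma length_bulk: "length (bulk K J) = card (set J) + card (exs (\<lambda>u. \<not> u < K) (set J))"
proof -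
  have "set (filter (\<lambda>u. \<not> u < K) (concat (map (\<lambda>f. snd f) J))) = exs (\<lambda>u. \<not> u < K) (set J)"
    by (auto simp: exs_def)
  then show ?thesis unfolding bulk_def by (simp add: length_remdups_card_conv)
qed

lemma set_name_facts: "set (name_facts K L) =
    (\<lambda>c. (fst c, map (name_elem K (concat (map snd L))) (snd c))) ` set L"
  by (auto simp: name_facts_def Let_def)

section \<open>Correctness of the refinement steps\<close>

text \<open>The query to be learned for a fact \<open>\<alpha>\<close> is the union of the components \<open>(A, C, \<gamma>)\<close>: the
  variables \<open>C\<close> of \<open>A\<close> stand for the constants given by \<open>\<gamma>\<close>, the other ones are existential.\<close>

type_synonym qcomponent = "fact set \<times> nat set \<times> (nat \<Rightarrow> nat)"

text \<open>With the identity for \<open>s\<close> this is a match into a hypothesis over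
  \<open>\<alpha>\<close> itself. A general \<open>s\<close> describes matches for a source fact of
  which \<open>\<alpha>\<close> is only the pattern: \<open>s\<close> replaces the constants by the
  arguments of that fact.\<close>

definition maps_into :: "(nat \<Rightarrow> nat) \<Rightarrow> qcomponent \<Rightarrow> fact set \<Rightarrow> bool" where
  "maps_into s c G \<longleftrightarrow> (\<exists>h. (\<forall>x \<in> fst (snd c). h x = s (snd (snd c) x)) \<and> instantiate h ` fst c \<subseteq> G)"

lemma instantiate_simps [simp]: "fst (instantiate h f) = fst f" "snd (instantiate h f) = map h (snd f)"
  by (simp_all add: instantiate_def)

text \<open>The learning problem for a single source fact, detached from mappings. All that is known
  of the oracle is its answers to well-typed hypotheses.\<close>

locale target =
  fixes K r :: nat and T :: schema and \<alpha> :: fact and Cs :: "qcomponent set" and Q :: query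
  assumes arity: "\<And>s n. T s = Some n \<Longrightarrow> n \<le> r"
    and constants: "\<And>a. a \<in> set (snd \<alpha>) \<Longrightarrow> a < K"
    and finite_component: "\<And>c. c \<in> Cs \<Longrightarrow> finite (fst c)"
    and component_acyclic: "\<And>c. c \<in> Cs \<Longrightarrow> no_cycle (\<lambda>u. u \<notin> fst (snd c)) (fst c)"
    and component_const: "\<And>c x. c \<in> Cs \<Longrightarrow> x \<in> fst (snd c) \<Longrightarrow> snd (snd c) x \<in> set (snd \<alpha>)"
    and component_typed: "\<And>c f. c \<in> Cs \<Longrightarrow> f \<in> fst c \<Longrightarrow> T (fst f) = Some (length (snd f))"
    and answer: "\<And>J. (\<And>f. f \<in> set J \<Longrightarrow> T (fst f) = Some (length (snd f))) \<Longrightarrow>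
      (query_pos Q \<alpha> J \<longleftrightarrow> (\<forall>c \<in> Cs. maps_into (\<lambda>a. a) c (set J)))"
begin

abbreviation E :: "nat \<Rightarrow> bool" where "E \<equiv> \<lambda>u. \<not> u < K"

section \<open>Hypotheses and their minimization\<close>

text \<open>One \<open>K\<close> serves all patterns. Numbers below it that do not occur in
  \<open>\<alpha>\<close> are excluded, since in the resulting constraint they would be existential
  variables instead of constants.\<close>

definition wf :: "fact set \<Rightarrow> bool" where
  "wf J \<longleftrightarrow> (\<forall>f \<in> J. T (fst f) = Some (length (snd f)) \<and> (\<forall>u \<in> set (snd f). u < K \<longrightarrow> u \<in> set (snd \<alpha>)))"

definition pos :: "fact set \<Rightarrow> bool" where
  "pos J \<longleftrightarrow> (\<forall>c \<in> Cs. maps_into (\<lambda>a. a) c J)"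

definition minimal :: "fact set \<Rightarrow> bool" where
  "minimal J \<longleftrightarrow> pos J \<and> (\<forall>J' \<subseteq> J. pos J' \<longrightarrow> J' = J)"

lemma wf_subset: "wf J \<Longrightarrow> J' \<subseteq> J \<Longrightarrow> wf J'"
  by (auto simp: wf_def)

lemma wf_arity: "wf J \<Longrightarrow> f \<in> J \<Longrightarrow> length (snd f) \<le> r"
  using arity by (auto simp: wf_def)

lemma query_pos_iff: "wf (set J) \<Longrightarrow> query_pos Q \<alpha> J \<longleftrightarrow> pos (set J)"
  using answer[of J] by (simp add: wf_def pos_def)

lemma pos_mono: "pos J \<Longrightarrow> J \<subseteq> J' \<Longrightarrow> pos J'"
  unfolding pos_def maps_into_def by (meson order_trans)

lemma pos_hom:
  assumes "pos J" "\<And>a. a < K \<Longrightarrow> \<phi> a = a" "instantiate \<phi> ` J \<subseteq> J'"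
  shows "pos J'"
  unfolding pos_def
proof
  fix c assume c: "c \<in> Cs"
  with assms(1) obtain h where h: "\<forall>x \<in> fst (snd c). h x = snd (snd c) x" "instantiate h ` fst c \<subseteq> J"
    unfolding pos_def maps_into_def by blast
  have "instantiate (\<phi> \<circ> h) f = instantiate \<phi> (instantiate h f)" for f by (simp add: instantiate_def)
  then have "instantiate (\<phi> \<circ> h) ` fst c = instantiate \<phi> ` instantiate h ` fst c"
    by (simp add: image_image)
  also have "\<dots> \<subseteq> J'" using image_mono[OF h(2), of "instantiate \<phi>"] assms(3) by (rule order_trans)
  finally have "instantiate (\<phi> \<circ> h) ` fst c \<subseteq> J'" .
  moreover have "\<forall>x \<in> fst (snd c). (\<phi> \<circ> h) x = snd (snd c) x"
    using h(1) assms(2) component_const[OF c] constants by simp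
  ultimately show "maps_into (\<lambda>a. a) c J'" unfolding maps_into_def by blast
qed

text \<open>One pass suffices: positivity is monotone, so a fact that could not be deleted cannot be
  deleted after further deletions either.\<close>

lemma minimize_fold:
  assumes "wf (set ys)" "pos (set ys)" "distinct ys"
  shows "let zs = foldr (\<lambda>f acc. if query_pos Q \<alpha> (filter (\<lambda>g. g \<noteq> f) acc)
       then filter (\<lambda>g. g \<noteq> f) acc else acc) xs ys
    in set zs \<subseteq> set ys \<and> pos (set zs) \<and> distinct zs \<and> (\<forall>f \<in> set xs. f \<in> set zs \<longrightarrow> \<not> pos (set zs - {f}))"
proof (induction xs)
  case Nil
  then show ?case using assms by simp
next
  case (Cons x xs)
  define zs where "zs = foldr (\<lambda>f acc. if query_pos Q \<alpha> (filter (\<lambda>g. g \<noteq> f) acc)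
       then filter (\<lambda>g. g \<noteq> f) acc else acc) xs ys"
  have IH: "set zs \<subseteq> set ys" "pos (set zs)" "distinct zs"
    "\<And>f. f \<in> set xs \<Longrightarrow> f \<in> set zs \<Longrightarrow> \<not> pos (set zs - {f})"
    using Cons unfolding zs_def Let_def by blast+
  let ?zs = "filter (\<lambda>g. g \<noteq> x) zs"
  have set: "set ?zs = set zs - {x}" by auto
  have q: "query_pos Q \<alpha> ?zs \<longleftrightarrow> pos (set zs - {x})"
    using query_pos_iff[of ?zs] wf_subset[OF assms(1), of "set ?zs"] IH(1) set by auto
  have "\<not> pos (set zs - {x} - {f})" if "f \<in> set xs" "f \<in> set zs" for f
    using IH(4)[OF that] pos_mono[of "set zs - {x} - {f}" "set zs - {f}"] by blast
  then show ?case using IH q by (auto simp: zs_def[symmetric] Let_def set simp del: set_filter)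
qed

lemma minimize:
  assumes "wf (set J)" "pos (set J)"
  shows "set (minimize Q \<alpha> J) \<subseteq> set J" "distinct (minimize Q \<alpha> J)" "minimal (set (minimize Q \<alpha> J))"
proof -
  have *: "set (minimize Q \<alpha> J) \<subseteq> set J \<and> pos (set (minimize Q \<alpha> J)) \<and> distinct (minimize Q \<alpha> J) \<and>
     (\<forall>f \<in> set J. f \<in> set (minimize Q \<alpha> J) \<longrightarrow> \<not> pos (set (minimize Q \<alpha> J) - {f}))"
    using minimize_fold[of "remdups J" "remdups J"] assms by (simp add: minimize_def Let_def)
  have "J' = set (minimize Q \<alpha> J)" if J': "J' \<subseteq> set (minimize Q \<alpha> J)" "pos J'" for J'
  proof (rule ccontr)
    assume "J' \<noteq> set (minimize Q \<alpha> J)"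
    then obtain f where "f \<in> set (minimize Q \<alpha> J)" "J' \<subseteq> set (minimize Q \<alpha> J) - {f}" using J' by blast
    then show False using * pos_mono[OF J'(2)] by blast
  qed
  then show "set (minimize Q \<alpha> J) \<subseteq> set J" "distinct (minimize Q \<alpha> J)" "minimal (set (minimize Q \<alpha> J))"
    using * by (auto simp: minimal_def)
qed

lemma finite_exs: "finite F \<Longrightarrow> finite (exs P F)"
  by (rule finite_subset[of _ "\<Union>g \<in> F. set (snd g)"]) (auto simp: exs_def)

lemma wf_name_facts:
  assumes "wf (set J)" "\<And>c. c \<in> set L \<Longrightarrow> (fst c, map fst (snd c)) \<in> set J"
  shows "wf (set (name_facts K L))"
  unfolding wf_def
proof
  fix f assume "f \<in> set (name_facts K L)"
  then obtain c where c: "c \<in> set L" "f = (fst c, map (name_elem K (concat (map snd L))) (snd c))"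
    by (auto simp: set_name_facts)
  have J: "T (fst c) = Some (length (snd c))" "\<And>z. z \<in> set (snd c) \<Longrightarrow> fst z < K \<Longrightarrow> fst z \<in> set (snd \<alpha>)"
    using assms(1) assms(2)[OF c(1)] unfolding wf_def by fastforce+
  have "name_elem K M z \<in> set (snd \<alpha>)" if "z \<in> set (snd c)" "name_elem K M z < K" for z M
    using that J(2)[of z] by (auto simp: name_elem_def split: if_splits)
  then show "T (fst f) = Some (length (snd f)) \<and> (\<forall>u \<in> set (snd f). u < K \<longrightarrow> u \<in> set (snd \<alpha>))"
    using J(1) c(2) by auto
qed

section \<open>Sections, lifts and double covers\<close>

text \<open>A positive part of a refinement that is no larger than \<open>J\<close> is isomorphic to \<open>J\<close>.\<close>

lemma section_of_refinement:
  assumes J: "wf (set J)" "minimal (set J)"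
    and L: "\<And>c. c \<in> set L \<Longrightarrow> (fst c, map fst (snd c)) \<in> set J"
    and J': "set J' \<subseteq> set (name_facts K L)" "pos (set J')"
    and le: "\<not> length (bulk K J) < length (bulk K J')"
  obtains l where "\<And>u. u < K \<Longrightarrow> l u = []"
    "\<And>g. g \<in> set J \<Longrightarrow> (fst g, map (\<lambda>u. (u, l u)) (snd g)) \<in> set L"
proof -
  define M where "M = concat (map snd L)"
  define nm where "nm = name_elem K M"
  define \<pi> where "\<pi> = base_elem K M"
  have M: "z \<in> set M" if "c \<in> set L" "z \<in> set (snd c)" for c z using that by (auto simp: M_def)
  have \<pi>_nm: "\<pi> (nm z) = fst z" if "z \<in> set M" for z
    using base_elem_name[OF that] by (simp add: \<pi>_def nm_def)
  have \<pi>_const: "\<pi> a = a" if "a < K" for a using base_elem_const[OF that] by (simp add: \<pi>_def)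
  have J'L: "\<exists>c \<in> set L. f = (fst c, map nm (snd c))" if "f \<in> set J'" for f
    using J'(1) that by (auto simp: set_name_facts nm_def M_def)
  have proj: "instantiate \<pi> (fst c, map nm (snd c)) = (fst c, map fst (snd c))" if "c \<in> set L" for c
    using \<pi>_nm M[OF that] by (simp add: instantiate_def)
  have "instantiate \<pi> ` set J' \<subseteq> set J" using J'L proj L by fastforce
  moreover have "pos (instantiate \<pi> ` set J')" using pos_hom[OF J'(2) \<pi>_const] by blast
  \<comment> \<open>The image is a positive part of \<open>J\<close>, hence all of it.\<close>
  ultimately have im: "instantiate \<pi> ` set J' = set J" using J(2) unfolding minimal_def by blast
  have sub: "exs E (set J) \<subseteq> \<pi> ` exs E (set J')"
  proof
    fix u assume u: "u \<in> exs E (set J)"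
    then obtain g where g: "g \<in> set J" "u \<in> set (snd g)" by (auto simp: exs_def)
    then have "g \<in> instantiate \<pi> ` set J'" using im by simp
    then obtain f where f: "f \<in> set J'" "u \<in> set (snd (instantiate \<pi> f))" using g(2) by auto
    then obtain v where v: "v \<in> set (snd f)" "u = \<pi> v" by auto
    have "\<not> v < K" using \<pi>_const u v(2) by (auto simp: exs_def)
    then show "u \<in> \<pi> ` exs E (set J')" using v f by (auto simp: exs_def)
  qed
  have fin: "finite (exs E (set J'))" "finite (exs E (set J))" by (simp_all add: finite_exs)
  have card: "card (set J) \<le> card (set J')" using card_image_le[of "set J'" "instantiate \<pi>"] im by simp
  have card_ex: "card (exs E (set J)) \<le> card (\<pi> ` exs E (set J'))"
    "card (\<pi> ` exs E (set J')) \<le> card (exs E (set J'))"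
    using card_mono[OF _ sub] card_image_le[of "exs E (set J')" \<pi>] fin by auto
  have le': "card (set J') + card (exs E (set J')) \<le> card (set J) + card (exs E (set J))"
    using le by (simp add: length_bulk)
  \<comment> \<open>\<open>J'\<close> has at least as many facts and at least as many existential
    elements as \<open>J\<close>, but the sum is not larger. So both numbers agree, and the
    projection is a bijection of the existential elements.\<close>
  have inj: "inj_on \<pi> (exs E (set J'))"
    using card card_ex le' fin by (intro eq_card_imp_inj_on) linarith+
  have ex_eq: "\<pi> ` exs E (set J') = exs E (set J)"
    using card card_ex le' fin sub by (intro card_subset_eq[symmetric]) auto
  \<comment> \<open>For an existential element \<open>u\<close> of \<open>J\<close> this is the only
    pair over \<open>u\<close> that survives in \<open>J'\<close>.\<close>
  define up where "up u = (SOME z. z \<in> set M \<and> nm z \<in> exs E (set J') \<and> fst z = u)" for u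
  define l where "l u = (if u < K then [] else snd (up u))" for u
  have l: "snd z = l (fst z)" if z: "z \<in> set M" "\<exists>f \<in> set J'. nm z \<in> set (snd f)" for z
  proof (cases "nm z < K")
    case True
    then show ?thesis by (simp add: nm_def name_elem_less l_def)
  next
    case False
    then have nz: "nm z \<in> exs E (set J')" using z by (auto simp: exs_def)
    then have "\<pi> (nm z) \<in> exs E (set J)" using ex_eq by blast
    then have "\<not> fst z < K" using \<pi>_nm[OF z(1)] by (simp add: exs_def)
    have "up (fst z) \<in> set M \<and> nm (up (fst z)) \<in> exs E (set J') \<and> fst (up (fst z)) = fst z"
      unfolding up_def by (rule someI[of _ z]) (use z nz in auto)
    then have up: "up (fst z) \<in> set M" "nm (up (fst z)) \<in> exs E (set J')" "fst (up (fst z)) = fst z" by auto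
    have "nm (up (fst z)) = nm z"
      using inj_onD[OF inj _ up(2) nz] \<pi>_nm[OF z(1)] \<pi>_nm[OF up(1)] up(3) by simp
    then have "up (fst z) = z"
      using inj_onD[OF name_elem_inj _ up(1) z(1)] by (simp add: nm_def)
    then show ?thesis using \<open>\<not> fst z < K\<close> by (simp add: l_def)
  qed
  show ?thesis
  proof (rule that[of l])
    fix g assume "g \<in> set J"
    then obtain f where f: "f \<in> set J'" "g = instantiate \<pi> f" using im by blast
    then obtain c where c: "c \<in> set L" "f = (fst c, map nm (snd c))" using J'L by blast
    have g: "g = (fst c, map fst (snd c))" using f(2) c proj by simp
    have "z = (fst z, l (fst z))" if "z \<in> set (snd c)" for z
    proof -
      have "\<exists>f \<in> set J'. nm z \<in> set (snd f)" using that f(1) c(2) by (intro bexI[of _ f]) auto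
      then show ?thesis using l[of z] M[OF c(1) that] by (simp add: prod_eq_iff)
    qed
    then have "map (\<lambda>u. (u, l u)) (snd g) = snd c" using g by (simp add: map_idI)
    then show "(fst g, map (\<lambda>u. (u, l u)) (snd g)) \<in> set L" using c g by simp
  qed (simp add: l_def)
qed

text \<open>A match into a refinement is a match \<open>h\<close> together with labels. Constants
  must carry the trivial label, the only one under which they keep their own name.\<close>

lemma pos_by_lifting:
  assumes "\<And>c. c \<in> Cs \<Longrightarrow> \<exists>h lam. (\<forall>x \<in> fst (snd c). h x = snd (snd c) x \<and> lam x = []) \<and>
     (\<forall>f \<in> fst c. (fst f, map (\<lambda>y. (h y, lam y)) (snd f)) \<in> set L)"
  shows "pos (set (name_facts K L))"
  unfolding pos_def
proof
  fix c assume c: "c \<in> Cs"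
  from assms[OF c] obtain h lam where h: "\<forall>x \<in> fst (snd c). h x = snd (snd c) x \<and> lam x = []"
     "\<forall>f \<in> fst c. (fst f, map (\<lambda>y. (h y, lam y)) (snd f)) \<in> set L" by blast
  let ?h = "\<lambda>y. name_elem K (concat (map snd L)) (h y, lam y)"
  have "?h x = snd (snd c) x" if "x \<in> fst (snd c)" for x
    using h(1) that component_const[OF c that] constants by (simp add: name_elem_def)
  moreover have "instantiate ?h ` fst c \<subseteq> set (name_facts K L)"
    unfolding set_name_facts
  proof (rule image_subsetI)
    fix f assume "f \<in> fst c"
    then have "(fst f, map (\<lambda>y. (h y, lam y)) (snd f)) \<in> set L" using h(2) by (rule bspec[rotated])
    then show "instantiate ?h f \<in>
        (\<lambda>c. (fst c, map (name_elem K (concat (map snd L))) (snd c))) ` set L"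
      by (rule image_eqI[rotated]) (simp add: instantiate_def o_def)
  qed
  ultimately show "maps_into (\<lambda>a. a) c (set (name_facts K L))"
    unfolding maps_into_def by (intro exI[of _ ?h] conjI ballI)
qed

lemma split_at_iff:
  assumes "wf (set J)"
  shows "c \<in> set (split_at K r J f p) \<longleftrightarrow> (fst c, map fst (snd c)) \<in> set J \<and>
    (\<forall>z \<in> set (snd c). snd z \<in> set (split_labels K f (fst z))) \<and> split_ok K f p (fst c, map fst (snd c)) (snd c)"
  unfolding split_at_def by (rule refinement_iff) (rule wf_arity[OF assms])

lemma frontier_iff:
  assumes "wf (set J)"
  shows "c \<in> set (frontier K r J C) \<longleftrightarrow> (fst c, map fst (snd c)) \<in> set J \<and>
    (\<forall>z \<in> set (snd c). snd z \<in> set (frontier_labels K J (fst z))) \<and> frontier_ok K C (fst c, map fst (snd c)) (snd c)"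
  unfolding frontier_def by (rule refinement_iff) (rule wf_arity[OF assms])

text \<open>The sheet of a variable is its colour, that of a fact \<open>t\<close> is
  \<open>b t\<close>, and \<open>p\<close> prescribes the occurrences at which the two have to
  differ. An acyclic component has a colouring for every such prescription.\<close>

lemma pos_split_at:
  assumes J: "wf (set J)" "pos (set J)" and f: "f \<in> set J" "p \<in> set (lifts r (\<lambda>u. split_labels K f u) f)"
  shows "pos (set (name_facts K (split_at K r J f p)))"
proof (rule pos_by_lifting)
  fix c assume c: "c \<in> Cs"
  obtain h where h: "\<And>x. x \<in> fst (snd c) \<Longrightarrow> h x = snd (snd c) x" "instantiate h ` fst c \<subseteq> set J"
    using J(2) c unfolding pos_def maps_into_def by blast
  have hC: "y \<notin> fst (snd c)" if "\<not> h y < K" for y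
    using h(1) that component_const[OF c] constants by auto
  have p: "map fst p = snd f" "\<And>z. z \<in> set p \<Longrightarrow> snd z \<in> set (split_labels K f (fst z))"
    using f(2) lifts_iff[OF wf_arity[OF J(1) f(1)]] by auto
  define w where "w t j \<longleftrightarrow> instantiate h t = f \<and> snd (p ! j) \<noteq> []" for t j
  obtain col b where col: "\<And>t j. t \<in> fst c \<Longrightarrow> j < length (snd t) \<Longrightarrow> snd t ! j \<notin> fst (snd c) \<Longrightarrow>
      (col (snd t ! j) \<longleftrightarrow> b t \<noteq> w t j)"
    using no_cycle_colouring[OF finite_component[OF c] component_acyclic[OF c], of w] by blast
  \<comment> \<open>Variables mapped to a constant get the trivial label, since the cover does not
    double constants.\<close>
  define lam where "lam y = (if h y < K then [] else if col y then [f] else [])" for y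
  have "(fst t, map (\<lambda>y. (h y, lam y)) (snd t)) \<in> set (split_at K r J f p)" if t: "t \<in> fst c" for t
  proof -
    define g where "g = instantiate h t"
    define zs where "zs = map (\<lambda>y. (h y, lam y)) (snd t)"
    have g: "g \<in> set J" "fst g = fst t" "map fst zs = snd g" "length zs = length (snd g)"
      using h(2) t by (auto simp: g_def zs_def o_def)
    have "split_ok K f p g zs"
    proof (cases "g = f")
      case True
      have len: "length p = length zs" using p(1) g True by (metis length_map)
      have fst_p: "fst (p ! j) = fst (zs ! j)" if "j < length zs" for j
        using p(1) g(3) True len that by (metis nth_map)
      have lam: "snd (zs ! j) = (if fst (zs ! j) < K then [] else if b t \<noteq> (snd (p ! j) \<noteq> []) then [f] else [])"
        if j: "j < length zs" for j
        using col[OF t, of j] hC[of "snd t ! j"] j True by (auto simp: zs_def lam_def w_def g_def)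
      have lab: "snd (p ! j) = [] \<or> \<not> fst (zs ! j) < K \<and> snd (p ! j) = [f]" if j: "j < length zs" for j
        using p(2)[of "p ! j"] fst_p[OF j] j len by (auto simp: split_labels_def split: if_splits)
      have "zs = p \<or> zs = map (\<lambda>z. flip K f z) p"
      proof (cases "b t")
        case bt: True
        have "zs ! j = map (\<lambda>z. flip K f z) p ! j" if "j < length zs" for j
          using lab[OF that] lam[OF that] fst_p[OF that] len bt that by (auto simp: flip_def prod_eq_iff)
        then have "zs = map (\<lambda>z. flip K f z) p" using len by (intro nth_equalityI) auto
        then show ?thesis ..
      next
        case bf: False
        have "zs ! j = p ! j" if "j < length zs" for j
          using lab[OF that] lam[OF that] fst_p[OF that] bf that by (auto simp: prod_eq_iff)
        then have "zs = p" using len by (intro nth_equalityI) auto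
        then show ?thesis ..
      qed
      then show ?thesis using True by (simp add: split_ok_def)
    next
      case False
      have "lam y = (if b t then [f] else [])" if y: "y \<in> set (snd t)" "\<not> h y < K" for y
      proof -
        obtain j where "j < length (snd t)" "snd t ! j = y" using y(1) by (auto simp: in_set_conv_nth)
        then show ?thesis using col[OF t, of j] hC[OF y(2)] y(2) False by (simp add: lam_def w_def g_def)
      qed
      then have "h y < K \<or> h y' < K \<or> lam y = lam y'" if "y \<in> set (snd t)" "y' \<in> set (snd t)" for y y'
        using that by metis
      then show ?thesis using False by (simp add: split_ok_def zs_def) blast
    qed
    moreover have "(fst t, map fst zs) = g" using g by (simp add: prod_eq_iff)
    moreover have "\<forall>z \<in> set zs. snd z \<in> set (split_labels K f (fst z))"
      by (auto simp: zs_def lam_def split_labels_def)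
    ultimately show ?thesis using split_at_iff[OF J(1)] g(1) by (simp add: zs_def)
  qed
  moreover have "h x = snd (snd c) x \<and> lam x = []" if "x \<in> fst (snd c)" for x
    using h(1)[OF that] that hC[of x] by (auto simp: lam_def)
  ultimately show "\<exists>h lam. (\<forall>x \<in> fst (snd c). h x = snd (snd c) x \<and> lam x = []) \<and>
     (\<forall>t \<in> fst c. (fst t, map (\<lambda>y. (h y, lam y)) (snd t)) \<in> set (split_at K r J f p))" by blast
qed

text \<open>A cycle through an occurrence of an element in \<open>f\<close> unfolds under the split that separates
  this occurrence from the others.\<close>

lemma no_cycle_by_splitting:
  assumes J: "wf (set J)"
    and sec: "\<And>f p. f \<in> set J \<Longrightarrow> p \<in> set (lifts r (\<lambda>u. split_labels K f u) f) \<Longrightarrow>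
      \<exists>l. \<forall>g \<in> set J. (fst g, map (\<lambda>u. (u, l u)) (snd g)) \<in> set (split_at K r J f p)"
  shows "no_cycle E (set J)"
proof (rule no_cycle_by_colouring)
  fix f i assume f: "f \<in> set J" "i < length (snd f)" "E (snd f ! i)"
  \<comment> \<open>Only occurrence \<open>i\<close> is moved to the other sheet.\<close>
  define p where "p = map (\<lambda>j. (snd f ! j, if j = i then [f] else [])) [0..<length (snd f)]"
  have p: "length p = length (snd f)" "\<And>j. j < length (snd f) \<Longrightarrow> p ! j = (snd f ! j, if j = i then [f] else [])"
    by (auto simp: p_def)
  have "map fst p = snd f" by (rule nth_equalityI) (auto simp: p)
  moreover have "snd z \<in> set (split_labels K f (fst z))" if "z \<in> set p" for z
    using that f(3) by (auto simp: p_def split_labels_def)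
  ultimately have "p \<in> set (lifts r (\<lambda>u. split_labels K f u) f)"
    using lifts_iff[OF wf_arity[OF J f(1)]] by blast
  from sec[OF f(1) this] obtain l where
    l: "\<And>g. g \<in> set J \<Longrightarrow> (fst g, map (\<lambda>u. (u, l u)) (snd g)) \<in> set (split_at K r J f p)" by blast
  have ok: "split_ok K f p g (map (\<lambda>u. (u, l u)) (snd g))" if "g \<in> set J" for g
    using l[OF that] by (simp add: split_at_iff[OF J] o_def)
  \<comment> \<open>The section picks \<open>p\<close> or its mirror image over \<open>f\<close>;
    \<open>flipped\<close> tells which and serves as the colour of \<open>f\<close>. Then the colour
    changes across occurrence \<open>i\<close> of \<open>f\<close> and across no other existential
    occurrence.\<close>
  define flipped where "flipped \<longleftrightarrow> map (\<lambda>u. (u, l u)) (snd f) \<noteq> p"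
  define col where "col v = (case v of Elem u \<Rightarrow> l u \<noteq> []
     | Fact g \<Rightarrow> if g = f then flipped else \<exists>u \<in> set (snd g). E u \<and> l u \<noteq> [])" for v
  have "col (Elem (snd g ! j)) \<noteq> col (Fact g) \<longleftrightarrow> g = f \<and> j = i"
    if g: "g \<in> set J" "j < length (snd g)" "E (snd g ! j)" for g j
  proof (cases "g = f")
    case True
    have "l (snd f ! j) = (if flipped then (if j = i then [] else [f]) else (if j = i then [f] else []))"
    proof (cases flipped)
      case fl: True
      then have "map (\<lambda>u. (u, l u)) (snd f) = map (\<lambda>z. flip K f z) p"
        using ok[OF f(1)] by (simp add: split_ok_def flipped_def)
      then have "map (\<lambda>u. (u, l u)) (snd f) ! j = map (\<lambda>z. flip K f z) p ! j" by simp
      then show ?thesis using fl g True p by (simp add: flip_def)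
    next
      case False
      then have "map (\<lambda>u. (u, l u)) (snd f) ! j = p ! j" by (simp add: flipped_def)
      then show ?thesis using False g True p by simp
    qed
    then show ?thesis using True by (auto simp: col_def)
  next
    case False
    then have "\<And>u v. u \<in> set (snd g) \<Longrightarrow> v \<in> set (snd g) \<Longrightarrow> E u \<Longrightarrow> E v \<Longrightarrow> l u = l v"
      using ok[OF g(1)] by (auto simp: split_ok_def)
    then have "l (snd g ! j) \<noteq> [] \<longleftrightarrow> (\<exists>u \<in> set (snd g). E u \<and> l u \<noteq> [])"
      using g nth_mem by metis
    then show ?thesis using False by (simp add: col_def)
  qed
  then show "\<exists>col :: vertex \<Rightarrow> bool. \<forall>g \<in> set J. \<forall>j < length (snd g). E (snd g ! j) \<longrightarrow>
       (col (Elem (snd g ! j)) \<noteq> col (Fact g) \<longleftrightarrow> g = f \<and> j = i)" by blast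
qed

section \<open>Frontiers and fixed points of the improvement\<close>

text \<open>The labels of a section would be a choice of incident facts that never turns back:
  \<open>frontier_ok\<close> provides in each fact of the component an element whose choice is
  another fact. Constants cannot be the witness, as the section gives them the trivial
  label.\<close>

lemma frontier_no_section:
  assumes J: "wf (set J)" and t: "tree E gs" "set gs \<subseteq> set J"
    and cl: "\<And>g. g \<in> set J \<Longrightarrow> exs E {g} \<inter> exs E (set gs) \<noteq> {} \<Longrightarrow> g \<in> set gs"
    and C: "set C = set gs"
    and l: "\<And>u. u < K \<Longrightarrow> l u = []"
      "\<And>g. g \<in> set J \<Longrightarrow> (fst g, map (\<lambda>u. (u, l u)) (snd g)) \<in> set (frontier K r J C)"
  shows False
proof (rule tree_no_choice[OF t(1), of "\<lambda>u. hd (l u)"])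
  fix u assume u: "u \<in> exs E (set gs)"
  then obtain g where g: "g \<in> set gs" "u \<in> set (snd g)" "E u" by (auto simp: exs_def)
  then have "l u \<in> set (frontier_labels K J u)" using l(2)[of g] t(2) by (auto simp: frontier_iff[OF J])
  then obtain h where h: "l u = [h]" "h \<in> set J" "u \<in> set (snd h)" using g(3) by (auto simp: frontier_labels_def)
  then have "h \<in> set gs" using cl[of h] u g(3) by (auto simp: exs_def)
  then show "hd (l u) \<in> set gs \<and> u \<in> set (snd (hd (l u)))" using h by simp
next
  fix g assume g: "g \<in> set gs"
  then have "(fst g, map (\<lambda>u. (u, l u)) (snd g)) \<in> set (frontier K r J C)" using l(2) t(2) by blast
  then have *: "\<forall>u \<in> set (snd g). l u \<in> set (frontier_labels K J u)"
    "frontier_ok K C g (map (\<lambda>u. (u, l u)) (snd g))" by (simp_all add: frontier_iff[OF J] o_def)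
  then obtain u where u: "u \<in> set (snd g)" "if u < K then l u \<noteq> [] else l u \<noteq> [g]"
    using g C by (auto simp: frontier_ok_def split: if_splits)
  then have "E u" "l u \<noteq> [g]" using l(1)[of u] by (auto split: if_splits)
  moreover have "l u = [hd (l u)]" using *(1) u(1) \<open>E u\<close> by (auto simp: frontier_labels_def)
  ultimately show "\<exists>u \<in> exs E {g}. hd (l u) \<noteq> g" using u(1) by (auto simp: exs_def intro!: exI[of _ u])
qed

text \<open>Some component \<open>c\<close> of the query has no lift to the frontier. By
  \<open>tree_section_or_labelling\<close> its match \<open>h\<close> then has a section over
  \<open>gs\<close>, and so \<open>gs\<close> maps to whatever \<open>c\<close> maps to.\<close>

lemma frontier_section:
  assumes J: "wf (set J)" "pos (set J)" and t: "tree E gs" "set gs \<subseteq> set J"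
    and cl: "\<And>g. g \<in> set J \<Longrightarrow> exs E {g} \<inter> exs E (set gs) \<noteq> {} \<Longrightarrow> g \<in> set gs"
    and C: "set C = set gs" and neg: "\<not> pos (set (name_facts K (frontier K r J C)))"
    and G: "\<And>c. c \<in> Cs \<Longrightarrow> maps_into s c G"
  shows "\<exists>h. (\<forall>a \<in> set (snd \<alpha>). h a = s a) \<and> instantiate h ` set gs \<subseteq> G"
proof -
  obtain c where c: "c \<in> Cs" and no_lift: "\<not> (\<exists>h lam. (\<forall>x \<in> fst (snd c). h x = snd (snd c) x \<and> lam x = []) \<and>
     (\<forall>f \<in> fst c. (fst f, map (\<lambda>y. (h y, lam y)) (snd f)) \<in> set (frontier K r J C)))"
    using neg pos_by_lifting[of "frontier K r J C"] by blast
  obtain h where h: "\<And>x. x \<in> fst (snd c) \<Longrightarrow> h x = snd (snd c) x" "instantiate h ` fst c \<subseteq> set J"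
    using J(2) c unfolding pos_def maps_into_def by blast
  have hC: "y \<notin> fst (snd c)" if "\<not> h y < K" for y
    using h(1) that component_const[OF c] constants by auto
  from tree_section_or_labelling[OF t(1), of "fst c" h "fst (snd c)"] show ?thesis
  proof (elim disjE exE)
    fix lam assume lam: "(\<forall>x. h x \<in> exs E (set gs) \<longrightarrow> lam x \<in> set gs \<and> h x \<in> set (snd (lam x))) \<and>
      (\<forall>t \<in> fst c. (\<forall>y \<in> set (snd t). \<not> E (h y) \<longrightarrow> y \<in> fst (snd c)) \<and> instantiate h t \<in> set gs \<longrightarrow>
         (\<exists>x \<in> set (snd t). E (h x) \<and> lam x \<noteq> instantiate h t))"
    \<comment> \<open>Variables that are mapped to constants without being constants of the query
      receive a nontrivial label, so facts containing them meet \<open>frontier_ok\<close> at once.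
      Elements outside the component may take any incident fact as label.\<close>
    define l where "l y = (if y \<in> fst (snd c) then [] else if h y \<in> exs E (set gs) then [lam y]
       else [SOME g. g \<in> set J \<and> h y \<in> set (snd g)])" for y
    have "(fst t, map (\<lambda>y. (h y, l y)) (snd t)) \<in> set (frontier K r J C)" if tc: "t \<in> fst c" for t
    proof -
      define g where "g = instantiate h t"
      have g: "g \<in> set J" using h(2) tc by (auto simp: g_def)
      have "l y \<in> set (frontier_labels K J (h y))" if y: "y \<in> set (snd t)" for y
      proof (cases "y \<in> fst (snd c)")
        case True
        then show ?thesis using hC by (auto simp: l_def frontier_labels_def)
      next
        case False
        have "h y \<in> set (snd g)" using y by (auto simp: g_def)
        then have "(SOME g. g \<in> set J \<and> h y \<in> set (snd g)) \<in> set J \<and>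
            h y \<in> set (snd (SOME g. g \<in> set J \<and> h y \<in> set (snd g)))"
          using g someI[of "\<lambda>g. g \<in> set J \<and> h y \<in> set (snd g)" g] by blast
        moreover have "lam y \<in> set J \<and> h y \<in> set (snd (lam y))" if "h y \<in> exs E (set gs)"
          using lam t(2) that by blast
        ultimately obtain g' where "l y = [g']" "g' \<in> set J" "h y \<in> set (snd g')"
          using False unfolding l_def by (cases "h y \<in> exs E (set gs)") auto
        then show ?thesis by (auto simp: frontier_labels_def)
      qed
      moreover have "frontier_ok K C g (map (\<lambda>y. (h y, l y)) (snd t))"
      proof (cases "g \<in> set gs \<and> (\<forall>y \<in> set (snd t). \<not> E (h y) \<longrightarrow> y \<in> fst (snd c))")
        case True
        then obtain x where x: "x \<in> set (snd t)" "E (h x)" "lam x \<noteq> g" using lam tc by (auto simp: g_def)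
        have "h x \<in> set (snd g)" using x by (auto simp: g_def)
        then have "h x \<in> exs E (set gs)" using x True by (auto simp: exs_def)
        then have "l x = [lam x]" using hC[OF x(2)] by (simp add: l_def)
        then show ?thesis using x by (auto simp: frontier_ok_def)
      next
        case False
        then show ?thesis using C by (auto simp: frontier_ok_def l_def)
      qed
      moreover have "(fst t, map h (snd t)) = g" by (simp add: g_def instantiate_def)
      ultimately show ?thesis using g by (simp add: frontier_iff[OF J(1)] o_def)
    qed
    moreover have "h x = snd (snd c) x \<and> l x = []" if "x \<in> fst (snd c)" for x
      using h(1) that by (simp add: l_def)
    ultimately show ?thesis using no_lift by blast
  next
    fix k assume k: "\<forall>g \<in> set gs. \<exists>t \<in> fst c. instantiate h t = g \<and>
       (\<forall>y \<in> set (snd t). \<not> E (h y) \<longrightarrow> y \<in> fst (snd c)) \<and>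
       (\<forall>j < length (snd g). E (snd g ! j) \<longrightarrow> snd t ! j = k (snd g ! j))"
    obtain h' where h': "\<forall>x \<in> fst (snd c). h' x = s (snd (snd c) x)" "instantiate h' ` fst c \<subseteq> G"
      using G[OF c] unfolding maps_into_def by blast
    define m where "m u = (if u < K then s u else h' (k u))" for u
    have "instantiate m g \<in> G" if g: "g \<in> set gs" for g
    proof -
      from k g obtain t where t: "t \<in> fst c" "instantiate h t = g"
        "\<forall>y \<in> set (snd t). \<not> E (h y) \<longrightarrow> y \<in> fst (snd c)"
        "\<forall>j < length (snd g). E (snd g ! j) \<longrightarrow> snd t ! j = k (snd g ! j)" by blast
      have len: "length (snd g) = length (snd t)" and nth: "\<And>j. j < length (snd t) \<Longrightarrow> snd g ! j = h (snd t ! j)"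
        using t(2) by auto
      have "m (snd g ! j) = h' (snd t ! j)" if j: "j < length (snd t)" for j
      proof (cases "snd g ! j < K")
        case True
        then have "snd t ! j \<in> fst (snd c)" using t(3) nth[OF j] j by auto
        then show ?thesis using h(1) h'(1) nth[OF j] True by (simp add: m_def)
      next
        case False
        then show ?thesis using t(4) len j by (simp add: m_def)
      qed
      then have "map m (snd g) = map h' (snd t)" using len by (intro nth_equalityI) auto
      then have "instantiate m g = instantiate h' t" using t(2) by (auto simp: instantiate_def)
      then show ?thesis using h'(2) t(1) by auto
    qed
    moreover have "m a = s a" if "a \<in> set (snd \<alpha>)" for a using constants[OF that] by (simp add: m_def)
    ultimately show ?thesis by blast
  qed
qed

text \<open>The second claim says that \<open>J\<close> maps wherever the query does; with
  positivity this is homomorphic equivalence. It is proved for unions of components, from which one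
  component at a time is removed, because a failed frontier yields a map of one component
  only.\<close>

theorem improve_fixpoint:
  assumes J: "wf (set J)" "minimal (set J)" and fp: "improve Q K r (\<alpha>, J) = (\<alpha>, J)"
  shows "no_cycle E (set J)"
    and "(\<And>c. c \<in> Cs \<Longrightarrow> maps_into s c G) \<Longrightarrow>
      \<exists>h. (\<forall>a \<in> set (snd \<alpha>). h a = s a) \<and> instantiate h ` set J \<subseteq> G"
proof -
  have "pos (set J)" using J(2) by (simp add: minimal_def)
  note J = J this
  have refines: "(fst c, map fst (snd c)) \<in> set J" if "L \<in> set (refinements K r J)" "c \<in> set L" for L c
    using that frontier_iff[OF J(1)] split_at_iff[OF J(1)] unfolding refinements_def by fastforce
  have small: "\<not> length (bulk K J) < length (bulk K (minimize Q \<alpha> (name_facts K L)))"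
    if "L \<in> set (refinements K r J)" "pos (set (name_facts K L))" for L
  proof
    define Js where "Js = filter (\<lambda>J'. length (bulk K J) < length (bulk K J'))
      (map (\<lambda>J. minimize Q \<alpha> J) (filter (\<lambda>J. query_pos Q \<alpha> J)
         (map (\<lambda>L. name_facts K L) (refinements K r J))))"
    assume "length (bulk K J) < length (bulk K (minimize Q \<alpha> (name_facts K L)))"
    then have "minimize Q \<alpha> (name_facts K L) \<in> set Js"
      using that query_pos_iff[OF wf_name_facts[OF J(1) refines[OF that(1)]]] by (auto simp: Js_def)
    then obtain J' Js' where "Js = J' # Js'" by (cases Js) auto
    moreover from this have "length (bulk K J) < length (bulk K J')"
      by (metis Js_def filter_eq_Cons_iff)
    moreover have "head J Js = J" using fp by (simp add: improve_def Js_def)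
    ultimately show False by (auto simp: head_def)
  qed
  have sec: "\<exists>l. (\<forall>u < K. l u = []) \<and> (\<forall>g \<in> set J. (fst g, map (\<lambda>u. (u, l u)) (snd g)) \<in> set L)"
    if L: "L \<in> set (refinements K r J)" "pos (set (name_facts K L))" for L
  proof -
    note wfL = wf_name_facts[OF J(1) refines[OF L(1)]]
    show ?thesis
      using section_of_refinement[OF J(1,2) refines[OF L(1)] minimize(1)[OF wfL L(2)] _ small[OF L]]
        minimize(3)[OF wfL L(2)] unfolding minimal_def by metis
  qed
  show nc: "no_cycle E (set J)"
  proof (rule no_cycle_by_splitting[OF J(1)])
    fix f p assume "f \<in> set J" "p \<in> set (lifts r (\<lambda>u. split_labels K f u) f)"
    then show "\<exists>l. \<forall>g \<in> set J. (fst g, map (\<lambda>u. (u, l u)) (snd g)) \<in> set (split_at K r J f p)"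
      using sec[of "split_at K r J f p"] pos_split_at[OF J(1,3)] by (auto simp: refinements_def)
  qed
  assume G: "\<And>c. c \<in> Cs \<Longrightarrow> maps_into s c G"
  have "\<exists>h. (\<forall>a \<in> set (snd \<alpha>). h a = s a) \<and> instantiate h ` F \<subseteq> G"
    if "F \<subseteq> set J" "\<And>g h. g \<in> F \<Longrightarrow> h \<in> set J \<Longrightarrow> exs E {g} \<inter> exs E {h} \<noteq> {} \<Longrightarrow> h \<in> F" for F
    using finite_subset[OF that(1) finite_set] that
  proof (induction F rule: finite_psubset_induct)
    case (psubset F)
    show ?case
    proof (cases "F = {}")
      case True
      then show ?thesis by auto
    next
      case False
      then obtain g0 where g0: "g0 \<in> F" "g0 \<in> set J" using psubset.prems(1) by blast
      obtain gs where gs: "tree E gs" "g0 \<in> set gs" "set gs \<subseteq> set J"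
        "\<And>g. g \<in> set J \<Longrightarrow> exs E {g} \<inter> exs E (set gs) \<noteq> {} \<Longrightarrow> g \<in> set gs"
        using no_cycle_component[OF nc finite_set g0(2)] by blast
      have F: "set gs \<subseteq> F"
        by (rule tree_connected[OF gs(1)]) (use psubset.prems(2) gs g0 in \<open>blast+\<close>)
      have comp: "set (component K J g0) = set gs" by (rule component_eq_tree[OF gs])
      let ?L = "frontier K r J (component K J g0)"
      have L: "?L \<in> set (refinements K r J)" using g0 by (auto simp: refinements_def)
      have "\<not> pos (set (name_facts K ?L))"
      proof
        assume "pos (set (name_facts K ?L))"
        from sec[OF L this] obtain l where "\<And>u. u < K \<Longrightarrow> l u = []"
          "\<And>g. g \<in> set J \<Longrightarrow> (fst g, map (\<lambda>u. (u, l u)) (snd g)) \<in> set ?L" by blast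
        from frontier_no_section[OF J(1) gs(1,3,4) comp this] show False .
      qed
      from frontier_section[OF J(1,3) gs(1,3,4) comp this G] obtain h1 where
        h1: "\<forall>a \<in> set (snd \<alpha>). h1 a = s a" "instantiate h1 ` set gs \<subseteq> G" by blast
      have "F - set gs \<subset> F" using gs(2) g0 by blast
      moreover have "h \<in> F - set gs" if "g \<in> F - set gs" "h \<in> set J" "exs E {g} \<inter> exs E {h} \<noteq> {}" for g h
      proof -
        have "exs E {h} \<subseteq> exs E (set gs)" if "h \<in> set gs" using that by (intro exs_mono) auto
        then show ?thesis using psubset.prems that gs(4)[of g] by blast
      qed
      ultimately obtain h2 where h2: "\<forall>a \<in> set (snd \<alpha>). h2 a = s a" "instantiate h2 ` (F - set gs) \<subseteq> G"
        using psubset.IH[of "F - set gs"] psubset.prems(1) by blast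
      \<comment> \<open>The two maps agree on the constants, and the two parts share no existential
        elements, so the maps can be glued.\<close>
      define h where "h u = (if u \<in> exs E (set gs) then h1 u else h2 u)" for u
      have const: "h a = s a" if "a \<in> set (snd \<alpha>)" for a using h1 h2 that by (simp add: h_def)
      have "instantiate h g \<in> G" if g: "g \<in> F" for g
      proof (cases "g \<in> set gs")
        case True
        have "h u = h1 u" if u: "u \<in> set (snd g)" for u
        proof (cases "u < K")
          case True
          then have "u \<in> set (snd \<alpha>)" using J(1) g psubset.prems(1) u unfolding wf_def by blast
          then show ?thesis using const h1 by simp
        next
          case False
          then show ?thesis using True u by (auto simp: h_def exs_def)
        qed
        then have "instantiate h g = instantiate h1 g" by (simp add: instantiate_def)
        then show ?thesis using h1(2) True by auto
      next
        case False
        have "h u = h2 u" if u: "u \<in> set (snd g)" for u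
        proof -
          have "u \<notin> exs E (set gs)" using gs(4)[of g] False g psubset.prems(1) u by (auto simp: exs_def)
          then show ?thesis by (simp add: h_def)
        qed
        then have "instantiate h g = instantiate h2 g" by (simp add: instantiate_def)
        then show ?thesis using h2(2) False g by auto
      qed
      then show ?thesis using const by blast
    qed
  qed
  from this[of "set J"] show "\<exists>h. (\<forall>a \<in> set (snd \<alpha>). h a = s a) \<and> instantiate h ` set J \<subseteq> G" by blast
qed

end

section \<open>Size bounds\<close>

lemma length_plist:
  "(\<And>xs. xs \<in> set xss \<Longrightarrow> length xs \<le> m) \<Longrightarrow> m \<ge> 1 \<Longrightarrow> length (plist n xss) \<le> m ^ n"
proof (induction n arbitrary: xss)
  case (Suc n)
  show ?case
  proof (cases xss)
    case Nil
    then show ?thesis using Suc.prems(2) by simp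
  next
    case (Cons xs yss)
    have "length (plist n yss) \<le> m ^ n" using Suc Cons by simp
    moreover have "length xs \<le> m" using Suc.prems(1) Cons by simp
    ultimately have "length xs * length (plist n yss) \<le> m * m ^ n" by (intro mult_mono) auto
    then show ?thesis using Cons by (simp add: head_def length_concat o_def sum_list_triv)
  qed
qed simp

lemma sum_list_le_mult: "(\<And>x. x \<in> set xs \<Longrightarrow> f x \<le> (B::nat)) \<Longrightarrow> sum_list (map f xs) \<le> length xs * B"
  by (induction xs) (auto intro: add_mono)

lemma length_refinement:
  assumes "\<And>u. length (lab u) \<le> m" "m \<ge> 1"
  shows "length (refinement r lab ok J) \<le> length J * m ^ r"
proof -
  have "length (filter (\<lambda>zs. ok g zs) (lifts r lab g)) \<le> m ^ r" for g
    by (rule order_trans[OF length_filter_le])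
       (unfold lifts_def, rule length_plist, use assms in auto)
  then show ?thesis
    unfolding refinement_def length_concat map_map o_def length_map by (intro sum_list_le_mult)
qed

text \<open>\<open>length J + 2\<close> bounds the number of labels of an element in either
  construction, and the product over the arguments is cut off after \<open>r\<close>
  factors.\<close>

lemma length_refinements:
  assumes "L \<in> set (refinements K r J)"
  shows "length L \<le> length J * (length J + 2) ^ r"
proof -
  have "length (frontier_labels K J u) \<le> length J + 2" for u
    using length_filter_le[of _ J] by (simp add: frontier_labels_def trans_le_add1 le_SucI)
  then have *: "length (frontier K r J C) \<le> length J * (length J + 2) ^ r" for C
    unfolding frontier_def by (intro length_refinement) simp_all
  have "length (split_at K r J f p) \<le> length J * (length J + 2) ^ r" for f p
    unfolding split_at_def by (intro length_refinement) (simp_all add: split_labels_def)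
  with * assms show ?thesis by (auto simp: refinements_def)
qed

lemma name_elem_le: "name_elem K E z \<le> K + length E"
  by (simp add: name_elem_def length_takeWhile_le trans_le_add1)

text \<open>Without a fixed point up to the \<open>N\<close>-th iterate, \<open>\<Phi>\<close> would
  have grown \<open>N + 1\<close> times.\<close>

lemma iterate_reaches_fixpoint:
  fixes \<Phi> :: "'a \<Rightarrow> nat"
  assumes P: "P x" "\<And>y. P y \<Longrightarrow> P (f y)" and inc: "\<And>y. P y \<Longrightarrow> f y \<noteq> y \<Longrightarrow> \<Phi> y < \<Phi> (f y)"
    and bound: "\<And>y. P y \<Longrightarrow> \<Phi> y \<le> N"
  shows "f ((f ^^ N) x) = (f ^^ N) x"
proof (rule ccontr)
  assume neq: "f ((f ^^ N) x) \<noteq> (f ^^ N) x"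
  have Pi: "P ((f ^^ i) x)" for i using P by (induction i) auto
  have ne: "f ((f ^^ i) x) \<noteq> (f ^^ i) x" if "i \<le> N" for i
  proof
    assume fixed: "f ((f ^^ i) x) = (f ^^ i) x"
    have "(f ^^ k) ((f ^^ i) x) = (f ^^ i) x" for k using fixed by (induction k) auto
    from this[of "N - i"] have "(f ^^ N) x = (f ^^ i) x"
      using that by (metis add.commute comp_apply funpow_add le_add_diff_inverse)
    then show False using neq fixed by simp
  qed
  have "i \<le> \<Phi> ((f ^^ i) x)" if "i \<le> Suc N" for i
    using that
  proof (induction i)
    case (Suc i)
    then show ?case using inc[OF Pi ne, of i] by simp
  qed simp
  from this[of "Suc N"] bound[OF Pi, of "Suc N"] show False by simp
qed

context target
begin

definition good :: "nat \<Rightarrow> fact list \<Rightarrow> bool" where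
  "good V J \<longleftrightarrow> wf (set J) \<and> minimal (set J) \<and> distinct J \<and> (\<forall>f \<in> set J. \<forall>u \<in> set (snd f). u \<le> V)"

text \<open>The image of the query in \<open>J\<close> is a positive part, hence \<open>J\<close>
  itself; so the unknown query bounds the number of facts.\<close>

lemma card_minimal:
  assumes "finite Cs" "minimal J" "(\<Sum>c \<in> Cs. card (fst c)) \<le> n"
  shows "card J \<le> n"
proof -
  have "\<forall>c \<in> Cs. \<exists>h. (\<forall>x \<in> fst (snd c). h x = snd (snd c) x) \<and> instantiate h ` fst c \<subseteq> J"
    using assms(2) unfolding minimal_def pos_def maps_into_def by blast
  then obtain H where H: "\<And>c. c \<in> Cs \<Longrightarrow> (\<forall>x \<in> fst (snd c). H c x = snd (snd c) x) \<and> instantiate (H c) ` fst c \<subseteq> J"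
    by metis
  let ?J = "\<Union>c \<in> Cs. instantiate (H c) ` fst c"
  have "pos ?J" unfolding pos_def maps_into_def using H by blast
  moreover have "?J \<subseteq> J" using H by blast
  ultimately have "?J = J" using assms(2) unfolding minimal_def by blast
  then have "card J \<le> (\<Sum>c \<in> Cs. card (instantiate (H c) ` fst c))"
    using card_UN_le[OF assms(1), of "\<lambda>c. instantiate (H c) ` fst c"] by simp
  also have "\<dots> \<le> (\<Sum>c \<in> Cs. card (fst c))"
    by (intro sum_mono card_image_le finite_component)
  finally show ?thesis using assms(3) by simp
qed

lemma card_exs:
  assumes "wf J" "finite J" shows "card (exs E J) \<le> card J * r"
proof -
  have "card (exs E J) \<le> card (\<Union>g \<in> J. set (snd g))"
    using assms(2) by (intro card_mono) (auto simp: exs_def)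
  also have "\<dots> \<le> (\<Sum>g \<in> J. card (set (snd g)))" using assms(2) by (rule card_UN_le)
  also have "\<dots> \<le> (\<Sum>g \<in> J. r)"
    using wf_arity[OF assms(1)] by (intro sum_mono) (meson card_length order_trans)
  finally show ?thesis by simp
qed

lemma bulk_bound:
  assumes "finite Cs" "(\<Sum>c \<in> Cs. card (fst c)) \<le> n" "good V J"
  shows "length (bulk K J) \<le> n * (r + 1)" and "length J \<le> n"
proof -
  have J: "wf (set J)" "minimal (set J)" "distinct J" using assms(3) by (auto simp: good_def)
  have c: "card (set J) \<le> n" by (rule card_minimal[OF assms(1) J(2) assms(2)])
  then show "length J \<le> n" using distinct_card[OF J(3)] by simp
  have "card (exs E (set J)) \<le> n * r"
    using card_exs[OF J(1)] c by (meson finite_set mult_le_mono1 order_trans)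
  then show "length (bulk K J) \<le> n * (r + 1)" using c by (simp add: length_bulk)
qed

text \<open>\<open>V\<close> comes from the names: a refinement of at most \<open>n\<close> facts
  has at most \<open>n * (n + 2) ^ r\<close> facts with at most \<open>r\<close> arguments each, and
  these are numbered from \<open>K\<close>.\<close>

lemma improve_good:
  assumes "finite Cs" "(\<Sum>c \<in> Cs. card (fst c)) \<le> n" and J: "good V J"
    and V: "V = K + n * (n + 2) ^ r * r"
  shows "fst (improve Q K r (\<alpha>, J)) = \<alpha>" "good V (snd (improve Q K r (\<alpha>, J)))"
    and "improve Q K r (\<alpha>, J) \<noteq> (\<alpha>, J) \<Longrightarrow> length (bulk K J) < length (bulk K (snd (improve Q K r (\<alpha>, J))))"
    and "length (bulk K J) \<le> length (bulk K (snd (improve Q K r (\<alpha>, J))))"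
proof -
  have wf: "wf (set J)" and len: "length J \<le> n"
    using J bulk_bound(2)[OF assms(1-3)] by (auto simp: good_def)
  define Js where "Js = filter (\<lambda>J'. length (bulk K J) < length (bulk K J'))
      (map (\<lambda>J. minimize Q \<alpha> J) (filter (\<lambda>J. query_pos Q \<alpha> J)
         (map (\<lambda>L. name_facts K L) (refinements K r J))))"
  have imp: "improve Q K r (\<alpha>, J) = (\<alpha>, head J Js)" by (simp add: improve_def Js_def)
  then show "fst (improve Q K r (\<alpha>, J)) = \<alpha>" by simp
  have Js: "good V J' \<and> length (bulk K J) < length (bulk K J')" if "J' \<in> set Js" for J'
  proof -
    from that obtain L where L: "L \<in> set (refinements K r J)" "query_pos Q \<alpha> (name_facts K L)"
      "J' = minimize Q \<alpha> (name_facts K L)" and bulk: "length (bulk K J) < length (bulk K J')"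
      by (auto simp: Js_def)
    have ref: "(fst c, map fst (snd c)) \<in> set J" if "c \<in> set L" for c
      using that L(1) frontier_iff[OF wf] split_at_iff[OF wf] unfolding refinements_def by fastforce
    note wfL = wf_name_facts[OF wf ref]
    have pos: "pos (set (name_facts K L))" using L(2) query_pos_iff[OF wfL] by simp
    note m = minimize[OF wfL pos, folded L(3)]
    have "length (snd c) \<le> r" if "c \<in> set L" for c
      using wf_arity[OF wf ref[OF that]] by simp
    then have "length (concat (map snd L)) \<le> length L * r"
      unfolding length_concat map_map o_def by (rule sum_list_le_mult)
    also have "\<dots> \<le> length J * (length J + 2) ^ r * r"
      using length_refinements[OF L(1)] by simp
    also have "\<dots> \<le> n * (n + 2) ^ r * r"
      using len by (intro mult_mono power_mono) auto
    finally have "name_elem K (concat (map snd L)) z \<le> V" for z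
      using name_elem_le[of K "concat (map snd L)" z] V by simp
    then have "\<forall>f \<in> set J'. \<forall>u \<in> set (snd f). u \<le> V"
      using m(1) by (fastforce simp: set_name_facts)
    then show ?thesis using m wf_subset[OF wfL m(1)] bulk by (simp add: good_def)
  qed
  have "head J Js = J \<or> head J Js \<in> set Js" by (cases Js) (auto simp: head_def)
  then show "good V (snd (improve Q K r (\<alpha>, J)))"
    "improve Q K r (\<alpha>, J) \<noteq> (\<alpha>, J) \<Longrightarrow> length (bulk K J) < length (bulk K (snd (improve Q K r (\<alpha>, J))))"
    "length (bulk K J) \<le> length (bulk K (snd (improve Q K r (\<alpha>, J))))"
    using imp Js J by (auto intro: less_imp_le)
qed

text \<open>Sending all existential variables to \<open>K\<close> maps the query to the full
  structure, whatever the goal is.\<close>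

lemma minimize_full_good:
  assumes full: "set J = {f. T (fst f) = Some (length (snd f)) \<and> set (snd f) \<subseteq> insert K (set (snd \<alpha>))}"
    and V: "K \<le> V"
  shows "good V (minimize Q \<alpha> J)"
proof -
  have wf: "wf (set J)" unfolding wf_def full by auto
  have "pos (set J)" unfolding pos_def
  proof
    fix c assume c: "c \<in> Cs"
    let ?h = "\<lambda>y. if y \<in> fst (snd c) then snd (snd c) y else K"
    have "instantiate ?h ` fst c \<subseteq> set J"
      unfolding full using component_typed[OF c] component_const[OF c] by auto
    then show "maps_into (\<lambda>a. a) c (set J)" unfolding maps_into_def by (intro exI[of _ ?h]) simp
  qed
  note m = minimize[OF wf this]
  have "\<forall>f \<in> set J. \<forall>u \<in> set (snd f). u \<le> V"
  proof safe
    fix s us u assume "(s, us) \<in> set J" "u \<in> set (snd (s, us))"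
    then have "u = K \<or> u \<in> set (snd \<alpha>)" unfolding full by auto
    then show "u \<le> V" using constants[of u] V by auto
  qed
  then show ?thesis using m wf_subset[OF wf m(1)] unfolding good_def by blast
qed

end

lemma size_enc_fact:
  assumes "s \<le> R" "length us \<le> r" "\<And>u. u \<in> set us \<Longrightarrow> u \<le> V"
  shows "size (enc (s, us)) \<le> R + r * (V + 1) + 1"
proof -
  have "size (enc us) \<le> length us * (V + 1)"
    unfolding size_enc_list by (rule sum_list_le_mult) (use assms in simp)
  also have "\<dots> \<le> r * (V + 1)" using assms(2) by (rule mult_le_mono1)
  finally show ?thesis using assms(1) by simp
qed


section \<open>The queries of a schema mapping\<close>

lemma enc_nat_fun: "(enc :: nat \<Rightarrow> val) = encode_nat"
  by (rule ext) (simp add: enc_nat_def)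

lemma enc_fact_fun: "(enc :: fact \<Rightarrow> val) = encode_fact"
  by (rule ext) (simp add: enc_prod_def encode_fact_def enc_list_def enc_nat_fun)

lemma represents_structure_enc:
  "represents_structure v A \<longleftrightarrow> (\<exists>ds fs. set ds = elements A \<and> set fs = facts A \<and> v = Node (enc ds) (enc fs))"
  by (simp add: represents_structure_def enc_list_def enc_nat_fun enc_fact_fun)

text \<open>As the schemas are disjoint, left-hand sides can match only in \<open>I\<close> and
  right-hand sides only in \<open>J\<close>. Variables land in the elements because arguments of
  facts are elements.\<close>

lemma satisfies_iff:
  assumes "dom S \<inter> dom T = {}" "is_structure S I" "is_structure T J"
    and c: "atom_over S (lhs c)" "\<forall>a \<in> set (rhs c). atom_over T a"
  shows "satisfies (struct_union I J) c \<longleftrightarrow> (\<forall>h. instantiate h (lhs c) \<in> facts I \<longrightarrow>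
     (\<exists>h'. (\<forall>x \<in> atom_vars (lhs c). h' x = h x) \<and> instantiate h' ` set (rhs c) \<subseteq> facts J))"
proof -
  have I: "S (fst f) = Some (length (snd f))" "set (snd f) \<subseteq> elements I" if "f \<in> facts I" for f
    using assms(2) that unfolding is_structure_def by (auto simp: case_prod_beta)
  have J: "T (fst f) = Some (length (snd f))" "set (snd f) \<subseteq> elements J" if "f \<in> facts J" for f
    using assms(3) that unfolding is_structure_def by (auto simp: case_prod_beta)
  have l: "instantiate h (lhs c) \<in> facts I \<union> facts J \<longleftrightarrow> instantiate h (lhs c) \<in> facts I" for h
    using assms(1) c(1) J(1)[of "instantiate h (lhs c)"] by (auto simp: atom_over_def)
  have l': "h ` atom_vars (lhs c) \<subseteq> elements I" if "instantiate h (lhs c) \<in> facts I" for h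
    using I(2)[OF that] by (simp add: atom_vars_def)
  have r: "instantiate h a \<in> facts I \<union> facts J \<longleftrightarrow> instantiate h a \<in> facts J" if "a \<in> set (rhs c)" for h a
    using assms(1) c(2) I(1)[of "instantiate h a"] that by (auto simp: atom_over_def)
  have r': "h ` rhs_vars c \<subseteq> elements J" if "\<forall>a \<in> set (rhs c). instantiate h a \<in> facts J" for h
  proof -
    have "h ` set (snd a) \<subseteq> elements J" if a: "a \<in> set (rhs c)" for a
      using J(2)[of "instantiate h a"] that a \<open>\<forall>a \<in> set (rhs c). instantiate h a \<in> facts J\<close> by simp
    then show ?thesis by (auto simp: rhs_vars_def atom_vars_def)
  qed
  have "satisfies (struct_union I J) c \<longleftrightarrow> (\<forall>h. instantiate h (lhs c) \<in> facts I \<longrightarrow>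
     (\<exists>h'. (\<forall>x \<in> atom_vars (lhs c). h' x = h x) \<and> (\<forall>a \<in> set (rhs c). instantiate h' a \<in> facts J)))"
    (is "_ \<longleftrightarrow> ?R")
  proof
    assume s: "satisfies (struct_union I J) c"
    show ?R
    proof (intro allI impI)
      fix h assume h: "instantiate h (lhs c) \<in> facts I"
      then have "h ` atom_vars (lhs c) \<subseteq> elements (struct_union I J) \<and>
          instantiate h (lhs c) \<in> facts (struct_union I J)"
        using l' by (auto simp: struct_union_def)
      from s[unfolded satisfies_def, rule_format, OF this] obtain h' where
        "\<forall>x \<in> atom_vars (lhs c). h' x = h x"
        "\<forall>a \<in> set (rhs c). instantiate h' a \<in> facts (struct_union I J)" by blast
      then have "\<forall>x \<in> atom_vars (lhs c). h' x = h x"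
        "\<forall>a \<in> set (rhs c). instantiate h' a \<in> facts I \<union> facts J" by (simp_all add: struct_union_def)
      then show "\<exists>h'. (\<forall>x \<in> atom_vars (lhs c). h' x = h x) \<and> (\<forall>a \<in> set (rhs c). instantiate h' a \<in> facts J)"
        using r by blast
    qed
  next
    assume R: ?R
    show "satisfies (struct_union I J) c"
      unfolding satisfies_def struct_union_def
    proof (intro allI impI, simp only: struct.simps)
      fix h assume "h ` atom_vars (lhs c) \<subseteq> elements I \<union> elements J \<and>
         instantiate h (lhs c) \<in> facts I \<union> facts J"
      then have "instantiate h (lhs c) \<in> facts I" using l by blast
      with R obtain h' where h': "\<forall>x \<in> atom_vars (lhs c). h' x = h x"
        "\<forall>a \<in> set (rhs c). instantiate h' a \<in> facts J" by blast
      then show "\<exists>h'. (\<forall>x \<in> atom_vars (lhs c). h' x = h x) \<and>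
          h' ` rhs_vars c \<subseteq> elements I \<union> elements J \<and>
          (\<forall>a \<in> set (rhs c). instantiate h' a \<in> facts I \<union> facts J)"
        using r'[OF h'(2)] by (intro exI[of _ h']) auto
    qed
  qed
  then show ?thesis by (simp add: image_subset_iff)
qed

text \<open>On the variables of the left-hand side the substitution is determined by
  \<open>\<alpha>\<close> (see \<open>instantiate_matches\<close>), so the choice is
  harmless.\<close>

definition matches :: "fact \<Rightarrow> lav_constraint \<Rightarrow> nat \<Rightarrow> nat" where
  "matches \<alpha> c = (SOME \<gamma>. instantiate \<gamma> (lhs c) = \<alpha>)"

definition qcomponent_of :: "fact \<Rightarrow> lav_constraint \<Rightarrow> qcomponent" where
  "qcomponent_of \<alpha> c = (set (rhs c), atom_vars (lhs c), matches \<alpha> c)"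

definition query_of :: "mapping \<Rightarrow> fact \<Rightarrow> qcomponent set" where
  "query_of M \<alpha> = qcomponent_of \<alpha> ` {c \<in> M. \<exists>\<gamma>. instantiate \<gamma> (lhs c) = \<alpha>}"

lemma instantiate_matches:
  assumes "instantiate \<gamma> (lhs c) = \<alpha>"
  shows "instantiate (matches \<alpha> c) (lhs c) = \<alpha>" "x \<in> atom_vars (lhs c) \<Longrightarrow> matches \<alpha> c x = \<gamma> x"
proof -
  show *: "instantiate (matches \<alpha> c) (lhs c) = \<alpha>" unfolding matches_def by (rule someI[where P = "\<lambda>\<gamma>. instantiate \<gamma> (lhs c) = \<alpha>", OF assms])
  show "x \<in> atom_vars (lhs c) \<Longrightarrow> matches \<alpha> c x = \<gamma> x"
    using assms * by (auto simp: instantiate_def atom_vars_def)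
qed

lemma finite_query_of: "finite M \<Longrightarrow> finite (query_of M \<alpha>)"
  by (simp add: query_of_def)

lemma size_query_of:
  assumes "finite M" shows "(\<Sum>c \<in> query_of M \<alpha>. card (fst c)) \<le> mapping_length M"
proof -
  have "(\<Sum>c \<in> query_of M \<alpha>. card (fst c)) \<le>
      (\<Sum>c \<in> {c \<in> M. \<exists>\<gamma>. instantiate \<gamma> (lhs c) = \<alpha>}. card (fst (qcomponent_of \<alpha> c)))"
    unfolding query_of_def using assms by (intro order_trans[OF sum_image_le]) (simp_all add: o_def)
  also have "\<dots> \<le> (\<Sum>c \<in> M. card (fst (qcomponent_of \<alpha> c)))"
    using assms by (intro sum_mono2) auto
  also have "\<dots> \<le> (\<Sum>c \<in> M. atom_length (lhs c) + sum_list (map atom_length (rhs c)))"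
  proof (rule sum_mono)
    fix c :: lav_constraint
    have "length xs \<le> sum_list (map atom_length xs)" for xs
      by (induction xs) (auto simp: atom_length_def)
    then show "card (fst (qcomponent_of \<alpha> c)) \<le> atom_length (lhs c) + sum_list (map atom_length (rhs c))"
      using card_length[of "rhs c"] by (simp add: qcomponent_of_def) (meson order_trans trans_le_add2)
  qed
  finally show ?thesis by (simp add: mapping_length_def)
qed

lemma membership_query_pos:
  assumes dis: "dom S \<inter> dom T = {}" and M: "lav_mapping S T M" and \<alpha>: "atom_over S \<alpha>"
    and J: "\<And>f. f \<in> set J \<Longrightarrow> T (fst f) = Some (length (snd f))"
  shows "query_pos (membership_query S T M) \<alpha> J \<longleftrightarrow> (\<forall>c \<in> query_of M \<alpha>. maps_into (\<lambda>a. a) c (set J))"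
proof -
  let ?I = "\<lparr>elements = set (snd \<alpha>), facts = {\<alpha>}\<rparr>"
  let ?J = "\<lparr>elements = set (concat (map (\<lambda>f. snd f) J)), facts = set J\<rparr>"
  have str: "is_structure S ?I" "is_structure T ?J"
    using \<alpha> J by (auto simp: is_structure_def atom_over_def)
  \<comment> \<open>The encoded lists determine the sets they represent, so the existential
    quantifier in \<open>membership_query\<close> ranges over a single example.\<close>
  have rep: "represents_example (enc ((snd \<alpha>, [\<alpha>]), (concat (map (\<lambda>f. snd f) J), J))) e \<longleftrightarrow> e = (?I, ?J)" for e
  proof -
    have 1: "represents_structure (Node (enc ds) (enc fs)) A \<longleftrightarrow>
        A = \<lparr>elements = set ds, facts = set fs\<rparr>" for ds fs A
      unfolding represents_structure_enc by (cases A) auto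
    show ?thesis by (cases e) (simp add: represents_example_def 1 del: enc_simps(6) add: enc_simps(4))
  qed
  have "query_pos (membership_query S T M) \<alpha> J \<longleftrightarrow> positive M (?I, ?J)"
    using str unfolding query_pos_def membership_query_def rep by (auto simp: mapping_example_def)
  also have "\<dots> \<longleftrightarrow> (\<forall>c \<in> M. \<forall>h. instantiate h (lhs c) = \<alpha> \<longrightarrow>
      (\<exists>h'. (\<forall>x \<in> atom_vars (lhs c). h' x = h x) \<and> instantiate h' ` set (rhs c) \<subseteq> set J))"
    using satisfies_iff[OF dis str] M by (simp add: positive_def lav_mapping_def)
  also have "\<dots> \<longleftrightarrow> (\<forall>c \<in> M. (\<exists>\<gamma>. instantiate \<gamma> (lhs c) = \<alpha>) \<longrightarrow> maps_into (\<lambda>a. a) (qcomponent_of \<alpha> c) (set J))"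
  proof (intro ball_cong refl iffI impI allI)
    fix c :: lav_constraint
    assume "\<forall>h. instantiate h (lhs c) = \<alpha> \<longrightarrow>
      (\<exists>h'. (\<forall>x \<in> atom_vars (lhs c). h' x = h x) \<and> instantiate h' ` set (rhs c) \<subseteq> set J)"
      "\<exists>\<gamma>. instantiate \<gamma> (lhs c) = \<alpha>"
    then show "maps_into (\<lambda>a. a) (qcomponent_of \<alpha> c) (set J)"
      using instantiate_matches(1) unfolding maps_into_def qcomponent_of_def by auto
  next
    fix c :: lav_constraint and h
    assume "(\<exists>\<gamma>. instantiate \<gamma> (lhs c) = \<alpha>) \<longrightarrow> maps_into (\<lambda>a. a) (qcomponent_of \<alpha> c) (set J)"
      and h: "instantiate h (lhs c) = \<alpha>"
    then show "\<exists>h'. (\<forall>x \<in> atom_vars (lhs c). h' x = h x) \<and> instantiate h' ` set (rhs c) \<subseteq> set J"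
      using instantiate_matches(2)[OF h] unfolding maps_into_def qcomponent_of_def by auto
  qed
  also have "\<dots> \<longleftrightarrow> (\<forall>c \<in> query_of M \<alpha>. maps_into (\<lambda>a. a) c (set J))"
    by (auto simp: query_of_def)
  finally show ?thesis .
qed

lemma target_of_mapping:
  assumes dis: "dom S \<inter> dom T = {}" and M: "c_acyclic_lav_mapping S T M" and \<alpha>: "atom_over S \<alpha>"
    and "\<And>a. a \<in> set (snd \<alpha>) \<Longrightarrow> a < K" and "\<And>s n. T s = Some n \<Longrightarrow> n \<le> r"
  shows "target K r T \<alpha> (query_of M \<alpha>) (membership_query S T M)"
proof
  have lav: "lav_mapping S T M" using M by (simp add: c_acyclic_lav_mapping_def)
  fix c assume "c \<in> query_of M \<alpha>"
  then obtain d where d: "d \<in> M" "c = qcomponent_of \<alpha> d" "instantiate (matches \<alpha> d) (lhs d) = \<alpha>"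
    using instantiate_matches(1) by (auto simp: query_of_def)
  show "finite (fst c)" by (simp add: d qcomponent_of_def)
  show "T (fst f) = Some (length (snd f))" if "f \<in> fst c" for f
    using lav d that by (auto simp: lav_mapping_def atom_over_def qcomponent_of_def)
  show "snd (snd c) x \<in> set (snd \<alpha>)" if "x \<in> fst (snd c)" for x
  proof -
    have "snd \<alpha> = map (matches \<alpha> d) (snd (lhs d))" using d(3) by (metis instantiate_simps(2))
    then show ?thesis using that by (simp add: d(2) qcomponent_of_def atom_vars_def)
  qed
  have "c_acyclic_structure (canonical_structure d) (distinguished_tuple d)"
    using M d(1) by (simp add: c_acyclic_lav_mapping_def)
  then show "no_cycle (\<lambda>u. u \<notin> fst (snd c)) (fst c)"
    unfolding no_cycle_def c_acyclic_structure_def canonical_structure_def distinguished_tuple_def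
      d(2) qcomponent_of_def incidence_cycle_def incidence_edges_def atom_vars_def by simp blast
next
  show "query_pos (membership_query S T M) \<alpha> J \<longleftrightarrow> (\<forall>c \<in> query_of M \<alpha>. maps_into (\<lambda>a. a) c (set J))"
    if "\<And>f. f \<in> set J \<Longrightarrow> T (fst f) = Some (length (snd f))" for J
    using M that by (intro membership_query_pos[OF dis _ \<alpha>]) (simp_all add: c_acyclic_lav_mapping_def)
qed (use assms in auto)

section \<open>Learning a schema mapping\<close>

text \<open>Arguments are positions, so every source fact has a pattern with the same equalities
  among its arguments. An equality type may be represented several times.\<close>

definition patterns :: "schema \<Rightarrow> fact set" where
  "patterns S = {\<alpha>. S (fst \<alpha>) = Some (length (snd \<alpha>)) \<and> set (snd \<alpha>) \<subseteq> {..<length (snd \<alpha>)}}"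

definition full_facts :: "schema \<Rightarrow> nat \<Rightarrow> fact \<Rightarrow> fact set" where
  "full_facts T K \<alpha> = {f. T (fst f) = Some (length (snd f)) \<and> set (snd f) \<subseteq> insert K (set (snd \<alpha>))}"

lemma finite_typed_facts:
  assumes "is_schema S" "finite X"
  shows "finite {f :: fact. S (fst f) = Some (length (snd f)) \<and> set (snd f) \<subseteq> X}"
proof (rule finite_subset)
  show "{f :: fact. S (fst f) = Some (length (snd f)) \<and> set (snd f) \<subseteq> X} \<subseteq>
      (SIGMA s:dom S. {us. set us \<subseteq> X \<and> length us = the (S s)})" by auto
  show "finite (SIGMA s:dom S. {us. set us \<subseteq> X \<and> length us = the (S s)})"
    using assms by (intro finite_SigmaI finite_lists_length_eq) (simp_all add: is_schema_def)
qed

lemma schema_arity_bound: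
  assumes "is_schema S"
  shows "\<exists>k. \<forall>s n. S s = Some n \<longrightarrow> n \<le> k \<and> s \<le> k"
proof -
  have "finite (dom S \<union> the ` S ` dom S)" using assms by (simp add: is_schema_def)
  then obtain k where "\<forall>x \<in> dom S \<union> the ` S ` dom S. x \<le> k" using finite_nat_set_iff_bounded_le by blast
  then show ?thesis by (intro exI[of _ k]) force
qed

lemma finite_patterns:
  assumes "is_schema S" shows "finite (patterns S)"
proof -
  obtain k where k: "\<forall>s n. S s = Some n \<longrightarrow> n \<le> k \<and> s \<le> k"
    using schema_arity_bound[OF assms] by blast
  have "patterns S \<subseteq> {f. S (fst f) = Some (length (snd f)) \<and> set (snd f) \<subseteq> {..<k}}"
    unfolding patterns_def using k by (auto simp: subset_iff) (meson less_le_trans)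
  then show ?thesis using finite_typed_facts[OF assms, of "{..<k}"] finite_subset by blast
qed

text \<open>The pattern of a fact is obtained by replacing each argument by one of its positions.\<close>

definition position_of :: "nat list \<Rightarrow> nat \<Rightarrow> nat" where
  "position_of bs b = (LEAST i. i < length bs \<and> bs ! i = b)"

lemma position_of:
  assumes "b \<in> set bs" shows "position_of bs b < length bs" "bs ! position_of bs b = b"
proof -
  have "\<exists>i. i < length bs \<and> bs ! i = b" using assms by (simp add: in_set_conv_nth)
  from LeastI_ex[OF this] show "position_of bs b < length bs" "bs ! position_of bs b = b"
    by (simp_all add: position_of_def)
qed

definition mapping_of :: "(fact \<times> fact list) list \<Rightarrow> mapping" where
  "mapping_of cs = (\<lambda>c. \<lparr>lhs = fst c, rhs = snd c\<rparr>) ` set cs"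

lemma represents_mapping_of: "represents_mapping (enc cs) (mapping_of cs)"
proof -
  let ?f = "\<lambda>c :: fact \<times> fact list. \<lparr>lhs = fst c, rhs = snd c\<rparr>"
  have "encode_constraint (?f c) = enc c" for c
    by (cases c) (simp add: encode_constraint_def enc_prod_def[of c] enc_list_def flip: enc_fact_fun)
  then have "encode_list encode_constraint (map ?f cs) = enc cs" by (induction cs) simp_all
  then show ?thesis unfolding represents_mapping_def mapping_of_def
    by (intro exI[of _ "map ?f cs"]) simp
qed

text \<open>A match of a pattern in \<open>I\<close> is a substitution \<open>s\<close>. If
  \<open>M\<close> holds, matches of its right-hand sides under \<open>s\<close> give a match of the
  hypothesis by \<open>univ\<close>. Conversely, a right-hand side of \<open>M\<close> maps to the
  hypothesis by \<open>pos\<close> and from there to \<open>J\<close>.\<close>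

lemma logically_equivalent_by_queries:
  assumes dis: "dom S \<inter> dom T = {}" and M: "lav_mapping S T M"
    and dom: "fst ` set cs = patterns S"
    and typed: "\<And>c f. c \<in> set cs \<Longrightarrow> f \<in> set (snd c) \<Longrightarrow> T (fst f) = Some (length (snd f))"
    and pos: "\<And>c q. c \<in> set cs \<Longrightarrow> q \<in> query_of M (fst c) \<Longrightarrow> maps_into (\<lambda>a. a) q (set (snd c))"
    and univ: "\<And>c s G. c \<in> set cs \<Longrightarrow> (\<And>q. q \<in> query_of M (fst c) \<Longrightarrow> maps_into s q G) \<Longrightarrow>
      \<exists>h. (\<forall>a \<in> set (snd (fst c)). h a = s a) \<and> instantiate h ` set (snd c) \<subseteq> G"
  shows "logically_equivalent S T M (mapping_of cs)"
  unfolding logically_equivalent_def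
proof (intro allI impI)
  fix e assume "mapping_example S T e"
  then obtain I J where e: "e = (I, J)" and str: "is_structure S I" "is_structure T J"
    by (cases e) (auto simp: mapping_example_def)
  have typed': "atom_over S (fst c)" "\<forall>a \<in> set (snd c). atom_over T a" if "c \<in> set cs" for c
  proof -
    have "fst c \<in> patterns S" using dom that by blast
    then show "atom_over S (fst c)" by (simp add: patterns_def atom_over_def)
    show "\<forall>a \<in> set (snd c). atom_over T a" using typed[OF that] by (simp add: atom_over_def)
  qed
  have P1: "positive M e \<longleftrightarrow> (\<forall>c \<in> M. \<forall>h. instantiate h (lhs c) \<in> facts I \<longrightarrow>
     (\<exists>h'. (\<forall>x \<in> atom_vars (lhs c). h' x = h x) \<and> instantiate h' ` set (rhs c) \<subseteq> facts J))"
    using satisfies_iff[OF dis str] M by (simp add: e positive_def lav_mapping_def)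
  have P2: "positive (mapping_of cs) e \<longleftrightarrow> (\<forall>c \<in> set cs. \<forall>s. instantiate s (fst c) \<in> facts I \<longrightarrow>
     (\<exists>h. (\<forall>x \<in> set (snd (fst c)). h x = s x) \<and> instantiate h ` set (snd c) \<subseteq> facts J))"
    using satisfies_iff[OF dis str] typed' by (simp add: e positive_def mapping_of_def atom_vars_def)
  show "positive M e \<longleftrightarrow> positive (mapping_of cs) e"
  proof
    assume p: "positive M e"
    show "positive (mapping_of cs) e" unfolding P2
    proof (intro ballI allI impI)
      fix c s assume c: "c \<in> set cs" and s: "instantiate s (fst c) \<in> facts I"
      show "\<exists>h. (\<forall>x \<in> set (snd (fst c)). h x = s x) \<and> instantiate h ` set (snd c) \<subseteq> facts J"
      proof (rule univ[OF c])
        fix q assume "q \<in> query_of M (fst c)"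
        then obtain d where d: "d \<in> M" "q = qcomponent_of (fst c) d"
          "instantiate (matches (fst c) d) (lhs d) = fst c"
          using instantiate_matches(1) unfolding query_of_def by blast
        have "instantiate (s \<circ> matches (fst c) d) (lhs d) = instantiate s (instantiate (matches (fst c) d) (lhs d))"
          by (simp add: instantiate_def)
        then have "instantiate (s \<circ> matches (fst c) d) (lhs d) \<in> facts I" using d(3) s by simp
        then obtain h' where "\<forall>x \<in> atom_vars (lhs d). h' x = (s \<circ> matches (fst c) d) x"
          "instantiate h' ` set (rhs d) \<subseteq> facts J" using p d(1) unfolding P1 by blast
        then show "maps_into s q (facts J)"
          unfolding maps_into_def d(2) qcomponent_of_def by (intro exI[of _ h']) simp
      qed
    qed
  next
    assume p: "positive (mapping_of cs) e"
    show "positive M e" unfolding P1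
    proof (intro ballI allI impI)
      fix d h assume d: "d \<in> M" and h: "instantiate h (lhs d) \<in> facts I"
      define bs where "bs = map h (snd (lhs d))"
      \<comment> \<open>\<open>\<alpha>\<close> keeps the equalities among the arguments
        \<open>bs\<close>, and \<open>s\<close> leads back from positions to arguments.\<close>
      define \<alpha> where "\<alpha> = (fst (lhs d), map (position_of bs) bs)"
      define s where "s j = bs ! j" for j
      have S: "S (fst (lhs d)) = Some (length bs)"
        using M d by (simp add: lav_mapping_def atom_over_def bs_def)
      have "\<alpha> \<in> patterns S" using S position_of(1) by (auto simp: patterns_def \<alpha>_def)
      then obtain c where c: "c \<in> set cs" "fst c = \<alpha>" using dom by (metis imageE)
      have match: "instantiate (position_of bs \<circ> h) (lhs d) = \<alpha>"
        by (simp add: instantiate_def \<alpha>_def bs_def)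
      then have "qcomponent_of \<alpha> d \<in> query_of M (fst c)" using d c by (auto simp: query_of_def)
      from pos[OF c(1) this] obtain g where
        g: "\<forall>x \<in> atom_vars (lhs d). g x = matches \<alpha> d x" "instantiate g ` set (rhs d) \<subseteq> set (snd c)"
        by (auto simp: maps_into_def qcomponent_of_def)
      have "map s (snd \<alpha>) = bs" using position_of(2) by (auto simp: \<alpha>_def s_def intro: map_idI)
      then have "instantiate s \<alpha> = instantiate h (lhs d)"
        by (simp add: instantiate_def \<alpha>_def bs_def)
      then have "instantiate s (fst c) \<in> facts I" using h c(2) by simp
      with p c(1) obtain k where k: "\<forall>x \<in> set (snd (fst c)). k x = s x" "instantiate k ` set (snd c) \<subseteq> facts J"
        unfolding P2 by blast
      have "(k \<circ> g) x = h x" if x: "x \<in> atom_vars (lhs d)" for x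
      proof -
        have hx: "h x \<in> set bs" using x by (simp add: bs_def atom_vars_def)
        have "g x = position_of bs (h x)" using g(1) instantiate_matches(2)[OF match x] x by simp
        moreover have "position_of bs (h x) \<in> set (snd \<alpha>)" using hx by (simp add: \<alpha>_def)
        ultimately show ?thesis using k(1) c(2) position_of(2)[OF hx] by (simp add: s_def)
      qed
      moreover have "instantiate (k \<circ> g) ` set (rhs d) \<subseteq> facts J"
      proof -
        have "instantiate (k \<circ> g) ` set (rhs d) = instantiate k ` instantiate g ` set (rhs d)"
          by (simp add: image_image instantiate_def)
        then show ?thesis using image_mono[OF g(2), of "instantiate k"] k(2) by simp
      qed
      ultimately show "\<exists>h'. (\<forall>x \<in> atom_vars (lhs d). h' x = h x) \<and> instantiate h' ` set (rhs d) \<subseteq> facts J"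
        by blast
    qed
  qed
qed

lemma c_acyclic_mapping_of:
  assumes dom: "fst ` set cs = patterns S"
    and typed: "\<And>c f. c \<in> set cs \<Longrightarrow> f \<in> set (snd c) \<Longrightarrow> T (fst f) = Some (length (snd f))"
    and const: "\<And>c f u. c \<in> set cs \<Longrightarrow> f \<in> set (snd c) \<Longrightarrow> u \<in> set (snd f) \<Longrightarrow> u < K \<Longrightarrow> u \<in> set (snd (fst c))"
    and nc: "\<And>c. c \<in> set cs \<Longrightarrow> no_cycle (\<lambda>u. \<not> u < K) (set (snd c))"
  shows "c_acyclic_lav_mapping S T (mapping_of cs)"
proof -
  have "lav_mapping S T (mapping_of cs)"
    using dom typed by (auto simp: lav_mapping_def mapping_of_def patterns_def atom_over_def)
  moreover have "\<exists>x \<in> set (snd (fst c)). Elem x \<in> set vs"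
    if c: "c \<in> set cs" and cyc: "incidence_cycle \<lparr>elements = X, facts = set (snd c)\<rparr> vs es" for c X vs es
  proof -
    have "incidence_cycle \<lparr>elements = {}, facts = set (snd c)\<rparr> vs es"
      using cyc by (simp add: incidence_cycle_def incidence_edges_def)
    then obtain x where x: "x < K" "Elem x \<in> set vs" using nc[OF c] unfolding no_cycle_def by blast
    \<comment> \<open>A vertex of a cycle is an endpoint of one of its edges, so \<open>x\<close>
      occurs in a fact and \<open>const\<close> applies.\<close>
    then obtain i where i: "i < length es" "vs ! i = Elem x"
      using cyc by (auto simp: incidence_cycle_def in_set_conv_nth)
    then have "Elem x \<in> endpoints (es ! i)" "es ! i \<in> set es"
      using cyc by (auto simp: incidence_cycle_def)
    then have "fst (es ! i) \<in> set (snd c)" "snd (es ! i) < length (snd (fst (es ! i)))"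
      "x = snd (fst (es ! i)) ! snd (es ! i)"
      using cyc by (auto simp: incidence_cycle_def incidence_edges_def endpoints_def)
    then have "x \<in> set (snd (fst c))" using const[OF c _ _ x(1)] nth_mem by metis
    then show ?thesis using x by blast
  qed
  ultimately show ?thesis
    by (auto simp: c_acyclic_lav_mapping_def c_acyclic_structure_def canonical_structure_def
        distinguished_tuple_def mapping_of_def)
qed

lemma logically_equivalent_query:
  "logically_equivalent S T M M' \<Longrightarrow> membership_query S T M = membership_query S T M'"
  by (rule ext) (auto simp: logically_equivalent_def membership_query_def)

lemma learning_program:
  fixes S T :: schema
  assumes S: "is_schema S" and T: "is_schema T" and dis: "dom S \<inter> dom T = {}"
  shows "\<exists>(P :: program) (p :: nat poly). \<forall>M. c_acyclic_lav_mapping S T M \<longrightarrow>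
    (\<exists>v t M'. outputs_in_time (membership_query S T M) P v t \<and> t \<le> poly p (mapping_length M) \<and>
      represents_mapping v M' \<and> c_acyclic_lav_mapping S T M' \<and> logically_equivalent S T M M')"
proof -
  obtain K where K: "\<forall>s n. S s = Some n \<longrightarrow> n \<le> K \<and> s \<le> K"
    using schema_arity_bound[OF S] by blast
  obtain r where "\<forall>s n. T s = Some n \<longrightarrow> n \<le> r \<and> s \<le> r"
    using schema_arity_bound[OF T] by blast
  then have r: "\<And>s n. T s = Some n \<Longrightarrow> n \<le> r" "\<And>s n. T s = Some n \<Longrightarrow> s \<le> r" by blast+
  obtain as where as: "set as = patterns S" using finite_list[OF finite_patterns[OF S]] by blast
  define full where "full \<alpha> = (SOME J. set J = full_facts T K \<alpha>)" for \<alpha>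
  have full: "set (full \<alpha>) = full_facts T K \<alpha>" for \<alpha>
    unfolding full_def full_facts_def
    by (rule someI_ex, rule finite_list) (use finite_typed_facts[OF T] in simp)
  define cs0 where "cs0 = map (\<lambda>\<alpha>. (\<alpha>, full \<alpha>)) as"
  obtain P p where P: "\<And>Q N B. step K r Q ((step K r Q ^^ N) (start cs0 Q ())) = (step K r Q ^^ N) (start cs0 Q ()) \<Longrightarrow>
       (\<And>i. size (enc ((step K r Q ^^ i) (start cs0 Q ()))) \<le> B) \<Longrightarrow>
       \<exists>t \<le> (N + 2) * poly p B. outputs_in_time Q P (enc ((step K r Q ^^ N) (start cs0 Q ()))) t"
    by (rule PT_iterate[OF PT_start[of cs0] PT_step[of K r]]) blast
  \<comment> \<open>\<open>A\<close> bounds the size of a pattern, \<open>pV\<close> is the bound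
    \<open>V\<close> on names, \<open>pB\<close> bounds the size of a whole state, and
    \<open>pN\<close> the total bulk and hence the number of rounds.\<close>
  define A where "A = (\<Sum>\<alpha>\<leftarrow>as. size (enc \<alpha>))"
  define pV where "pV = [:K:] + [:0,1:] * [:2,1:] ^ r * [:r:]"
  define pB where "pB = [:length as:] * ([:A:] + [:0,1:] * ([:r:] + [:r:] * (pV + 1) + 2) + 2)"
  define pN where "pN = [:length as:] * ([:0,1:] * [:r + 1:])"
  define pT where "pT = (pN + 2) * pcompose p pB"
  show ?thesis
  proof (intro exI[of _ P] exI[of _ pT] allI impI)
    fix M assume M: "c_acyclic_lav_mapping S T M"
    then have lav: "lav_mapping S T M" and fin: "finite M"
      by (simp_all add: c_acyclic_lav_mapping_def lav_mapping_def)
    define n where "n = mapping_length M"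
    define Q where "Q = membership_query S T M"
    define V where "V = K + n * (n + 2) ^ r * r"
    have tgt: "target K r T \<alpha> (query_of M \<alpha>) Q" if "\<alpha> \<in> patterns S" for \<alpha>
      unfolding Q_def
    proof (rule target_of_mapping[OF dis M])
      show "atom_over S \<alpha>" using that by (simp add: patterns_def atom_over_def)
      show "a < K" if "a \<in> set (snd \<alpha>)" for a
        using K[rule_format, of "fst \<alpha>" "length (snd \<alpha>)"] that \<open>\<alpha> \<in> patterns S\<close> by (fastforce simp: patterns_def)
    qed (rule r(1))
    have bound: "finite (query_of M \<alpha>)" "(\<Sum>c \<in> query_of M \<alpha>. card (fst c)) \<le> n" for \<alpha>
      using finite_query_of[OF fin] size_query_of[OF fin] by (simp_all add: n_def)
    define inv where "inv cs \<longleftrightarrow> map fst cs = as \<and>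
      (\<forall>c \<in> set cs. target.good K T (fst c) (query_of M (fst c)) V (snd c))" for cs
    \<comment> \<open>All patterns improve in parallel and may stop at different times; the sum
      grows as long as one of them does.\<close>
    define \<Phi> where "\<Phi> cs = (\<Sum>c\<leftarrow>cs. length (bulk K (snd c)))" for cs :: "(fact \<times> fact list) list"
    have inv_tgt: "target K r T (fst c) (query_of M (fst c)) Q"
      "target.good K T (fst c) (query_of M (fst c)) V (snd c)" if "inv cs" "c \<in> set cs" for cs c
    proof -
      have "fst c \<in> set (map fst cs)" using that(2) by simp
      then have "fst c \<in> patterns S" using that(1) as by (simp only: inv_def)
      then show "target K r T (fst c) (query_of M (fst c)) Q" by (rule tgt)
      show "target.good K T (fst c) (query_of M (fst c)) V (snd c)" using that by (simp add: inv_def)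
    qed
    have imp: "fst (improve Q K r c) = fst c"
      "target.good K T (fst c) (query_of M (fst c)) V (snd (improve Q K r c))"
      "improve Q K r c \<noteq> c \<Longrightarrow> length (bulk K (snd c)) < length (bulk K (snd (improve Q K r c)))"
      "length (bulk K (snd c)) \<le> length (bulk K (snd (improve Q K r c)))"
      if "inv cs" "c \<in> set cs" for cs c
      using target.improve_good[OF inv_tgt(1)[OF that] bound inv_tgt(2)[OF that] V_def] by simp_all
    have inv_start: "inv (start cs0 Q ())"
    proof -
      have "target.good K T \<alpha> (query_of M \<alpha>) V (minimize Q \<alpha> (full \<alpha>))" if "\<alpha> \<in> patterns S" for \<alpha>
        using target.minimize_full_good[OF tgt[OF that], of "full \<alpha>" V] full[of \<alpha>]
        by (simp add: full_facts_def V_def)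
      then show ?thesis by (auto simp: inv_def start_def cs0_def as o_def)
    qed
    have inv_step: "inv (step K r Q cs)" if "inv cs" for cs
    proof -
      have "map fst (step K r Q cs) = map fst cs" using imp(1)[OF that] by (simp add: step_def)
      then show ?thesis using imp(1,2)[OF that] that by (auto simp: inv_def step_def)
    qed
    have inc: "\<Phi> cs < \<Phi> (step K r Q cs)" if asm: "inv cs" "step K r Q cs \<noteq> cs" for cs
    proof -
      obtain c where c: "c \<in> set cs" "improve Q K r c \<noteq> c"
        using asm(2) unfolding step_def by (metis map_idI)
      obtain ds es where ds: "cs = ds @ c # es" using c(1) by (meson split_list)
      have "(\<Sum>c\<leftarrow>ds. length (bulk K (snd c))) \<le> (\<Sum>c\<leftarrow>ds. length (bulk K (snd (improve Q K r c))))"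
        "(\<Sum>c\<leftarrow>es. length (bulk K (snd c))) \<le> (\<Sum>c\<leftarrow>es. length (bulk K (snd (improve Q K r c))))"
        using imp(4)[OF asm(1)] by (auto intro!: sum_list_mono simp: ds)
      then show ?thesis using imp(3)[OF asm(1) c] by (simp add: \<Phi>_def step_def ds o_def)
    qed
    have le: "\<Phi> cs \<le> poly pN n" if "inv cs" for cs
    proof -
      have "\<Phi> cs \<le> length cs * (n * (r + 1))" unfolding \<Phi>_def
      proof (rule sum_list_le_mult)
        fix c assume "c \<in> set cs"
        from target.bulk_bound(1)[OF inv_tgt(1)[OF that this] bound inv_tgt(2)[OF that this]]
        show "length (bulk K (snd c)) \<le> n * (r + 1)" .
      qed
      moreover have "length cs = length as" using that unfolding inv_def by (metis length_map)
      ultimately show ?thesis by (simp add: pN_def algebra_simps)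
    qed
    define cs where "cs = (step K r Q ^^ poly pN n) (start cs0 Q ())"
    have inv_i: "inv ((step K r Q ^^ i) (start cs0 Q ()))" for i
      using inv_start inv_step by (induction i) auto
    have fixp: "step K r Q cs = cs"
      unfolding cs_def by (rule iterate_reaches_fixpoint[where P = inv and \<Phi> = \<Phi>]) (use inv_start inv_step inc le in auto)
    have size: "size (enc ((step K r Q ^^ i) (start cs0 Q ()))) \<le> poly pB n" for i
    proof -
      let ?cs = "(step K r Q ^^ i) (start cs0 Q ())"
      have len: "length ?cs = length as" using inv_i[of i] unfolding inv_def by (metis length_map)
      have "size (enc c) + 1 \<le> A + n * (r + r * (V + 1) + 2) + 2" if c: "c \<in> set ?cs" for c
      proof -
        note t = inv_tgt[OF inv_i c]
        have "fst c \<in> set as" using inv_i[of i] c unfolding inv_def by (metis image_eqI set_map)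
        then have "size (enc (fst c)) \<le> A" unfolding A_def by (intro member_le_sum_list) simp_all
        moreover have "size (enc (snd c)) \<le> length (snd c) * (r + r * (V + 1) + 2)"
          unfolding size_enc_list
        proof (rule sum_list_le_mult)
          fix f assume f: "f \<in> set (snd c)"
          then have Tf: "T (fst f) = Some (length (snd f))" "\<forall>u \<in> set (snd f). u \<le> V"
            using t(2) unfolding target.good_def[OF t(1)] target.wf_def[OF t(1)] by auto
          have "size (enc (fst f, snd f)) \<le> r + r * (V + 1) + 1"
            using Tf r[OF Tf(1)] by (intro size_enc_fact) auto
          then show "size (enc f) + 1 \<le> r + r * (V + 1) + 2" by simp
        qed
        moreover have "length (snd c) * (r + r * (V + 1) + 2) \<le> n * (r + r * (V + 1) + 2)"
          using target.bulk_bound(2)[OF t(1) bound t(2)] by (rule mult_le_mono1)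
        moreover have "size (enc c) = size (enc (fst c)) + size (enc (snd c)) + 1"
          by (simp add: enc_prod_def)
        ultimately show ?thesis by linarith
      qed
      then have "size (enc ?cs) \<le> length as * (A + n * (r + r * (V + 1) + 2) + 2)"
        unfolding size_enc_list len[symmetric] by (rule sum_list_le_mult)
      also have "\<dots> = poly pB n" by (simp add: pB_def pV_def V_def algebra_simps)
      finally show ?thesis .
    qed
    from P[of Q "poly pN n" "poly pB n", folded cs_def, OF fixp size] obtain t where
      t: "t \<le> (poly pN n + 2) * poly p (poly pB n)" "outputs_in_time Q P (enc cs) t" by blast
    have inv: "inv cs" using inv_i by (simp add: cs_def)
    have dom: "fst ` set cs = patterns S" using inv as unfolding inv_def by (metis set_map)
    have fc: "improve Q K r c = c" if "c \<in> set cs" for c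
      using fixp that unfolding step_def by (metis map_idI map_eq_conv list.map_id0 id_apply)
    have good: "target.wf K T (fst c) (set (snd c))" "target.minimal (query_of M (fst c)) (set (snd c))"
      if "c \<in> set cs" for c
      using inv_tgt[OF inv that] by (simp_all add: target.good_def)
    have typed: "T (fst f) = Some (length (snd f))" "\<And>u. u \<in> set (snd f) \<Longrightarrow> u < K \<Longrightarrow> u \<in> set (snd (fst c))"
      if "c \<in> set cs" "f \<in> set (snd c)" for c f
      using good(1)[OF that(1)] that(2) unfolding target.wf_def[OF inv_tgt(1)[OF inv that(1)]] by auto
    have fp: "improve Q K r (fst c, snd c) = (fst c, snd c)" if "c \<in> set cs" for c using fc[OF that] by simp
    have "c_acyclic_lav_mapping S T (mapping_of cs)"
    proof (rule c_acyclic_mapping_of[OF dom typed(1)])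
      fix c assume c: "c \<in> set cs"
      show "no_cycle (\<lambda>u. \<not> u < K) (set (snd c))"
        by (rule target.improve_fixpoint(1)[OF inv_tgt(1)[OF inv c] good[OF c] fp[OF c]])
    qed (use typed in auto)
    moreover have "logically_equivalent S T M (mapping_of cs)"
    proof (rule logically_equivalent_by_queries[OF dis lav dom typed(1)])
      fix c q assume c: "c \<in> set cs" and q: "q \<in> query_of M (fst c)"
      show "maps_into (\<lambda>a. a) q (set (snd c))"
        using good(2)[OF c] q target.minimal_def[OF inv_tgt(1)[OF inv c]] target.pos_def[OF inv_tgt(1)[OF inv c]]
        by blast
    next
      fix c s G assume c: "c \<in> set cs" and G: "\<And>q. q \<in> query_of M (fst c) \<Longrightarrow> maps_into s q G"
      show "\<exists>h. (\<forall>a \<in> set (snd (fst c)). h a = s a) \<and> instantiate h ` set (snd c) \<subseteq> G"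
        by (rule target.improve_fixpoint(2)[OF inv_tgt(1)[OF inv c] good[OF c] fp[OF c] G])
    qed
    moreover have "t \<le> poly pT n" using t(1) by (simp add: pT_def poly_pcompose)
    ultimately show "\<exists>v t M'. outputs_in_time (membership_query S T M) P v t \<and>
       t \<le> poly pT (mapping_length M) \<and> represents_mapping v M' \<and>
       c_acyclic_lav_mapping S T M' \<and> logically_equivalent S T M M'"
      using t(2) represents_mapping_of unfolding Q_def n_def by blast
  qed
qed

theorem theorem6p6:
  fixes S T :: schema
  assumes "is_schema S" and "is_schema T" and "dom S \<inter> dom T = {}"
  shows "\<exists>(P :: program) (p :: nat poly).
           \<forall>M. c_acyclic_lav_mapping S T M \<longrightarrow>
             (\<exists>v t M'. outputs_in_time (membership_query S T M) P v t \<and>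
                t \<le> poly p (mapping_size S T M) \<and>
                represents_mapping v M' \<and>
                c_acyclic_lav_mapping S T M' \<and>
                logically_equivalent S T M M')"
proof -
  obtain P p where P: "\<And>M. c_acyclic_lav_mapping S T M \<Longrightarrow>
    \<exists>v t M'. outputs_in_time (membership_query S T M) P v t \<and> t \<le> poly p (mapping_length M) \<and>
      represents_mapping v M' \<and> c_acyclic_lav_mapping S T M' \<and> logically_equivalent S T M M'"
    using learning_program[OF assms] by blast
  show ?thesis
  proof (intro exI[of _ P] exI[of _ p] allI impI)
    fix M assume "c_acyclic_lav_mapping S T M"
    then have "\<exists>n M'. c_acyclic_lav_mapping S T M' \<and> logically_equivalent S T M M' \<and> mapping_length M' = n"
      by (auto simp: logically_equivalent_def)
    from LeastI_ex[OF this] obtain M0 where M0: "c_acyclic_lav_mapping S T M0"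
      "logically_equivalent S T M M0" "mapping_length M0 = mapping_size S T M"
      unfolding mapping_size_def by blast
    \<comment> \<open>The oracle depends only on the class of logical equivalence, so the run is the
      same as for the smallest representation \<open>M0\<close>, whose length is the size of
      \<open>M\<close>.\<close>
    then have "membership_query S T M = membership_query S T M0"
      by (intro logically_equivalent_query)
    then obtain v t M' where "outputs_in_time (membership_query S T M) P v t"
      "t \<le> poly p (mapping_size S T M)" "represents_mapping v M'" "c_acyclic_lav_mapping S T M'"
      "logically_equivalent S T M0 M'" using P[OF M0(1)] M0(3) by metis
    moreover from this have "logically_equivalent S T M M'"
      using M0(2) by (auto simp: logically_equivalent_def)
    ultimately show "\<exists>v t M'. outputs_in_time (membership_query S T M) P v t \<and>
       t \<le> poly p (mapping_size S T M) \<and> represents_mapping v M' \<and>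
       c_acyclic_lav_mapping S T M' \<and> logically_equivalent S T M M'" by blast
  qed
qed

end
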